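(* Let $X$ be a one-sided subshift over the finite alphabet $\mathfrak a$. Then $\mathcal O_X$ is the universal unital $C^*$-algebra generated by partial isometries $\{S_a\}_{a\in\mathfrak a}$ satisfying (a) $\sum_{a\in\mathfrak a}S_aS_a^*=I$, (b) $S_\mu^*S_\mu S_\nu S_\nu^*=S_\nu S_\nu^*S_\mu^*S_\mu$ for all $\mu,\nu\in\mathfrak a^*$, (c) the map $1_{\sigma^{|\mu|}(C(\mu))}\mapsto S_\mu^*S_\mu$ ($\mu\in\mathfrak a^*$) extends to a unital $*$-homomorphism from $\widetilde{\mathcal A}_X$ to the $C^*$-algebra generated by $\{S_a\}_{a\in\mathfrak a}$, where $S_\mu=S_{\mu_1}\cdots S_{\mu_{|\mu|}}$ for $\mu\in\mathfrak a^*$ and $S_\epsilon=I$. Explicitly: the elements $S_a=k_{\mathsf H_X}(\xi_a)$, $a\in\mathfrak a$, are partial isometries which generate the unital $C^*$-algebra $\mathcal O_X$ and satisfy (a), (b), (c); and whenever $B$ is a unital $C^*$-algebra generated by partial isometries $\{T_a\}_{a\in\mathfrak a}$ satisfying (a), (b), (c) (with $T$ in place of $S$), there is a $*$-homomorphism $\mathcal O_X\to B$ mapping $S_a$ to $T_a$ for every $a\in\mathfrak a$.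
   Context: Subshifts. Let $\mathfrak a$ be a finite set (the alphabet) with the discrete topology, $\mathbb N_0=\{0,1,2,\dots\}$, and give $\mathfrak a^{\mathbb N_0}$ the product topology. The shift is $(\sigma(x))_i=x_{i+1}$. A (one-sided) subshift is a closed set $X\subseteq\mathfrak a^{\mathbb N_0}$ with $\sigma(X)\subseteq X$ (equality is not required), together with the restriction of $\sigma$ to $X$. Let $\mathfrak a^*$ be the set of all finite words over $\mathfrak a$, including the empty word $\epsilon$; $|\mu|$ is the length of $\mu$. For $\mu,\nu\in\mathfrak a^*$ put $C(\mu)=\{x\in X: (x_0,\dots,x_{|\mu|-1})=\mu\}$ and $C(\mu,\nu)=C(\nu)\cap\sigma^{-|\nu|}(\sigma^{|\mu|}(C(\mu)))=\{\nu x\in X:\mu x\in X\}$, where $\sigma^{-n}(Y)$ denotes the preimage of $Y\subseteq X$ under $\sigma^n|_X$. Note $\sigma^{|\mu|}(C(\mu))=C(\mu,\epsilon)=\{x\in X:\mu x\in X\}$. Let $\mathfrak B(X)$ be the $C^*$-algebra of all bounded complex functions on $X$, let $\widetilde{\mathcal D}_X$ be its $C^*$-subalgebra generated by $\{1_{C(\mu,\nu)}:\mu,\nu\in\mathfrak a^*\}$, and let $\widetilde{\mathcal A}_X$ be the $C^*$-subalgebra of $\widetilde{\mathcal D}_X$ generated by $\{1_{\sigma^{|\mu|}(C(\mu))}:\mu\in\mathfrak a^*\}$. Cuntz-Pimsner algebras. Let $\mathsf H$ be a right Hilbert module over a $C^*$-algebra $\mathcal A$ (inner product linear in the second variable), $\mathcal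 L(\mathsf H)$ the adjointable operators, $\theta_{\xi,\eta}(\zeta)=\xi\langle\eta,\zeta\rangle$, and $\mathcal K(\mathsf H)$ the closed linear span of the $\theta_{\xi,\eta}$. A $*$-homomorphism $\phi:\mathcal A\to\mathcal L(\mathsf H)$ makes $\mathsf H$ a $C^*$-correspondence over $\mathcal A$. A Toeplitz representation $(\psi,\pi)$ of $\mathsf H$ in a $C^*$-algebra $B$ is a linear map $\psi:\mathsf H\to B$ and a $*$-homomorphism $\pi:\mathcal A\to B$ with $\psi(\xi a)=\psi(\xi)\pi(a)$, $\psi(\xi)^*\psi(\eta)=\pi(\langle\xi,\eta\rangle)$, $\psi(\phi(a)\xi)=\pi(a)\psi(\xi)$; it induces a $*$-homomorphism $\pi^{(1)}:\mathcal K(\mathsf H)\to B$ with $\pi^{(1)}(\theta_{\xi,\eta})=\psi(\xi)\psi(\eta)^*$. It is Cuntz-Pimsner coinvariant if $\pi^{(1)}(\phi(a))=\pi(a)$ for all $a\in\phi^{-1}(\mathcal K(\mathsf H))$. The Cuntz-Pimsner algebra $\mathcal O_{\mathsf H}$ is the $C^*$-algebra (unique up to isomorphism) with a Cuntz-Pimsner coinvariant Toeplitz representation $(k_{\mathsf H},k_{\mathcal A})$ in it such that $\mathcal O_{\mathsf H}$ is generated by $k_{\mathsf H}(\mathsf H)\cup k_{\mathcal A}(\mathcal A)$ and every Cuntz-Pimsner coinvariant Toeplitz representation $(\psi,\pi)$ of $\mathsf H$ is of the form $(\rho\circ k_{\mathsf H},\rho\circ k_{\mathcal A})$ for a $*$-homomorphism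 $\rho$ of $\mathcal O_{\mathsf H}$. The algebra $\mathcal O_X$. For $a\in\mathfrak a$ let $\widetilde{\mathcal D}_a$ be the (closed) ideal of $\widetilde{\mathcal D}_X$ generated by $1_{\sigma(C(a))}$. Let $\mathsf H_X=\bigoplus_{a\in\mathfrak a}\widetilde{\mathcal D}_a$, a right Hilbert $\widetilde{\mathcal D}_X$-module with $(f_a)_af=(f_af)_a$ and $\langle(f_a)_a,(g_a)_a\rangle=\sum_{a}f_a^*g_a$. For $a\in\mathfrak a$, $f\in\mathfrak B(X)$, $x\in X$ let $\widetilde\lambda_a(f)(x)=f(ax)$ if $ax\in X$ and $0$ otherwise; $\widetilde\lambda_a$ maps $\widetilde{\mathcal D}_X$ into $\widetilde{\mathcal D}_a$. Then $\mathsf H_X$ is a $C^*$-correspondence over $\widetilde{\mathcal D}_X$ via $\phi(f)((f_a)_a)=(\widetilde\lambda_a(f)f_a)_a$. Define $\mathcal O_X:=\mathcal O_{\mathsf H_X}$, with canonical maps $k_{\mathsf H_X},k_{\widetilde{\mathcal D}_X}$. It is unital with unit $I$. For $a\in\mathfrak a$, $\xi_a\in\mathsf H_X$ is the element with $a$-coordinate $1_{\sigma(C(a))}$ and all other coordinates $0$. *)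

theory Defs
  imports "HOL-Analysis.Analysis" "HOL-Algebra.Module"
begin

section \<open>C*-algebras\<close>

definition complex_field :: "complex ring" where
  "complex_field = \<lparr>carrier = UNIV, mult = (*), one = 1, zero = 0, add = (+)\<rparr>"

(* The complex vector space structure is that of a module over complex_field. C*-algebras need
   not be unital: the field "one" inherited from the module record carries no meaning here, units
   are expressed by cstar_unit below. *)
record 'b cstar = "(complex, 'b) module" +
  star :: "'b \<Rightarrow> 'b"
  nrm :: "'b \<Rightarrow> real"

(* The locale Metric_space wants nonnegativity and symmetry also outside the carrier. *)
definition cstar_dist :: "('b, 'm) cstar_scheme \<Rightarrow> 'b \<Rightarrow> 'b \<Rightarrow> real" where
  "cstar_dist A x y =
     (if x \<in> carrier A \<and> y \<in> carrier A then nrm A (x \<ominus>\<^bsub>A\<^esub> y) else 0)"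

locale cstar_algebra = module complex_field A for A :: "('b, 'm) cstar_scheme" (structure) +
  assumes mult_closed: "\<lbrakk>x \<in> carrier A; y \<in> carrier A\<rbrakk> \<Longrightarrow> x \<otimes> y \<in> carrier A"
    and mult_assoc:
      "\<lbrakk>x \<in> carrier A; y \<in> carrier A; z \<in> carrier A\<rbrakk> \<Longrightarrow> (x \<otimes> y) \<otimes> z = x \<otimes> (y \<otimes> z)"
    and mult_l_distr:
      "\<lbrakk>x \<in> carrier A; y \<in> carrier A; z \<in> carrier A\<rbrakk> \<Longrightarrow> (x \<oplus> y) \<otimes> z = x \<otimes> z \<oplus> y \<otimes> z"
    and mult_r_distr:
      "\<lbrakk>x \<in> carrier A; y \<in> carrier A; z \<in> carrier A\<rbrakk> \<Longrightarrow> z \<otimes> (x \<oplus> y) = z \<otimes> x \<oplus> z \<otimes> y"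
    and mult_smult_left:
      "\<lbrakk>x \<in> carrier A; y \<in> carrier A\<rbrakk> \<Longrightarrow> (c \<odot>\<^bsub>A\<^esub> x) \<otimes> y = c \<odot>\<^bsub>A\<^esub> (x \<otimes> y)"
    and mult_smult_right:
      "\<lbrakk>x \<in> carrier A; y \<in> carrier A\<rbrakk> \<Longrightarrow> x \<otimes> (c \<odot>\<^bsub>A\<^esub> y) = c \<odot>\<^bsub>A\<^esub> (x \<otimes> y)"
    and star_closed: "x \<in> carrier A \<Longrightarrow> star A x \<in> carrier A"
    and star_star: "x \<in> carrier A \<Longrightarrow> star A (star A x) = x"
    and star_add:
      "\<lbrakk>x \<in> carrier A; y \<in> carrier A\<rbrakk> \<Longrightarrow> star A (x \<oplus> y) = star A x \<oplus> star A y"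
    and star_smult: "x \<in> carrier A \<Longrightarrow> star A (c \<odot>\<^bsub>A\<^esub> x) = cnj c \<odot>\<^bsub>A\<^esub> star A x"
    and star_mult:
      "\<lbrakk>x \<in> carrier A; y \<in> carrier A\<rbrakk> \<Longrightarrow> star A (x \<otimes> y) = star A y \<otimes> star A x"
    and nrm_nonneg: "x \<in> carrier A \<Longrightarrow> 0 \<le> nrm A x"
    and nrm_eq_zero: "x \<in> carrier A \<Longrightarrow> nrm A x = 0 \<longleftrightarrow> x = \<zero>"
    and nrm_triangle:
      "\<lbrakk>x \<in> carrier A; y \<in> carrier A\<rbrakk> \<Longrightarrow> nrm A (x \<oplus> y) \<le> nrm A x + nrm A y"
    and nrm_smult: "x \<in> carrier A \<Longrightarrow> nrm A (c \<odot>\<^bsub>A\<^esub> x) = cmod c * nrm A x"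
    and nrm_mult:
      "\<lbrakk>x \<in> carrier A; y \<in> carrier A\<rbrakk> \<Longrightarrow> nrm A (x \<otimes> y) \<le> nrm A x * nrm A y"
    and cstar_identity: "x \<in> carrier A \<Longrightarrow> nrm A (star A x \<otimes> x) = (nrm A x)\<^sup>2"
    and complete: "Metric_space.mcomplete (carrier A) (cstar_dist A)"

definition cstar_unit :: "('b, 'm) cstar_scheme \<Rightarrow> 'b \<Rightarrow> bool" where
  "cstar_unit A e \<longleftrightarrow>
     e \<in> carrier A \<and> (\<forall>x\<in>carrier A. e \<otimes>\<^bsub>A\<^esub> x = x \<and> x \<otimes>\<^bsub>A\<^esub> e = x)"

definition partial_isometry :: "('b, 'm) cstar_scheme \<Rightarrow> 'b \<Rightarrow> bool" where
  "partial_isometry A s \<longleftrightarrow> s \<in> carrier A \<and> s \<otimes>\<^bsub>A\<^esub> star A s \<otimes>\<^bsub>A\<^esub> s = s"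

definition star_hom :: "('b, 'm) cstar_scheme \<Rightarrow> ('c, 'n) cstar_scheme \<Rightarrow> ('b \<Rightarrow> 'c) \<Rightarrow> bool" where
  "star_hom A B h \<longleftrightarrow>
     h \<in> carrier A \<rightarrow> carrier B \<and>
     (\<forall>x\<in>carrier A. \<forall>y\<in>carrier A. h (x \<oplus>\<^bsub>A\<^esub> y) = h x \<oplus>\<^bsub>B\<^esub> h y) \<and>
     (\<forall>c. \<forall>x\<in>carrier A. h (c \<odot>\<^bsub>A\<^esub> x) = c \<odot>\<^bsub>B\<^esub> h x) \<and>
     (\<forall>x\<in>carrier A. \<forall>y\<in>carrier A. h (x \<otimes>\<^bsub>A\<^esub> y) = h x \<otimes>\<^bsub>B\<^esub> h y) \<and>
     (\<forall>x\<in>carrier A. h (star A x) = star B (h x))"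

definition closed_subspace :: "('b, 'm) cstar_scheme \<Rightarrow> 'b set \<Rightarrow> bool" where
  "closed_subspace A V \<longleftrightarrow>
     V \<subseteq> carrier A \<and> \<zero>\<^bsub>A\<^esub> \<in> V \<and>
     (\<forall>x\<in>V. \<forall>y\<in>V. x \<oplus>\<^bsub>A\<^esub> y \<in> V) \<and>
     (\<forall>c. \<forall>x\<in>V. c \<odot>\<^bsub>A\<^esub> x \<in> V) \<and>
     closedin (Metric_space.mtopology (carrier A) (cstar_dist A)) V"

definition closed_span :: "('b, 'm) cstar_scheme \<Rightarrow> 'b set \<Rightarrow> 'b set" where
  "closed_span A G = \<Inter>{V. closed_subspace A V \<and> G \<subseteq> V}"

definition closed_ideal :: "('b, 'm) cstar_scheme \<Rightarrow> 'b set \<Rightarrow> bool" where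
  "closed_ideal A J \<longleftrightarrow>
     closed_subspace A J \<and>
     (\<forall>x\<in>J. \<forall>y\<in>carrier A. x \<otimes>\<^bsub>A\<^esub> y \<in> J \<and> y \<otimes>\<^bsub>A\<^esub> x \<in> J)"

definition generated_ideal :: "('b, 'm) cstar_scheme \<Rightarrow> 'b set \<Rightarrow> 'b set" where
  "generated_ideal A G = \<Inter>{J. closed_ideal A J \<and> G \<subseteq> J}"

definition cstar_subalgebra :: "('b, 'm) cstar_scheme \<Rightarrow> 'b set \<Rightarrow> bool" where
  "cstar_subalgebra A S \<longleftrightarrow>
     closed_subspace A S \<and>
     (\<forall>x\<in>S. \<forall>y\<in>S. x \<otimes>\<^bsub>A\<^esub> y \<in> S) \<and> (\<forall>x\<in>S. star A x \<in> S)"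

definition cstar_generated :: "('b, 'm) cstar_scheme \<Rightarrow> 'b set \<Rightarrow> 'b set" where
  "cstar_generated A G = \<Inter>{S. cstar_subalgebra A S \<and> G \<subseteq> S}"

section \<open>Operators on Hilbert modules and Cuntz-Pimsner algebras\<close>

(* As for HOL-Algebra modules, the fields "mult" and "one" carry no meaning. *)
record ('h, 'b) hilbert_module = "(complex, 'h) module" +
  ract :: "'h \<Rightarrow> 'b \<Rightarrow> 'h"
  iprod :: "'h \<Rightarrow> 'h \<Rightarrow> 'b"

definition hnorm :: "('b, 'm) cstar_scheme \<Rightarrow> ('h, 'b, 'n) hilbert_module_scheme \<Rightarrow> 'h \<Rightarrow> real" where
  "hnorm A H \<xi> = sqrt (nrm A (iprod H \<xi> \<xi>))"

(* Operators on H are functions extensional on carrier H, so that equality of operators is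
   equality of functions and the adjoint is unique. *)
definition adjoint_pair :: "('h, 'b, 'n) hilbert_module_scheme \<Rightarrow> ('h \<Rightarrow> 'h) \<Rightarrow> ('h \<Rightarrow> 'h) \<Rightarrow> bool" where
  "adjoint_pair H T T' \<longleftrightarrow>
     T \<in> carrier H \<rightarrow>\<^sub>E carrier H \<and> T' \<in> carrier H \<rightarrow>\<^sub>E carrier H \<and>
     (\<forall>\<xi>\<in>carrier H. \<forall>\<eta>\<in>carrier H. iprod H (T \<xi>) \<eta> = iprod H \<xi> (T' \<eta>))"

definition adjointable_ops ::
  "('b, 'm) cstar_scheme \<Rightarrow> ('h, 'b, 'n) hilbert_module_scheme \<Rightarrow> ('h \<Rightarrow> 'h) cstar" where
  "adjointable_ops A H =
     \<lparr>carrier = {T. \<exists>T'. adjoint_pair H T T'},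
      mult = (\<lambda>S T. compose (carrier H) S T),
      one = (\<lambda>\<xi>\<in>carrier H. \<xi>),
      zero = (\<lambda>\<xi>\<in>carrier H. \<zero>\<^bsub>H\<^esub>),
      add = (\<lambda>S T. \<lambda>\<xi>\<in>carrier H. S \<xi> \<oplus>\<^bsub>H\<^esub> T \<xi>),
      smult = (\<lambda>c T. \<lambda>\<xi>\<in>carrier H. c \<odot>\<^bsub>H\<^esub> T \<xi>),
      star = (\<lambda>T. THE T'. adjoint_pair H T T'),
      nrm = (\<lambda>T. Sup {hnorm A H (T \<xi>) | \<xi>. \<xi> \<in> carrier H \<and> hnorm A H \<xi> \<le> 1})\<rparr>"

definition theta :: "('h, 'b, 'n) hilbert_module_scheme \<Rightarrow> 'h \<Rightarrow> 'h \<Rightarrow> 'h \<Rightarrow> 'h" where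
  "theta H \<xi> \<eta> = (\<lambda>\<zeta>\<in>carrier H. ract H \<xi> (iprod H \<eta> \<zeta>))"

definition compact_ops ::
  "('b, 'm) cstar_scheme \<Rightarrow> ('h, 'b, 'n) hilbert_module_scheme \<Rightarrow> ('h \<Rightarrow> 'h) cstar" where
  "compact_ops A H = (adjointable_ops A H)
     \<lparr>carrier := closed_span (adjointable_ops A H)
        {theta H \<xi> \<eta> | \<xi> \<eta>. \<xi> \<in> carrier H \<and> \<eta> \<in> carrier H}\<rparr>"

definition toeplitz_representation ::
  "('b, 'm) cstar_scheme \<Rightarrow> ('h, 'b, 'n) hilbert_module_scheme \<Rightarrow> ('b \<Rightarrow> 'h \<Rightarrow> 'h) \<Rightarrow>
   ('c, 'k) cstar_scheme \<Rightarrow> ('h \<Rightarrow> 'c) \<Rightarrow> ('b \<Rightarrow> 'c) \<Rightarrow> bool" where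
  "toeplitz_representation A H \<phi> B \<psi> \<pi> \<longleftrightarrow>
     \<psi> \<in> carrier H \<rightarrow> carrier B \<and>
     (\<forall>\<xi>\<in>carrier H. \<forall>\<eta>\<in>carrier H. \<psi> (\<xi> \<oplus>\<^bsub>H\<^esub> \<eta>) = \<psi> \<xi> \<oplus>\<^bsub>B\<^esub> \<psi> \<eta>) \<and>
     (\<forall>c. \<forall>\<xi>\<in>carrier H. \<psi> (c \<odot>\<^bsub>H\<^esub> \<xi>) = c \<odot>\<^bsub>B\<^esub> \<psi> \<xi>) \<and>
     star_hom A B \<pi> \<and>
     (\<forall>\<xi>\<in>carrier H. \<forall>a\<in>carrier A. \<psi> (ract H \<xi> a) = \<psi> \<xi> \<otimes>\<^bsub>B\<^esub> \<pi> a) \<and>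
     (\<forall>\<xi>\<in>carrier H. \<forall>\<eta>\<in>carrier H. star B (\<psi> \<xi>) \<otimes>\<^bsub>B\<^esub> \<psi> \<eta> = \<pi> (iprod H \<xi> \<eta>)) \<and>
     (\<forall>a\<in>carrier A. \<forall>\<xi>\<in>carrier H. \<psi> (\<phi> a \<xi>) = \<pi> a \<otimes>\<^bsub>B\<^esub> \<psi> \<xi>)"

(* The homomorphism pi^(1) of the compact operators: it exists for every Toeplitz representation
   and is unique, since *-homomorphisms of C*-algebras are continuous. *)
definition induced_hom ::
  "('b, 'm) cstar_scheme \<Rightarrow> ('h, 'b, 'n) hilbert_module_scheme \<Rightarrow> ('c, 'k) cstar_scheme \<Rightarrow>
   ('h \<Rightarrow> 'c) \<Rightarrow> (('h \<Rightarrow> 'h) \<Rightarrow> 'c) \<Rightarrow> bool" where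
  "induced_hom A H B \<psi> \<rho> \<longleftrightarrow>
     star_hom (compact_ops A H) B \<rho> \<and>
     (\<forall>\<xi>\<in>carrier H. \<forall>\<eta>\<in>carrier H. \<rho> (theta H \<xi> \<eta>) = \<psi> \<xi> \<otimes>\<^bsub>B\<^esub> star B (\<psi> \<eta>))"

definition cuntz_pimsner_coinvariant ::
  "('b, 'm) cstar_scheme \<Rightarrow> ('h, 'b, 'n) hilbert_module_scheme \<Rightarrow> ('b \<Rightarrow> 'h \<Rightarrow> 'h) \<Rightarrow>
   ('c, 'k) cstar_scheme \<Rightarrow> ('h \<Rightarrow> 'c) \<Rightarrow> ('b \<Rightarrow> 'c) \<Rightarrow> bool" where
  "cuntz_pimsner_coinvariant A H \<phi> B \<psi> \<pi> \<longleftrightarrow>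
     (\<exists>\<rho>. induced_hom A H B \<psi> \<rho> \<and>
        (\<forall>a\<in>carrier A. \<phi> a \<in> carrier (compact_ops A H) \<longrightarrow> \<rho> (\<phi> a) = \<pi> a))"

(* HOL cannot quantify over types inside a formula, so the universal property refers to the
   C*-algebras whose elements are taken from a given type 'c. *)
definition cuntz_pimsner_algebra ::
  "'c itself \<Rightarrow> ('b, 'm) cstar_scheme \<Rightarrow> ('h, 'b, 'n) hilbert_module_scheme \<Rightarrow> ('b \<Rightarrow> 'h \<Rightarrow> 'h) \<Rightarrow>
   'o cstar \<Rightarrow> ('h \<Rightarrow> 'o) \<Rightarrow> ('b \<Rightarrow> 'o) \<Rightarrow> bool" where
  "cuntz_pimsner_algebra (_ :: 'c itself) A H \<phi> Q k\<^sub>H k\<^sub>A \<longleftrightarrow>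
     cstar_algebra Q \<and>
     toeplitz_representation A H \<phi> Q k\<^sub>H k\<^sub>A \<and>
     cuntz_pimsner_coinvariant A H \<phi> Q k\<^sub>H k\<^sub>A \<and>
     cstar_generated Q (k\<^sub>H ` carrier H \<union> k\<^sub>A ` carrier A) = carrier Q \<and>
     (\<forall>(B :: 'c cstar) \<psi> \<pi>.
        cstar_algebra B \<and> toeplitz_representation A H \<phi> B \<psi> \<pi> \<and>
        cuntz_pimsner_coinvariant A H \<phi> B \<psi> \<pi> \<longrightarrow>
        (\<exists>\<rho>. star_hom Q B \<rho> \<and>
             (\<forall>\<xi>\<in>carrier H. \<psi> \<xi> = \<rho> (k\<^sub>H \<xi>)) \<and> (\<forall>a\<in>carrier A. \<pi> a = \<rho> (k\<^sub>A a))))"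

section \<open>Subshifts and their algebras\<close>

definition shift :: "(nat \<Rightarrow> 'a) \<Rightarrow> nat \<Rightarrow> 'a" where
  "shift x = (\<lambda>i. x (Suc i))"

definition subshift :: "'a set \<Rightarrow> (nat \<Rightarrow> 'a) set \<Rightarrow> bool" where
  "subshift \<AA> X \<longleftrightarrow>
     closedin (product_topology (\<lambda>_. discrete_topology \<AA>) UNIV) X \<and> shift ` X \<subseteq> X"

definition cylinder :: "(nat \<Rightarrow> 'a) set \<Rightarrow> 'a list \<Rightarrow> (nat \<Rightarrow> 'a) set" where
  "cylinder X \<mu> = {x \<in> X. map x [0..<length \<mu>] = \<mu>}"

(* sigma^|mu| (C(mu)) = {x in X. mu x in X} *)
definition follower_set :: "(nat \<Rightarrow> 'a) set \<Rightarrow> 'a list \<Rightarrow> (nat \<Rightarrow> 'a) set" where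
  "follower_set X \<mu> = (shift ^^ length \<mu>) ` cylinder X \<mu>"

(* C(mu, nu) = {nu x in X. mu x in X} *)
definition cylinder2 :: "(nat \<Rightarrow> 'a) set \<Rightarrow> 'a list \<Rightarrow> 'a list \<Rightarrow> (nat \<Rightarrow> 'a) set" where
  "cylinder2 X \<mu> \<nu> = {x \<in> cylinder X \<nu>. (shift ^^ length \<nu>) x \<in> follower_set X \<mu>}"

(* Functions on X are represented by their extension by 0 outside X. In particular the supremum
   over the whole type is the supremum norm on X, also for empty X. *)
definition bounded_functions :: "'x set \<Rightarrow> ('x \<Rightarrow> complex) cstar" where
  "bounded_functions X =
     \<lparr>carrier = {f. bounded (range f) \<and> (\<forall>x. x \<notin> X \<longrightarrow> f x = 0)},
      mult = (\<lambda>f g x. f x * g x),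
      one = indicator X,
      zero = (\<lambda>x. 0),
      add = (\<lambda>f g x. f x + g x),
      smult = (\<lambda>c f x. c * f x),
      star = (\<lambda>f x. cnj (f x)),
      nrm = (\<lambda>f. SUP x. cmod (f x))\<rparr>"

definition D_alg :: "'a set \<Rightarrow> (nat \<Rightarrow> 'a) set \<Rightarrow> ((nat \<Rightarrow> 'a) \<Rightarrow> complex) cstar" where
  "D_alg \<AA> X = (bounded_functions X)
     \<lparr>carrier := cstar_generated (bounded_functions X)
        {indicator (cylinder2 X \<mu> \<nu>) | \<mu> \<nu>. \<mu> \<in> lists \<AA> \<and> \<nu> \<in> lists \<AA>}\<rparr>"

definition A_alg :: "'a set \<Rightarrow> (nat \<Rightarrow> 'a) set \<Rightarrow> ((nat \<Rightarrow> 'a) \<Rightarrow> complex) cstar" where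
  "A_alg \<AA> X = (D_alg \<AA> X)
     \<lparr>carrier := cstar_generated (D_alg \<AA> X) {indicator (follower_set X \<mu>) | \<mu>. \<mu> \<in> lists \<AA>}\<rparr>"

definition D_ideal :: "'a set \<Rightarrow> (nat \<Rightarrow> 'a) set \<Rightarrow> 'a \<Rightarrow> ((nat \<Rightarrow> 'a) \<Rightarrow> complex) set" where
  "D_ideal \<AA> X a = generated_ideal (D_alg \<AA> X) {indicator (follower_set X [a])}"

(* Elements of the direct sum are families indexed by the whole type, vanishing off the
   alphabet. *)
definition H_mod ::
  "'a set \<Rightarrow> (nat \<Rightarrow> 'a) set \<Rightarrow>
   ('a \<Rightarrow> (nat \<Rightarrow> 'a) \<Rightarrow> complex, (nat \<Rightarrow> 'a) \<Rightarrow> complex) hilbert_module" where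
  "H_mod \<AA> X =
     \<lparr>carrier = {\<xi>. (\<forall>a\<in>\<AA>. \<xi> a \<in> D_ideal \<AA> X a) \<and> (\<forall>a. a \<notin> \<AA> \<longrightarrow> \<xi> a = (\<lambda>x. 0))},
      mult = undefined,
      one = undefined,
      zero = (\<lambda>a x. 0),
      add = (\<lambda>\<xi> \<eta> a x. \<xi> a x + \<eta> a x),
      smult = (\<lambda>c \<xi> a x. c * \<xi> a x),
      ract = (\<lambda>\<xi> f a x. \<xi> a x * f x),
      iprod = (\<lambda>\<xi> \<eta> x. \<Sum>a\<in>\<AA>. cnj (\<xi> a x) * \<eta> a x)\<rparr>"

definition lambda_op ::
  "(nat \<Rightarrow> 'a) set \<Rightarrow> 'a \<Rightarrow> ((nat \<Rightarrow> 'a) \<Rightarrow> complex) \<Rightarrow> (nat \<Rightarrow> 'a) \<Rightarrow> complex" where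
  "lambda_op X a f x = (if x \<in> X \<and> case_nat a x \<in> X then f (case_nat a x) else 0)"

definition left_action ::
  "'a set \<Rightarrow> (nat \<Rightarrow> 'a) set \<Rightarrow> ((nat \<Rightarrow> 'a) \<Rightarrow> complex) \<Rightarrow>
   ('a \<Rightarrow> (nat \<Rightarrow> 'a) \<Rightarrow> complex) \<Rightarrow> 'a \<Rightarrow> (nat \<Rightarrow> 'a) \<Rightarrow> complex" where
  "left_action \<AA> X f = (\<lambda>\<xi>\<in>carrier (H_mod \<AA> X). \<lambda>a x. lambda_op X a f x * \<xi> a x)"

definition xi :: "(nat \<Rightarrow> 'a) set \<Rightarrow> 'a \<Rightarrow> 'a \<Rightarrow> (nat \<Rightarrow> 'a) \<Rightarrow> complex" where
  "xi X a = (\<lambda>b. if b = a then indicator (follower_set X [a]) else (\<lambda>x. 0))"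

(* (Q, kH, kD) is a model of O_X with its canonical maps. *)
definition subshift_algebra ::
  "'c itself \<Rightarrow> 'a set \<Rightarrow> (nat \<Rightarrow> 'a) set \<Rightarrow> 'o cstar \<Rightarrow>
   (('a \<Rightarrow> (nat \<Rightarrow> 'a) \<Rightarrow> complex) \<Rightarrow> 'o) \<Rightarrow> (((nat \<Rightarrow> 'a) \<Rightarrow> complex) \<Rightarrow> 'o) \<Rightarrow> bool" where
  "subshift_algebra \<T> \<AA> X Q k\<^sub>H k\<^sub>D \<longleftrightarrow>
     cuntz_pimsner_algebra \<T> (D_alg \<AA> X) (H_mod \<AA> X) (left_action \<AA> X) Q k\<^sub>H k\<^sub>D"

section \<open>Generating families of partial isometries\<close>

definition word_elem :: "('b, 'm) cstar_scheme \<Rightarrow> 'b \<Rightarrow> ('a \<Rightarrow> 'b) \<Rightarrow> 'a list \<Rightarrow> 'b" where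
  "word_elem B I S \<mu> = foldr (\<lambda>a y. S a \<otimes>\<^bsub>B\<^esub> y) \<mu> I"

definition subshift_family ::
  "'a set \<Rightarrow> (nat \<Rightarrow> 'a) set \<Rightarrow> 'b cstar \<Rightarrow> 'b \<Rightarrow> ('a \<Rightarrow> 'b) \<Rightarrow> bool" where
  "subshift_family \<AA> X B I S \<longleftrightarrow>
     (\<forall>a\<in>\<AA>. partial_isometry B (S a)) \<and>
     (\<Oplus>\<^bsub>B\<^esub>a\<in>\<AA>. S a \<otimes>\<^bsub>B\<^esub> star B (S a)) = I \<and>
     (\<forall>\<mu>\<in>lists \<AA>. \<forall>\<nu>\<in>lists \<AA>.
        (let p = star B (word_elem B I S \<mu>) \<otimes>\<^bsub>B\<^esub> word_elem B I S \<mu>;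
             q = word_elem B I S \<nu> \<otimes>\<^bsub>B\<^esub> star B (word_elem B I S \<nu>)
         in p \<otimes>\<^bsub>B\<^esub> q = q \<otimes>\<^bsub>B\<^esub> p)) \<and>
     (\<exists>h. star_hom (A_alg \<AA> X) (B\<lparr>carrier := cstar_generated B (S ` \<AA>)\<rparr>) h \<and>
          h (indicator X) = I \<and>
          (\<forall>\<mu>\<in>lists \<AA>. h (indicator (follower_set X \<mu>)) =
             star B (word_elem B I S \<mu>) \<otimes>\<^bsub>B\<^esub> word_elem B I S \<mu>))"

end

theory Submission
  imports Defs
begin

text \<open>
  In \<open>\<O>\<^sub>X\<close> one has \<open>k\<^sub>D(f) S\<^sub>a = S\<^sub>a k\<^sub>D(\<lambda>\<^sub>a f)\<close>, and coinvariance applied to \<open>\<phi>(1) = \<Sum>\<^sub>a \<theta>(\<xi>\<^sub>a, \<xi>\<^sub>a)\<close>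
  gives (a); the remaining relations and the generation statement follow from these two identities.
  Conversely, a family \<open>T\<close> satisfying (a)--(c) yields a representation \<open>\<pi>\<close> of \<open>A\<^sub>X\<close> with
  \<open>\<pi>(f) T\<^sub>a = T\<^sub>a \<pi>(\<lambda>\<^sub>a f)\<close>. Such a covariant representation of a function algebra \<open>E\<close> extends to the algebra of all
  \<open>f\<close> with \<open>\<lambda>\<^sub>a f \<in> E\<close> for every letter \<open>a\<close>, by \<open>f \<mapsto> \<Sum>\<^sub>a T\<^sub>a \<pi>(\<lambda>\<^sub>a f) T\<^sub>a\<^sup>*\<close>. Iterating and passing to the closure reaches
  \<open>D\<^sub>X\<close>, and \<open>\<psi>(\<xi>) = \<Sum>\<^sub>a T\<^sub>a \<pi>(\<xi>(a))\<close> completes \<open>\<pi>\<close> to a Toeplitz representation. It is coinvariant because every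
  adjointable operator is determined by its values at the \<open>\<xi>\<^sub>a\<close>, so that \<open>\<pi>\<^sup>(\<^sup>1\<^sup>)(U) = \<Sum>\<^sub>a \<psi>(U \<xi>\<^sub>a) T\<^sub>a\<^sup>*\<close>.
  That the \<open>T\<^sub>a\<close> have orthogonal ranges is not part of (a)--(c); it holds because projections of a C*-algebra
  with sum \<open>1\<close> are pairwise orthogonal.
\<close>

section \<open>Elementary facts on C*-algebras\<close>

text \<open>The route avoids spectral theory: its analytic inputs are the C*-identity, completeness
  and polynomial approximation. Two facts that usually rest on functional calculus get elementary
  proofs: orthogonality of projections with sum \<open>1\<close> via the iteration for
  \<open>1 - sqrt (1 - x)\<close>, and contractivity of representations of function algebras via
  Bernstein polynomials. Contractivity is the crux of the converse, because \<open>D\<^sub>X\<close>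
  is reached only as a closure and the representations on the increasing algebras have to pass to
  uniform limits. Orthogonality makes the extension formula multiplicative. Relation (b) enters with
  a single letter as second word: it lets the range projection of \<open>T\<^sub>a\<close> move past
  \<open>\<pi>(f)\<close>, which is what the covariance relation on \<open>A\<^sub>X\<close> amounts
  to. Coinvariance asks for a homomorphism on all compact operators; the formula for
  \<open>\<pi>\<^sup>(\<^sup>1\<^sup>)\<close> defines it outright on every adjointable operator, so
  nothing has to be extended from the span of the operators \<open>theta\<close> by
  continuity.\<close>

lemma complex_field_simps [simp]:
  "carrier complex_field = UNIV" "c \<otimes>\<^bsub>complex_field\<^esub> d = c * d"
  "c \<oplus>\<^bsub>complex_field\<^esub> d = c + d" "\<one>\<^bsub>complex_field\<^esub> = 1" "\<zero>\<^bsub>complex_field\<^esub> = 0"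
  by (simp_all add: complex_field_def)

text \<open>Only additivity of \<open>g\<close> is asked for, so that one induction covers left and
  right multiplication as well as the conjugate-linear involution.\<close>

lemma finsum_additive:
  assumes "abelian_monoid A" "abelian_monoid B" "finite F" "f \<in> F \<rightarrow> carrier A"
    and "g \<in> carrier A \<rightarrow> carrier B" "g \<zero>\<^bsub>A\<^esub> = \<zero>\<^bsub>B\<^esub>"
    and "\<And>x y. x \<in> carrier A \<Longrightarrow> y \<in> carrier A \<Longrightarrow> g (x \<oplus>\<^bsub>A\<^esub> y) = g x \<oplus>\<^bsub>B\<^esub> g y"
  shows "g (\<Oplus>\<^bsub>A\<^esub>i\<in>F. f i) = (\<Oplus>\<^bsub>B\<^esub>i\<in>F. g (f i))"
proof -
  interpret A: abelian_monoid A by fact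
  interpret B: abelian_monoid B by fact
  from assms(3,4) show ?thesis
  proof (induction F)
    case empty
    then show ?case by (simp add: assms(6))
  next
    case (insert i F)
    then have f: "f \<in> F \<rightarrow> carrier A" "f i \<in> carrier A" by auto
    have gf: "(\<lambda>i. g (f i)) \<in> F \<rightarrow> carrier B" "g (f i) \<in> carrier B"
      using f assms(5) by auto
    show ?case
      using insert f gf by (simp add: A.finsum_insert B.finsum_insert assms(7) A.finsum_closed)
  qed
qed

context cstar_algebra
begin

declare mult_closed [simp, intro] star_closed [simp, intro] star_star [simp]

lemma smult_closed' [simp, intro]: "x \<in> carrier A \<Longrightarrow> c \<odot> x \<in> carrier A"
  using smult_closed by simp

lemma smult_add_left: "x \<in> carrier A \<Longrightarrow> (c + d) \<odot> x = c \<odot> x \<oplus> d \<odot> x"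
  using smult_l_distr[of c d x] by simp

lemma smult_add_right:
  "\<lbrakk>x \<in> carrier A; y \<in> carrier A\<rbrakk> \<Longrightarrow> c \<odot> (x \<oplus> y) = c \<odot> x \<oplus> c \<odot> y"
  using smult_r_distr[of c x y] by simp

lemma smult_smult: "x \<in> carrier A \<Longrightarrow> c \<odot> (d \<odot> x) = (c * d) \<odot> x"
  using smult_assoc1[of c d x] by simp

lemma smult_1 [simp]: "x \<in> carrier A \<Longrightarrow> 1 \<odot> x = x"
  using smult_one[of x] by simp

lemma smult_0 [simp]: "x \<in> carrier A \<Longrightarrow> 0 \<odot> x = \<zero>"
  using smult_l_null[of x] by simp

lemma smult_zero [simp]: "c \<odot> \<zero> = \<zero>"
  using smult_r_null[of c] by simp

lemma uminus_eq_smult: "x \<in> carrier A \<Longrightarrow> \<ominus> x = (-1) \<odot> x"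
  by (rule minus_equality) (use smult_add_left[of x "-1" 1] in auto)

lemma minus_eq_smult: "\<lbrakk>x \<in> carrier A; y \<in> carrier A\<rbrakk> \<Longrightarrow> x \<ominus> y = x \<oplus> (-1) \<odot> y"
  by (simp add: a_minus_def uminus_eq_smult)

lemma mult_zero [simp]: "x \<in> carrier A \<Longrightarrow> x \<otimes> \<zero> = \<zero>" "x \<in> carrier A \<Longrightarrow> \<zero> \<otimes> x = \<zero>"
  using mult_smult_right[of x \<zero> 0] mult_smult_left[of \<zero> x 0] by simp_all

lemma star_zero [simp]: "star A \<zero> = \<zero>"
  using star_smult[of \<zero> 0] by simp

lemma nrm_zero [simp]: "nrm A \<zero> = 0"
  using nrm_eq_zero[of \<zero>] by simp

lemma minus_distribs:
  assumes "x \<in> carrier A" "y \<in> carrier A" "z \<in> carrier A"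
  shows "(x \<ominus> y) \<otimes> z = x \<otimes> z \<ominus> y \<otimes> z" "z \<otimes> (x \<ominus> y) = z \<otimes> x \<ominus> z \<otimes> y"
  using assms by (simp_all add: minus_eq_smult mult_l_distr mult_r_distr mult_smult_left mult_smult_right)

lemma star_minus: "\<lbrakk>x \<in> carrier A; y \<in> carrier A\<rbrakk> \<Longrightarrow> star A (x \<ominus> y) = star A x \<ominus> star A y"
  by (simp add: minus_eq_smult star_add star_smult)

lemma smult_minus:
  "\<lbrakk>x \<in> carrier A; y \<in> carrier A\<rbrakk> \<Longrightarrow> c \<odot> (x \<ominus> y) = c \<odot> x \<ominus> c \<odot> y"
  by (simp add: minus_eq_smult smult_add_right smult_smult)

lemma nrm_minus_commute:
  assumes "x \<in> carrier A" "y \<in> carrier A" shows "nrm A (x \<ominus> y) = nrm A (y \<ominus> x)"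
proof -
  have "x \<ominus> y = (-1) \<odot> (y \<ominus> x)"
    using assms by (simp add: minus_eq_smult smult_add_right smult_smult a_comm)
  then show ?thesis using assms by (simp add: nrm_smult)
qed

lemma minus_self [simp]: "x \<in> carrier A \<Longrightarrow> x \<ominus> x = \<zero>"
  by (simp add: a_minus_def r_neg)

lemma minus_add_cancel: "\<lbrakk>x \<in> carrier A; y \<in> carrier A\<rbrakk> \<Longrightarrow> (x \<ominus> y) \<oplus> y = x"
  by (simp add: a_minus_def a_assoc l_neg)

lemma minus_minus_add:
  assumes "x \<in> carrier A" "y \<in> carrier A" "z \<in> carrier A"
  shows "(x \<ominus> y) \<oplus> (y \<ominus> z) = x \<ominus> z"
  using assms by (simp add: a_minus_def a_assoc r_neg1)

lemma eq_iff_minus: "\<lbrakk>x \<in> carrier A; y \<in> carrier A\<rbrakk> \<Longrightarrow> x \<ominus> y = \<zero> \<longleftrightarrow> x = y"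
  by (metis l_zero minus_add_cancel minus_self)

lemma nrm_minus_triangle:
  assumes "x \<in> carrier A" "y \<in> carrier A" "z \<in> carrier A"
  shows "nrm A (x \<ominus> z) \<le> nrm A (x \<ominus> y) + nrm A (y \<ominus> z)"
  using nrm_triangle[of "x \<ominus> y" "y \<ominus> z"] assms by (simp add: minus_minus_add)

text \<open>The C*-identity and submultiplicativity give
  \<open>nrm A y ^ 2 \<le> nrm A (star A y) * nrm A y\<close>; cancelling, and exchanging the
  element with its adjoint, yields both inequalities.\<close>

lemma nrm_star: assumes x: "x \<in> carrier A" shows "nrm A (star A x) = nrm A x"
proof -
  have le: "nrm A y \<le> nrm A (star A y)" if y: "y \<in> carrier A" for y
  proof (cases "nrm A y = 0")
    case False
    then have "nrm A y > 0" using nrm_nonneg[OF y] by simp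
    moreover have "nrm A y * nrm A y \<le> nrm A (star A y) * nrm A y"
      using cstar_identity[OF y] nrm_mult[of "star A y" y] y by (simp add: power2_eq_square)
    ultimately show ?thesis by simp
  qed (simp add: y nrm_nonneg)
  from le[OF x] le[of "star A x"] x show ?thesis by simp
qed

lemma nrm_projection_le: "\<lbrakk>p \<in> carrier A; star A p = p; p \<otimes> p = p\<rbrakk> \<Longrightarrow> nrm A p \<le> 1"
  using cstar_identity[of p] nrm_nonneg[of p]
  by (metis dual_order.refl nrm_mult mult_cancel_left1 power2_eq_square zero_le_one)

lemma zero_if_star_mult_zero: "\<lbrakk>x \<in> carrier A; star A x \<otimes> x = \<zero>\<rbrakk> \<Longrightarrow> x = \<zero>"
  using cstar_identity[of x] nrm_eq_zero[of x] by simp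

lemma Metric_space_cstar_dist: "Metric_space (carrier A) (cstar_dist A)"
proof
  fix x y z assume "x \<in> carrier A" "y \<in> carrier A" "z \<in> carrier A"
  then show "cstar_dist A x z \<le> cstar_dist A x y + cstar_dist A y z"
    by (simp add: cstar_dist_def nrm_minus_triangle)
qed (auto simp: cstar_dist_def nrm_nonneg nrm_minus_commute nrm_eq_zero eq_iff_minus)

lemma Cauchy_limit:
  fixes x :: "nat \<Rightarrow> 'b"
  assumes x: "\<And>n. x n \<in> carrier A"
    and C: "\<And>e. e > 0 \<Longrightarrow> \<exists>N. \<forall>m\<ge>N. \<forall>n\<ge>N. nrm A (x m \<ominus> x n) < e"
  obtains b where "b \<in> carrier A" "\<And>e. e > 0 \<Longrightarrow> \<exists>N. \<forall>n\<ge>N. nrm A (b \<ominus> x n) < e"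
proof -
  interpret M: Metric_space "carrier A" "cstar_dist A" by (rule Metric_space_cstar_dist)
  have "M.MCauchy x"
    using C x by (auto simp: M.MCauchy_def cstar_dist_def image_subset_iff)
  then obtain b where b: "limitin M.mtopology x b sequentially"
    using complete by (auto simp: M.mcomplete_def)
  then have "b \<in> carrier A" "\<forall>e>0. \<exists>N. \<forall>n\<ge>N. x n \<in> carrier A \<and> cstar_dist A (x n) b < e"
    by (simp_all add: M.limit_metric_sequentially)
  with that[of b] x show ?thesis
    by (metis cstar_dist_def nrm_minus_commute)
qed

lemma mult_finsum:
  assumes "finite F" "f \<in> F \<rightarrow> carrier A" "x \<in> carrier A"
  shows "x \<otimes> (\<Oplus>i\<in>F. f i) = (\<Oplus>i\<in>F. x \<otimes> f i)"
  using assms by (intro finsum_additive[OF abelian_monoid_axioms abelian_monoid_axioms]) (auto simp: mult_r_distr)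

lemma finsum_mult:
  assumes "finite F" "f \<in> F \<rightarrow> carrier A" "x \<in> carrier A"
  shows "(\<Oplus>i\<in>F. f i) \<otimes> x = (\<Oplus>i\<in>F. f i \<otimes> x)"
  using assms
  by (intro finsum_additive[OF abelian_monoid_axioms abelian_monoid_axioms, where g = "\<lambda>y. y \<otimes> x"])
    (auto simp: mult_l_distr)

lemma star_finsum:
  assumes "finite F" "f \<in> F \<rightarrow> carrier A"
  shows "star A (\<Oplus>i\<in>F. f i) = (\<Oplus>i\<in>F. star A (f i))"
  using assms by (intro finsum_additive[OF abelian_monoid_axioms abelian_monoid_axioms]) (auto simp: star_add)

lemma smult_finsum:
  assumes "finite F" "f \<in> F \<rightarrow> carrier A"
  shows "c \<odot> (\<Oplus>i\<in>F. f i) = (\<Oplus>i\<in>F. c \<odot> f i)"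
  using finsum_smult_ldistr[of F c f] assms by simp

lemma finsum_single:
  assumes "finite F" "i \<in> F" "f i \<in> carrier A" "\<And>j. j \<in> F \<Longrightarrow> j \<noteq> i \<Longrightarrow> f j = \<zero>"
  shows "(\<Oplus>j\<in>F. f j) = f i"
proof -
  have "(\<Oplus>j\<in>F. f j) = (\<Oplus>j\<in>F. if i = j then f j else \<zero>)"
    using assms by (intro finsum_cong') auto
  also have "\<dots> = f i"
    using assms by (intro finsum_singleton Pi_I) (auto, metis zero_closed)
  finally show ?thesis .
qed

lemma finsum_closed_subset:
  assumes "finite F" "V \<subseteq> carrier A" "\<zero> \<in> V" "\<And>x y. x \<in> V \<Longrightarrow> y \<in> V \<Longrightarrow> x \<oplus> y \<in> V" "\<And>i. i \<in> F \<Longrightarrow> f i \<in> V"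
  shows "(\<Oplus>i\<in>F. f i) \<in> V"
  using assms(1,5)
proof (induction F)
  case (insert i F)
  then have "f \<in> F \<rightarrow> carrier A" "f i \<in> carrier A" using assms(2) by auto
  with insert show ?case by (simp add: finsum_insert assms(4))
qed (simp add: assms(3))

section \<open>Norm closedness and generated C*-subalgebras\<close>

lemma closedin_cstar_iff:
  "closedin (Metric_space.mtopology (carrier A) (cstar_dist A)) V \<longleftrightarrow>
    V \<subseteq> carrier A \<and> (\<forall>x\<in>carrier A. (\<forall>e>0. \<exists>y\<in>V. nrm A (x \<ominus> y) < e) \<longrightarrow> x \<in> V)"
proof -
  interpret M: Metric_space "carrier A" "cstar_dist A" by (rule Metric_space_cstar_dist)
  show ?thesis
    unfolding M.closedin_metric disjnt_iff M.in_mball by (auto simp: cstar_dist_def) (meson not_less subset_iff)+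
qed

lemma eq_if_close:
  assumes "x \<in> carrier A" "y \<in> carrier A" "\<And>e. e > 0 \<Longrightarrow> nrm A (x \<ominus> y) \<le> c * e"
  shows "x = y"
proof -
  have "nrm A (x \<ominus> y) \<le> 0"
  proof (rule field_le_epsilon)
    fix e :: real assume "e > 0"
    \<comment> \<open>\<open>c\<close> may be zero or negative; \<open>\<bar>c\<bar> + 1\<close> is
      a positive bound for it that can be divided by. The value \<open>c = 0\<close> does occur, in
      \<open>limit_rel_unique\<close>.\<close>
    define k where "k = \<bar>c\<bar> + 1"
    have "k > 0" "c \<le> k" by (auto simp: k_def)
    have "nrm A (x \<ominus> y) \<le> c * (e / k)" using assms(3)[of "e / k"] \<open>e > 0\<close> \<open>k > 0\<close> by simp
    also have "\<dots> \<le> k * (e / k)" using \<open>c \<le> k\<close> \<open>e > 0\<close> \<open>k > 0\<close> by (intro mult_right_mono) auto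
    finally show "nrm A (x \<ominus> y) \<le> 0 + e" using \<open>k > 0\<close> by simp
  qed
  then have "nrm A (x \<ominus> y) = 0" using nrm_nonneg[of "x \<ominus> y"] assms by simp
  then show ?thesis using assms nrm_eq_zero[of "x \<ominus> y"] eq_iff_minus by simp
qed

lemma cstar_subalgebra_iff:
  "cstar_subalgebra A S \<longleftrightarrow> S \<subseteq> carrier A \<and> \<zero> \<in> S \<and> (\<forall>x\<in>S. \<forall>y\<in>S. x \<oplus> y \<in> S) \<and>
     (\<forall>c. \<forall>x\<in>S. c \<odot> x \<in> S) \<and> (\<forall>x\<in>S. \<forall>y\<in>S. x \<otimes> y \<in> S) \<and> (\<forall>x\<in>S. star A x \<in> S) \<and>
     (\<forall>x\<in>carrier A. (\<forall>e>0. \<exists>y\<in>S. nrm A (x \<ominus> y) < e) \<longrightarrow> x \<in> S)"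
  unfolding cstar_subalgebra_def closed_subspace_def closedin_cstar_iff by blast

lemma cstar_subalgebra_carrier: "cstar_subalgebra A (carrier A)"
  unfolding cstar_subalgebra_iff by auto

lemma cstar_subalgebra_generated:
  assumes "G \<subseteq> carrier A"
  shows "cstar_subalgebra A (cstar_generated A G)" "G \<subseteq> cstar_generated A G"
proof -
  show "G \<subseteq> cstar_generated A G" by (auto simp: cstar_generated_def)
  have "cstar_generated A G \<subseteq> carrier A"
    using cstar_subalgebra_carrier assms by (auto simp: cstar_generated_def)
  moreover have "x \<in> cstar_generated A G"
    if x: "x \<in> carrier A" "\<forall>e>0. \<exists>y\<in>cstar_generated A G. nrm A (x \<ominus> y) < e" for x
  proof -
    have "x \<in> S" if S: "cstar_subalgebra A S" "G \<subseteq> S" for S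
    proof -
      have "cstar_generated A G \<subseteq> S" using S by (auto simp: cstar_generated_def)
      then have "\<forall>e>0. \<exists>y\<in>S. nrm A (x \<ominus> y) < e" using x(2) by blast
      then show ?thesis using S x(1) unfolding cstar_subalgebra_iff by blast
    qed
    then show ?thesis by (simp add: cstar_generated_def)
  qed
  moreover have "\<zero> \<in> S \<and> (\<forall>x\<in>S. \<forall>y\<in>S. x \<oplus> y \<in> S) \<and>
     (\<forall>c. \<forall>x\<in>S. c \<odot> x \<in> S) \<and> (\<forall>x\<in>S. \<forall>y\<in>S. x \<otimes> y \<in> S) \<and> (\<forall>x\<in>S. star A x \<in> S)"
    if "cstar_subalgebra A S" for S
    using that unfolding cstar_subalgebra_iff by blast
  then have "\<zero> \<in> cstar_generated A G \<and> (\<forall>x\<in>cstar_generated A G. \<forall>y\<in>cstar_generated A G. x \<oplus> y \<in> cstar_generated A G) \<and>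
     (\<forall>c. \<forall>x\<in>cstar_generated A G. c \<odot> x \<in> cstar_generated A G) \<and>
     (\<forall>x\<in>cstar_generated A G. \<forall>y\<in>cstar_generated A G. x \<otimes> y \<in> cstar_generated A G) \<and>
     (\<forall>x\<in>cstar_generated A G. star A x \<in> cstar_generated A G)"
    unfolding cstar_generated_def by simp
  ultimately show "cstar_subalgebra A (cstar_generated A G)"
    unfolding cstar_subalgebra_iff by blast
qed

lemma cstar_generated_least: "cstar_subalgebra A S \<Longrightarrow> G \<subseteq> S \<Longrightarrow> cstar_generated A G \<subseteq> S"
  by (auto simp: cstar_generated_def)

text \<open>A candidate unit then has to be tested on generators only. The elements fixed by
  \<open>e\<close> from both sides are closed under limits because multiplication by
  \<open>e\<close> is bounded, and under the involution because \<open>e\<close> is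
  self-adjoint.\<close>

lemma cstar_subalgebra_unit_for:
  assumes e: "e \<in> carrier A" "star A e = e"
  shows "cstar_subalgebra A {x \<in> carrier A. e \<otimes> x = x \<and> x \<otimes> e = x}" (is "cstar_subalgebra A ?V")
proof -
  have "x \<in> ?V" if x: "x \<in> carrier A" "\<forall>d>0. \<exists>y\<in>?V. nrm A (x \<ominus> y) < d" for x
  proof -
    have *: "nrm A (e \<otimes> x \<ominus> x) \<le> (nrm A e + 1) * d \<and> nrm A (x \<otimes> e \<ominus> x) \<le> (nrm A e + 1) * d"
      if "d > 0" for d
    proof -
      obtain y where y: "y \<in> carrier A" "e \<otimes> y = y" "y \<otimes> e = y" "nrm A (x \<ominus> y) < d"
        using x(2) \<open>d > 0\<close> by blast
      have yx: "nrm A (y \<ominus> x) \<le> d" using y x nrm_minus_commute by simp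
      have "nrm A (e \<otimes> x \<ominus> x) \<le> nrm A (e \<otimes> (x \<ominus> y)) + nrm A (y \<ominus> x)"
        using nrm_minus_triangle[of "e \<otimes> x" y x] x y e by (simp add: minus_distribs)
      also have "nrm A (e \<otimes> (x \<ominus> y)) \<le> nrm A e * d"
        using nrm_mult[of e "x \<ominus> y"] x y e mult_left_mono[OF less_imp_le[OF y(4)] nrm_nonneg[OF e(1)]]
        by simp
      finally have 1: "nrm A (e \<otimes> x \<ominus> x) \<le> (nrm A e + 1) * d" using yx by (simp add: algebra_simps)
      have "nrm A (x \<otimes> e \<ominus> x) \<le> nrm A ((x \<ominus> y) \<otimes> e) + nrm A (y \<ominus> x)"
        using nrm_minus_triangle[of "x \<otimes> e" y x] x y e by (simp add: minus_distribs)
      also have "nrm A ((x \<ominus> y) \<otimes> e) \<le> d * nrm A e"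
        using nrm_mult[of "x \<ominus> y" e] x y e mult_right_mono[OF less_imp_le[OF y(4)] nrm_nonneg[OF e(1)]]
        by simp
      finally show ?thesis using 1 yx by (simp add: algebra_simps)
    qed
    have "e \<otimes> x = x" using * x e by (intro eq_if_close) auto
    moreover have "x \<otimes> e = x" using * x e by (intro eq_if_close) auto
    ultimately show ?thesis using x by simp
  qed
  then have "\<forall>x\<in>carrier A. (\<forall>d>0. \<exists>y\<in>?V. nrm A (x \<ominus> y) < d) \<longrightarrow> x \<in> ?V" by blast
  moreover have "x \<otimes> y \<in> ?V" if x: "x \<in> ?V" and y: "y \<in> ?V" for x y
  proof -
    have xy: "x \<in> carrier A" "y \<in> carrier A" using x y by auto
    note mult_assoc[OF e(1) xy, symmetric] mult_assoc[OF xy e(1)]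
    with x y show ?thesis by simp
  qed
  moreover have "star A x \<in> ?V" if x: "x \<in> ?V" for x
  proof -
    have xc: "x \<in> carrier A" using x by simp
    have "e \<otimes> star A x = star A (x \<otimes> e)" "star A x \<otimes> e = star A (e \<otimes> x)"
      using star_mult[OF xc e(1)] star_mult[OF e(1) xc] e(2) by simp_all
    then show ?thesis using x by simp
  qed
  moreover have "\<zero> \<in> ?V" "\<And>x y. x \<in> ?V \<Longrightarrow> y \<in> ?V \<Longrightarrow> x \<oplus> y \<in> ?V" "\<And>x c. x \<in> ?V \<Longrightarrow> c \<odot> x \<in> ?V"
    using e by (simp_all add: mult_l_distr mult_r_distr mult_smult_left mult_smult_right)
  ultimately show ?thesis
    unfolding cstar_subalgebra_iff by (intro conjI ballI allI) auto
qed

lemma word_elem_closed: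
  assumes "I \<in> carrier A" "\<And>a. a \<in> \<AA> \<Longrightarrow> S a \<in> carrier A" "\<mu> \<in> lists \<AA>"
  shows "word_elem A I S \<mu> \<in> carrier A"
  using assms(3) by induction (simp_all add: word_elem_def assms)

text \<open>\<open>word_elem\<close> builds products from the front, whereas
  \<open>lambda_op\<close> lengthens the word of a follower set at its end; this connects the
  two.\<close>

lemma word_elem_snoc:
  assumes "cstar_unit A I" "\<And>a. a \<in> \<AA> \<Longrightarrow> S a \<in> carrier A" "\<mu> \<in> lists \<AA>" "a \<in> \<AA>"
  shows "word_elem A I S (\<mu> @ [a]) = word_elem A I S \<mu> \<otimes> S a"
  using assms(3)
proof induction
  case Nil
  then show ?case using assms by (simp add: word_elem_def cstar_unit_def)
next
  case (Cons b \<mu>)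
  then show ?case using word_elem_closed[of I \<AA> S \<mu>] assms
    by (simp add: word_elem_def mult_assoc cstar_unit_def)
qed

end

section \<open>Sums of projections\<close>

context cstar_algebra
begin

text \<open>Stands in for monotonicity of the norm on positive elements. Since \<open>u\<close> and
  \<open>v\<close> commute, the cross terms in the square of the auxiliary element cancel, and the
  C*-identity computes its norm.\<close>

lemma nrm_square_le_sum_squares:
  assumes u: "u \<in> carrier A" "star A u = u" and v: "v \<in> carrier A" "star A v = v"
    and comm: "u \<otimes> v = v \<otimes> u"
  shows "nrm A u ^ 2 \<le> nrm A (u \<otimes> u \<oplus> v \<otimes> v)"
proof -
  \<comment> \<open>\<open>u + \<i>v\<close> is normal, and \<open>u\<close> is its real part.\<close>
  define c where "c = u \<oplus> \<i> \<odot> v"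
  have c: "c \<in> carrier A" using u v by (simp add: c_def)
  have cs: "star A c = u \<oplus> (-\<i>) \<odot> v" using u v by (simp add: c_def star_add star_smult)
  have "star A c \<otimes> c = u \<otimes> u \<oplus> \<i> \<odot> (u \<otimes> v) \<oplus> ((-\<i>) \<odot> (u \<otimes> v) \<oplus> v \<otimes> v)"
    unfolding cs using u v comm
    by (simp add: c_def mult_l_distr mult_r_distr mult_smult_left mult_smult_right smult_smult
        smult_add_right a_ac)
  also have "\<dots> = u \<otimes> u \<oplus> (\<i> \<odot> (u \<otimes> v) \<oplus> (-\<i>) \<odot> (u \<otimes> v)) \<oplus> v \<otimes> v"
    using u v by (simp add: a_assoc)
  also have "\<dots> = u \<otimes> u \<oplus> v \<otimes> v"
    using u v by (simp add: smult_add_left[symmetric])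
  finally have n: "nrm A c ^ 2 = nrm A (u \<otimes> u \<oplus> v \<otimes> v)"
    using cstar_identity[OF c] by simp
  have "c \<oplus> star A c = (u \<oplus> u) \<oplus> (\<i> \<odot> v \<oplus> (-\<i>) \<odot> v)"
    unfolding cs using u v by (simp add: c_def a_ac)
  also have "\<dots> = 2 \<odot> u"
    using u v smult_add_left[of u 1 1] by (simp add: smult_add_left[symmetric])
  finally have "2 * nrm A u \<le> nrm A c + nrm A (star A c)"
    using nrm_triangle[OF c star_closed[OF c]] u by (simp add: nrm_smult)
  then have "nrm A u \<le> nrm A c" using c by (simp add: nrm_star)
  then show ?thesis using n nrm_nonneg[OF u(1)] by (metis power_mono)
qed

lemma minus_swap:
  assumes "a \<in> carrier A" "b \<in> carrier A" "c \<in> carrier A" "d \<in> carrier A"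
  shows "(a \<oplus> b) \<ominus> (c \<oplus> d) = (a \<ominus> c) \<oplus> (b \<ominus> d)"
  using assms by (simp add: minus_eq_smult smult_add_right a_ac)

text \<open>An approximate root suffices later, so no limit is taken:
  \<open>w = p \<ominus> y n\<close> has the exact error \<open>w \<otimes> w \<ominus> (p \<ominus>
  x) = 2 \<odot> (y (Suc n) \<ominus> y n)\<close>, which decays geometrically. As a polynomial in
  \<open>x\<close> and \<open>p\<close>, \<open>w\<close> commutes with whatever commutes with
  both.\<close>

lemma approx_square_root:
  assumes p: "p \<in> carrier A" "star A p = p" "p \<otimes> p = p"
    and x: "x \<in> carrier A" "star A x = x" "p \<otimes> x = x" "x \<otimes> p = x"
    and r: "nrm A x \<le> r" "r < 1" and "\<delta> > 0"
  obtains w where "w \<in> carrier A" "star A w = w" "nrm A (w \<otimes> w \<ominus> (p \<ominus> x)) < \<delta>"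
    "\<And>z. \<lbrakk>z \<in> carrier A; z \<otimes> x = x \<otimes> z; z \<otimes> p = p \<otimes> z\<rbrakk> \<Longrightarrow> z \<otimes> w = w \<otimes> z"
proof -
  \<comment> \<open>The iteration converges to \<open>1 - sqrt (1 - x)\<close> in the corner of \<open>p\<close>.\<close>
  define y where "y = rec_nat \<zero> (\<lambda>_ z. (1/2) \<odot> (x \<oplus> z \<otimes> z))"
  have y0: "y 0 = \<zero>" and yS: "y (Suc n) = (1/2) \<odot> (x \<oplus> y n \<otimes> y n)" for n
    by (simp_all add: y_def)
  have r0: "0 \<le> r" using r(1) nrm_nonneg[OF x(1)] by simp
  have yc [simp, intro]: "y n \<in> carrier A" for n
    by (induction n) (simp_all add: y0 yS x)
  have ys: "star A (y n) = y n" for n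
    by (induction n) (simp_all add: y0 yS x star_smult star_add star_mult)
  have py: "p \<otimes> y n = y n" "y n \<otimes> p = y n" for n
    by (induction n)
      (simp_all add: y0 yS x p mult_smult_right mult_smult_left mult_r_distr mult_l_distr
        mult_assoc[symmetric], simp_all add: mult_assoc p)
  have yz: "z \<otimes> y n = y n \<otimes> z" if "z \<in> carrier A" "z \<otimes> x = x \<otimes> z" for z n
  proof (induction n)
    case (Suc n)
    have "z \<otimes> (y n \<otimes> y n) = (y n \<otimes> y n) \<otimes> z"
      using Suc that by (metis mult_assoc yc)
    then show ?case
      using that by (simp add: yS x mult_smult_right mult_smult_left mult_r_distr mult_l_distr)
  qed (simp add: y0 that)
  have yy: "y m \<otimes> y n = y n \<otimes> y m" for m n
    using yz[OF yc, of n m] yz[OF x(1) refl, of n] by (metis yz)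
  have yr: "nrm A (y n) \<le> r" for n
  proof (induction n)
    case (Suc n)
    have "nrm A (x \<oplus> y n \<otimes> y n) \<le> r + nrm A (y n \<otimes> y n)"
      using nrm_triangle[of x "y n \<otimes> y n"] x r by simp
    also have "nrm A (y n \<otimes> y n) \<le> r * r"
      using nrm_mult[of "y n" "y n"] Suc nrm_nonneg[of "y n"] r0
      by (meson mult_mono order_trans yc)
    also have "r + r * r \<le> 2 * r" using r r0 mult_left_mono[of r 1 r] by simp
    finally show ?case by (simp add: yS x nrm_smult)
  qed (simp add: y0 r0)
  have yd: "nrm A (y (Suc n) \<ominus> y n) \<le> r ^ Suc n" for n
  proof (induction n)
    case 0
    show ?case using x r nrm_nonneg[OF x(1)] by (simp add: yS y0 nrm_smult minus_eq_smult)
  next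
    case (Suc n)
    let ?a = "y (Suc n)" and ?b = "y n"
    \<comment> \<open>Commuting iterates let the difference of squares factor. The sum factor has
      norm at most \<open>2 * r\<close>, and the \<open>1/2\<close> of the recursion turns this into
      the ratio \<open>r\<close>.\<close>
    have "(?a \<ominus> ?b) \<otimes> (?a \<oplus> ?b) = ?a \<otimes> ?a \<oplus> (?a \<otimes> ?b \<oplus> ((-1) \<odot> (?a \<otimes> ?b) \<oplus> (-1) \<odot> (?b \<otimes> ?b)))"
      using yy[of n "Suc n"] by (simp add: minus_eq_smult mult_l_distr mult_r_distr mult_smult_left
          smult_add_right a_ac)
    also have "\<dots> = ?a \<otimes> ?a \<oplus> (((1 + (-1)) \<odot> (?a \<otimes> ?b)) \<oplus> (-1) \<odot> (?b \<otimes> ?b))"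
      unfolding smult_add_left[OF mult_closed[OF yc yc]] by (simp add: a_assoc)
    finally have prod: "(?a \<ominus> ?b) \<otimes> (?a \<oplus> ?b) = ?a \<otimes> ?a \<ominus> ?b \<otimes> ?b"
      by (simp add: minus_eq_smult)
    have "y (Suc (Suc n)) \<ominus> y (Suc n)
      = (1/2) \<odot> (x \<oplus> ?a \<otimes> ?a) \<ominus> (1/2) \<odot> (x \<oplus> ?b \<otimes> ?b)"
      by (simp only: yS)
    also have "\<dots> = (1/2) \<odot> ((x \<ominus> x) \<oplus> (?a \<otimes> ?a \<ominus> ?b \<otimes> ?b))"
      using x by (subst minus_swap[symmetric]) (auto simp del: minus_self simp add: smult_minus)
    also have "\<dots> = (1/2) \<odot> ((?a \<ominus> ?b) \<otimes> (?a \<oplus> ?b))"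
      using x prod by simp
    finally have "nrm A (y (Suc (Suc n)) \<ominus> y (Suc n)) = nrm A ((?a \<ominus> ?b) \<otimes> (?a \<oplus> ?b)) / 2"
      by (simp add: nrm_smult)
    also have "nrm A ((?a \<ominus> ?b) \<otimes> (?a \<oplus> ?b)) \<le> nrm A (?a \<ominus> ?b) * nrm A (?a \<oplus> ?b)"
      by (rule nrm_mult) simp_all
    also have "\<dots> \<le> r ^ Suc n * (2 * r)"
      using Suc yr[of n] yr[of "Suc n"] nrm_triangle[OF yc yc, of "Suc n" n] r0
      by (intro mult_mono) (auto simp: nrm_nonneg)
    finally show ?case by (simp add: mult_ac)
  qed
  have "(\<lambda>n. 2 * r ^ Suc n) \<longlonglongrightarrow> 2 * 0"
    using r r0 by (intro tendsto_mult_left LIMSEQ_Suc LIMSEQ_realpow_zero)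
  then have "eventually (\<lambda>n. 2 * r ^ Suc n < \<delta>) sequentially"
    using \<open>\<delta> > 0\<close> by (intro order_tendstoD) auto
  then obtain n where n: "2 * r ^ Suc n < \<delta>"
    using eventually_happens'[OF sequentially_bot] by blast
  define w where "w = p \<ominus> y n"
  have w: "w \<in> carrier A" by (simp add: w_def p)
  let ?m = "\<lambda>x. (-1) \<odot> x"
  have "w \<otimes> w = p \<oplus> (?m (y n) \<oplus> (?m (y n) \<oplus> y n \<otimes> y n))"
    using p by (simp add: w_def minus_eq_smult mult_l_distr mult_r_distr mult_smult_left
        mult_smult_right py smult_smult smult_add_right a_ac)
  moreover have "p \<ominus> x = p \<oplus> ?m x" using p x by (simp add: minus_eq_smult)
  ultimately have "w \<otimes> w \<ominus> (p \<ominus> x) = (p \<ominus> p) \<oplus> ((?m (y n) \<oplus> (?m (y n) \<oplus> y n \<otimes> y n)) \<ominus> ?m x)"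
    using p x by (simp only: minus_swap smult_closed' a_closed mult_closed yc)
  also have "\<dots> = (x \<oplus> y n \<otimes> y n) \<oplus> (-2) \<odot> y n"
    using p x smult_add_left[of "y n" "-1" "-1"]
    by (simp add: minus_eq_smult smult_smult a_ac)
  also have "\<dots> = 2 \<odot> (y (Suc n) \<ominus> y n)"
    using x by (simp add: yS smult_smult minus_eq_smult smult_add_right)
  finally have "nrm A (w \<otimes> w \<ominus> (p \<ominus> x)) \<le> 2 * r ^ Suc n"
    using yd[of n] by (simp add: nrm_smult)
  then show thesis
    using n p w by (intro that[of w]) (auto simp: w_def star_minus ys minus_distribs yz)
qed

text \<open>In the order of self-adjoint elements, \<open>p \<le> p + b\<^sup>2 \<le> p\<close>
  would force \<open>b\<^sup>2 = 0\<close>. Norms replace the order here: shrinking by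
  \<open>1 - \<epsilon>\<close> brings \<open>p + b\<^sup>2\<close> into the range of the root
  iteration, and the error disappears as \<open>\<epsilon>\<close> tends to zero.\<close>

lemma eq_zero_if_nrm_le_1:
  assumes p: "p \<in> carrier A" "star A p = p" "p \<otimes> p = p"
    and b: "b \<in> carrier A" "star A b = b" "p \<otimes> b = b" "b \<otimes> p = b"
    and le: "nrm A (p \<oplus> b \<otimes> b) \<le> 1"
  shows "b = \<zero>"
proof -
  have bound: "nrm A b ^ 2 \<le> 4 * \<epsilon>" if e: "0 < \<epsilon>" "\<epsilon> \<le> 1/2" for \<epsilon> :: real
  proof -
    \<comment> \<open>An approximate root \<open>w\<close> of \<open>p - (1 - \<epsilon>) (p + b\<^sup>2)\<close> satisfies \<open>(1 - \<epsilon>) b\<^sup>2 + w\<^sup>2 \<approx> \<epsilon> p\<close>.\<close>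
    let ?b2 = "b \<otimes> b"
    let ?c = "of_real (1 - \<epsilon>) :: complex"
    define x where "x = ?c \<odot> (p \<oplus> ?b2)"
    have pb: "p \<otimes> (b \<otimes> b) = b \<otimes> b" "(b \<otimes> b) \<otimes> p = b \<otimes> b" using b p by (simp_all add: mult_assoc[symmetric], simp add: mult_assoc)
    have x: "x \<in> carrier A" "star A x = x" "p \<otimes> x = x" "x \<otimes> p = x"
      using p b pb by (simp_all add: x_def star_smult star_add star_mult mult_smult_right mult_smult_left
          mult_r_distr mult_l_distr)
    have "nrm A x \<le> 1 - \<epsilon>"
      using le e p b mult_left_mono[OF le, of "1 - \<epsilon>"] by (simp add: x_def nrm_smult del: of_real_diff)
    then obtain w where w: "w \<in> carrier A" "star A w = w" "nrm A (w \<otimes> w \<ominus> (p \<ominus> x)) < \<epsilon>"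
      and wz: "\<And>z. \<lbrakk>z \<in> carrier A; z \<otimes> x = x \<otimes> z; z \<otimes> p = p \<otimes> z\<rbrakk> \<Longrightarrow> z \<otimes> w = w \<otimes> z"
      using approx_square_root[OF p x, of "1 - \<epsilon>" \<epsilon>] e by auto
    have bw: "b \<otimes> w = w \<otimes> b"
      using p b by (intro wz) (simp_all add: x_def mult_smult_right mult_smult_left mult_r_distr mult_l_distr mult_assoc)
    \<comment> \<open>Scaled so that \<open>u \<otimes> u\<close> is the \<open>b\<^sup>2\<close>
      part of \<open>x\<close>; then \<open>u \<otimes> u \<oplus> (p \<ominus> x)\<close> is
      exactly \<open>\<epsilon>\<close> times \<open>p\<close>.\<close>
    define u where "u = of_real (sqrt (1 - \<epsilon>)) \<odot> b"
    have u: "u \<in> carrier A" "star A u = u" using b by (simp_all add: u_def star_smult)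
    have uu: "u \<otimes> u = ?c \<odot> ?b2"
      using b e by (simp add: u_def mult_smult_right mult_smult_left smult_smult flip: of_real_mult)
    have px: "p \<ominus> x = of_real \<epsilon> \<odot> p \<oplus> (- ?c) \<odot> ?b2"
    proof -
      have "p \<ominus> x = (1 + (- ?c)) \<odot> p \<oplus> (- ?c) \<odot> ?b2"
        unfolding smult_add_left[OF p(1)] using p b
        by (simp add: x_def minus_eq_smult smult_add_right smult_smult a_ac del: of_real_diff)
      then show ?thesis by simp
    qed
    have "u \<otimes> u \<oplus> (p \<ominus> x) = of_real \<epsilon> \<odot> p \<oplus> (?c + (- ?c)) \<odot> ?b2"
      unfolding uu px smult_add_left[OF mult_closed[OF b(1) b(1)]] using p b by (simp add: a_ac del: of_real_diff)
    then have "u \<otimes> u \<oplus> (p \<ominus> x) = of_real \<epsilon> \<odot> p"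
      using p b by simp
    moreover have "u \<otimes> u \<oplus> w \<otimes> w = (u \<otimes> u \<oplus> (p \<ominus> x)) \<oplus> (w \<otimes> w \<ominus> (p \<ominus> x))"
    proof -
      have "w \<otimes> w = (p \<ominus> x) \<oplus> (w \<otimes> w \<ominus> (p \<ominus> x))"
        using minus_add_cancel[of "w \<otimes> w" "p \<ominus> x"] w p x by (simp add: a_comm)
      then show ?thesis using u w p x by (metis a_assoc minus_closed mult_closed)
    qed
    ultimately have eq: "u \<otimes> u \<oplus> w \<otimes> w = of_real \<epsilon> \<odot> p \<oplus> (w \<otimes> w \<ominus> (p \<ominus> x))" by simp
    have "nrm A u ^ 2 \<le> nrm A (u \<otimes> u \<oplus> w \<otimes> w)"
      using b w by (intro nrm_square_le_sum_squares[OF u w(1,2)])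
        (simp add: u_def mult_smult_left mult_smult_right bw)
    also have "\<dots> \<le> nrm A (of_real \<epsilon> \<odot> p) + nrm A (w \<otimes> w \<ominus> (p \<ominus> x))"
      unfolding eq using p w x by (intro nrm_triangle) auto
    also have "\<dots> \<le> \<epsilon> * 1 + \<epsilon>"
      using w nrm_projection_le[OF p] e p mult_left_mono[of "nrm A p" 1 \<epsilon>]
      by (intro add_mono) (simp_all add: nrm_smult)
    finally have "(1 - \<epsilon>) * nrm A b ^ 2 \<le> 2 * \<epsilon>"
      using e b by (simp add: u_def nrm_smult power_mult_distrib)
    \<comment> \<open>Here \<open>\<epsilon> \<le> 1/2\<close> enters and turns the bound
      \<open>2 * \<epsilon>\<close> into \<open>4 * \<epsilon>\<close>.\<close>
    moreover have "1/2 * nrm A b ^ 2 \<le> (1 - \<epsilon>) * nrm A b ^ 2"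
      using e by (intro mult_right_mono) auto
    ultimately show ?thesis by simp
  qed
  have "nrm A b ^ 2 \<le> 0"
  proof (rule field_le_epsilon)
    fix e :: real assume "e > 0"
    show "nrm A b ^ 2 \<le> 0 + e"
    \<comment> \<open>The choice \<open>\<epsilon> = e/4\<close> is admissible up to
      \<open>e = 2\<close>; beyond that the fixed bound \<open>2\<close>, from
      \<open>\<epsilon> = 1/2\<close>, is enough.\<close>
    proof (cases "e \<le> 2")
      case True
      then show ?thesis using bound[of "e/4"] \<open>e > 0\<close> by simp
    next
      case False
      have "nrm A b ^ 2 \<le> 2" using bound[of "1/2"] by simp
      with False show ?thesis by linarith
    qed
  qed
  then show ?thesis using b nrm_eq_zero by simp
qed

text \<open>For \<open>q = p\<^sub>i\<close> and \<open>T = q p\<^sub>j q\<close>, contractivity of the elements \<open>q - q p\<^sub>k q\<close> gives \<open>\<parallel>M q \<plusminus> T\<parallel> \<le> M\<close>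
  for some \<open>M > 0\<close>, and this forces \<open>T = 0\<close>.\<close>

lemma projections_orthogonal:
  assumes J: "cstar_unit A J" and F: "finite F"
    and p: "\<And>k. k \<in> F \<Longrightarrow> p k \<in> carrier A" "\<And>k. k \<in> F \<Longrightarrow> star A (p k) = p k"
      "\<And>k. k \<in> F \<Longrightarrow> p k \<otimes> p k = p k"
    and sum: "(\<Oplus>k\<in>F. p k) = J" and ij: "i \<in> F" "j \<in> F" "i \<noteq> j"
  shows "p j \<otimes> p i = \<zero>"
proof -
  define q where "q = p i"
  have q: "q \<in> carrier A" "star A q = q" "q \<otimes> q = q" using p ij by (auto simp: q_def)
  have J': "J \<in> carrier A" "\<And>x. x \<in> carrier A \<Longrightarrow> J \<otimes> x = x" "\<And>x. x \<in> carrier A \<Longrightarrow> x \<otimes> J = x"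
    using J by (auto simp: cstar_unit_def)
  have "star A J = J" using J' by (metis star_closed star_mult star_star)
  define t where "t k = q \<otimes> p k \<otimes> q" for k
  have tc: "t k \<in> carrier A" "star A (t k) = t k" "q \<otimes> t k = t k" "t k \<otimes> q = t k" if "k \<in> F" for k
    using that p q by (simp_all add: t_def star_mult mult_assoc, simp add: mult_assoc[symmetric] q)
  \<comment> \<open>The complement \<open>J \<ominus> p k\<close> is again a projection, hence a
    contraction, and \<open>q \<ominus> t k\<close> is its compression by \<open>q\<close>.\<close>
  have qt: "nrm A (q \<ominus> t k) \<le> 1" if k: "k \<in> F" for k
  proof -
    have e: "nrm A (J \<ominus> p k) \<le> 1"
      using J' p[OF k] \<open>star A J = J\<close>
      by (intro nrm_projection_le) (simp_all add: star_minus minus_distribs, simp add: minus_eq_smult)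
    have "q \<ominus> t k = q \<otimes> (J \<ominus> p k) \<otimes> q"
      using q J' p[OF k] by (simp add: t_def minus_distribs)
    also have "nrm A \<dots> \<le> nrm A q * nrm A (J \<ominus> p k) * nrm A q"
      using q J' p[OF k]
      by (intro order_trans[OF nrm_mult] mult_right_mono nrm_mult) (auto intro: nrm_nonneg)
    also have "\<dots> \<le> 1 * 1 * 1"
      using e nrm_projection_le[OF q] q J' p[OF k] by (intro mult_mono) (auto intro: nrm_nonneg)
    finally show ?thesis by simp
  qed
  \<comment> \<open>\<open>M\<close> counts the indices other than \<open>i\<close>. It bounds
    \<open>M q + T\<close> because \<open>T\<close> is minus the sum of the remaining compressions
    \<open>t k\<close>, each of which satisfies \<open>nrm A (q \<ominus> t k) \<le> 1\<close>, and
    it bounds \<open>M q - T\<close> because \<open>q \<ominus> T\<close> is a contraction.\<close>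
  define M where "M = card (F - {i, j}) + 1"
  have sub: "nrm A (of_nat (card G) \<odot> q \<ominus> (\<Oplus>k\<in>G. t k)) \<le> card G" if "G \<subseteq> F" for G
    using finite_subset[OF that F] that
  proof (induction G)
    case (insert k G)
    then have tG: "t \<in> G \<rightarrow> carrier A" "t k \<in> carrier A" using tc by auto
    have "of_nat (card (insert k G)) \<odot> q \<ominus> (\<Oplus>k\<in>insert k G. t k)
       = (q \<ominus> t k) \<oplus> (of_nat (card G) \<odot> q \<ominus> (\<Oplus>k\<in>G. t k))"
      using insert(1,2) tG q finsum_closed[OF tG(1)] smult_add_left[OF q(1), of 1 "of_nat (card G)"]
      by (simp add: finsum_insert minus_swap)
    then have "nrm A (of_nat (card (insert k G)) \<odot> q \<ominus> (\<Oplus>k\<in>insert k G. t k))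
      \<le> nrm A (q \<ominus> t k) + nrm A (of_nat (card G) \<odot> q \<ominus> (\<Oplus>k\<in>G. t k))"
      using tG q by (auto intro!: nrm_triangle finsum_closed)
    also have "\<dots> \<le> 1 + real (card G)"
      using insert qt[of k] by (intro add_mono) auto
    finally show ?case using insert(1,2) by simp
  qed (use q in \<open>simp add: minus_eq_smult\<close>)
  have tF: "t \<in> F' \<rightarrow> carrier A" if "F' \<subseteq> F" for F' using tc that by auto
  have "(\<Oplus>k\<in>F. t k) = q \<otimes> (\<Oplus>k\<in>F. p k) \<otimes> q"
    using F p q by (subst mult_finsum; (subst finsum_mult)?) (auto simp: t_def intro!: finsum_cong')
  then have "(\<Oplus>k\<in>F. t k) = q" using q J' by (simp add: sum)
  moreover have "(\<Oplus>k\<in>F. t k) = q \<oplus> (t j \<oplus> (\<Oplus>k\<in>F - {i, j}. t k))"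
  proof -
    have "F = insert i (insert j (F - {i, j}))" using ij by auto
    then have "(\<Oplus>k\<in>F. t k) = (\<Oplus>k\<in>insert i (insert j (F - {i, j})). t k)" by simp
    also have "\<dots> = t i \<oplus> (t j \<oplus> (\<Oplus>k\<in>F - {i, j}. t k))"
      using F ij tc by (subst finsum_insert, auto)+
    also have "t i = q" using q by (simp add: t_def q_def[symmetric])
    finally show ?thesis .
  qed
  ultimately have z': "q \<oplus> (t j \<oplus> (\<Oplus>k\<in>F - {i, j}. t k)) = q" by simp
  have "t j \<oplus> (\<Oplus>k\<in>F - {i, j}. t k) \<in> carrier A"
    using tc ij finsum_closed[OF tF, of "F - {i, j}"] by simp
  with z' q have z: "t j \<oplus> (\<Oplus>k\<in>F - {i, j}. t k) = \<zero>"
    using add.l_cancel_one[of q "t j \<oplus> (\<Oplus>k\<in>F - {i, j}. t k)"] by simp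
  define s where "s = (\<Oplus>k\<in>F - {i, j}. t k)"
  have s: "s \<in> carrier A" using finsum_closed[OF tF, of "F - {i, j}"] by (simp add: s_def)
  define T where "T = t j"
  have T: "T \<in> carrier A" "star A T = T" "q \<otimes> T = T" "T \<otimes> q = T" using tc ij by (auto simp: T_def)
  have "T = \<ominus> s" using minus_equality[of T s] z s T by (simp add: s_def T_def)
  have M1: "nrm A (of_nat M \<odot> q \<oplus> T) \<le> M"
  proof -
    have "of_nat M \<odot> q \<oplus> T = q \<oplus> (of_nat (card (F - {i, j})) \<odot> q \<ominus> s)"
      using q s smult_add_left[OF q(1), of 1 "of_nat (card (F - {i, j}))"]
      by (simp add: M_def \<open>T = \<ominus> s\<close> a_minus_def a_ac)
    also have "nrm A \<dots> \<le> 1 + card (F - {i, j})"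
      using nrm_projection_le[OF q] sub[of "F - {i, j}"] q s
      by (intro order_trans[OF nrm_triangle] add_mono) (auto simp: s_def)
    finally show ?thesis by (simp add: M_def)
  qed
  have M2: "nrm A (of_nat M \<odot> q \<ominus> T) \<le> M"
  proof -
    have "of_nat M \<odot> q \<ominus> T = of_nat (card (F - {i, j})) \<odot> q \<oplus> (q \<ominus> T)"
      using q T smult_add_left[OF q(1), of 1 "of_nat (card (F - {i, j}))"]
      by (simp add: M_def a_minus_def a_ac)
    also have "nrm A \<dots> \<le> nrm A (of_nat (card (F - {i, j})) \<odot> q) + nrm A (q \<ominus> T)"
      using q T by (intro nrm_triangle) auto
    also have "\<dots> \<le> real (card (F - {i, j})) * 1 + 1"
      using q nrm_projection_le[OF q] qt[OF ij(2)] mult_left_mono[of "nrm A q" 1 "real (card (F - {i, j}))"]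
      by (intro add_mono) (simp_all add: nrm_smult T_def)
    finally show ?thesis by (simp add: M_def)
  qed
  have Mpos: "real M > 0" by (simp add: M_def)
  define b where "b = of_real (1 / M) \<odot> T"
  have b: "b \<in> carrier A" "star A b = b" "q \<otimes> b = b" "b \<otimes> q = b"
    using T q by (simp_all add: b_def star_smult mult_smult_left mult_smult_right del: of_real_divide)
  have pm: "nrm A (q \<oplus> b) \<le> 1" "nrm A (q \<ominus> b) \<le> 1"
  proof -
    have *: "of_nat M \<odot> b = T" using T Mpos by (simp add: b_def smult_smult)
    have "real M * nrm A (q \<oplus> b) \<le> real M * 1"
      using M1 q b by (simp add: *[symmetric] smult_add_right[symmetric] nrm_smult)
    then show "nrm A (q \<oplus> b) \<le> 1" using Mpos by (simp only: mult_le_cancel_left_pos)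
    have "real M * nrm A (q \<ominus> b) \<le> real M * 1"
      using M2 q b by (simp add: *[symmetric] smult_minus[symmetric] nrm_smult)
    then show "nrm A (q \<ominus> b) \<le> 1" using Mpos by (simp only: mult_le_cancel_left_pos)
  qed
  \<comment> \<open>Parallelogram identity: the squares of the contractions
    \<open>q \<oplus> b\<close> and \<open>q \<ominus> b\<close> add up to twice
    \<open>q \<oplus> b \<otimes> b\<close>, which therefore has norm at most
    \<open>1\<close>.\<close>
  have "(q \<oplus> b) \<otimes> (q \<oplus> b) \<oplus> (q \<ominus> b) \<otimes> (q \<ominus> b)
     = (q \<oplus> q) \<oplus> ((b \<oplus> (-1) \<odot> b) \<oplus> ((b \<oplus> (-1) \<odot> b) \<oplus> (b \<otimes> b \<oplus> b \<otimes> b)))"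
    using q b by (simp add: minus_eq_smult mult_l_distr mult_r_distr mult_smult_left mult_smult_right
        smult_smult smult_add_right a_ac)
  also have "b \<oplus> (-1) \<odot> b = \<zero>"
    using b smult_add_left[of b 1 "-1"] by simp
  also have "(q \<oplus> q) \<oplus> (\<zero> \<oplus> (\<zero> \<oplus> (b \<otimes> b \<oplus> b \<otimes> b))) = 2 \<odot> (q \<oplus> b \<otimes> b)"
    using q b smult_add_left[of "q \<oplus> b \<otimes> b" 1 1] by (simp add: a_ac)
  finally have "2 * nrm A (q \<oplus> b \<otimes> b) = nrm A ((q \<oplus> b) \<otimes> (q \<oplus> b) \<oplus> (q \<ominus> b) \<otimes> (q \<ominus> b))"
    using q b by (simp add: nrm_smult)
  also have "\<dots> \<le> nrm A (q \<oplus> b) * nrm A (q \<oplus> b) + nrm A (q \<ominus> b) * nrm A (q \<ominus> b)"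
    using q b by (intro order_trans[OF nrm_triangle] add_mono nrm_mult) auto
  also have "\<dots> \<le> 1 * 1 + 1 * 1"
    using pm q b by (intro add_mono mult_mono) (auto intro: nrm_nonneg)
  finally have "b = \<zero>" using eq_zero_if_nrm_le_1[OF q b] by simp
  then have "T = \<zero>"
    using T Mpos nrm_smult[OF T(1), of "of_real (1 / M)"] nrm_eq_zero[OF T(1)] by (auto simp: b_def)
  \<comment> \<open>\<open>T\<close> is the adjoint of \<open>p j \<otimes> q\<close> times
    \<open>p j \<otimes> q\<close>, so its vanishing kills that product by the C*-identity.\<close>
  moreover have "star A (p j \<otimes> q) \<otimes> (p j \<otimes> q) = T"
    using p[OF ij(2)] q by (simp add: T_def t_def star_mult mult_assoc) (metis mult_assoc mult_closed)
  ultimately show ?thesis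
    using zero_if_star_mult_zero[of "p j \<otimes> q"] p ij q by (simp add: q_def)
qed

end

section \<open>Algebras of bounded functions\<close>

abbreviation fn_alg :: "'x set \<Rightarrow> ('x \<Rightarrow> complex) set \<Rightarrow> ('x \<Rightarrow> complex) cstar" where
  "fn_alg X E \<equiv> bounded_functions X\<lparr>carrier := E\<rparr>"

lemma bounded_functions_simps [simp]:
  "add (bounded_functions X) = (\<lambda>f g x. f x + g x)"
  "mult (bounded_functions X) = (\<lambda>f g x. f x * g x)"
  "zero (bounded_functions X) = (\<lambda>x. 0)"
  "smult (bounded_functions X) = (\<lambda>c f x. c * f x)"
  "star (bounded_functions X) = (\<lambda>f x. cnj (f x))"
  "nrm (bounded_functions X) = (\<lambda>f. SUP x. cmod (f x))"
  by (simp_all add: bounded_functions_def)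

lemma carrier_bounded_functions:
  "carrier (bounded_functions X) = {f. bounded (range f) \<and> (\<forall>x. x \<notin> X \<longrightarrow> f x = 0)}"
  by (simp add: bounded_functions_def)

lemma fn_alg_carrier [simp]: "fn_alg X (carrier (bounded_functions X)) = bounded_functions X"
  by simp

text \<open>Membership in the sup-norm closure, phrased pointwise so that neither suprema nor
  boundedness of \<open>f - g\<close> have to be mentioned.\<close>

definition unif_limit :: "('x \<Rightarrow> complex) set \<Rightarrow> ('x \<Rightarrow> complex) \<Rightarrow> bool" where
  "unif_limit S f \<longleftrightarrow> (\<forall>e>0. \<exists>g\<in>S. \<forall>x. cmod (f x - g x) \<le> e)"

text \<open>The unital C*-subalgebras of the bounded functions. The limit clause ranges over
  arbitrary \<open>f\<close>; uniform limits of members are bounded and vanish off \<open>X\<close>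
  anyway, so this is closedness in \<open>bounded_functions X\<close>.\<close>

definition function_algebra :: "'x set \<Rightarrow> ('x \<Rightarrow> complex) set \<Rightarrow> bool" where
  "function_algebra X E \<longleftrightarrow>
     E \<subseteq> carrier (bounded_functions X) \<and> indicator X \<in> E \<and>
     (\<forall>f\<in>E. \<forall>g\<in>E. (\<lambda>x. f x + g x) \<in> E) \<and> (\<forall>c. \<forall>f\<in>E. (\<lambda>x. c * f x) \<in> E) \<and>
     (\<forall>f\<in>E. \<forall>g\<in>E. (\<lambda>x. f x * g x) \<in> E) \<and> (\<forall>f\<in>E. (\<lambda>x. cnj (f x)) \<in> E) \<and>
     (\<forall>f. unif_limit E f \<longrightarrow> f \<in> E)"

lemma function_algebraD:
  assumes "function_algebra X E"
  shows "E \<subseteq> carrier (bounded_functions X)" "indicator X \<in> E"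
    "f \<in> E \<Longrightarrow> g \<in> E \<Longrightarrow> (\<lambda>x. f x + g x) \<in> E" "f \<in> E \<Longrightarrow> (\<lambda>x. c * f x) \<in> E"
    "f \<in> E \<Longrightarrow> g \<in> E \<Longrightarrow> (\<lambda>x. f x * g x) \<in> E" "f \<in> E \<Longrightarrow> (\<lambda>x. cnj (f x)) \<in> E"
    "unif_limit E f \<Longrightarrow> f \<in> E" "f \<in> E \<Longrightarrow> x \<notin> X \<Longrightarrow> f x = 0" "f \<in> E \<Longrightarrow> bounded (range f)"
  using assms unfolding function_algebra_def carrier_bounded_functions by blast+

lemma function_algebra_zero: "function_algebra X E \<Longrightarrow> (\<lambda>x. 0) \<in> E"
  using function_algebraD(4)[of X E "indicator X" 0] function_algebraD(2)[of X E] by simp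

lemma function_algebra_minus: "function_algebra X E \<Longrightarrow> f \<in> E \<Longrightarrow> g \<in> E \<Longrightarrow> (\<lambda>x. f x - g x) \<in> E"
  using function_algebraD(3)[of X E f "\<lambda>x. (-1) * g x"] function_algebraD(4)[of X E g "-1"] by simp

lemma function_algebra_sum:
  assumes "function_algebra X E" "finite F" "\<And>i. i \<in> F \<Longrightarrow> f i \<in> E"
  shows "(\<lambda>x. \<Sum>i\<in>F. f i x) \<in> E"
  using assms(2,3) by (induction F) (simp_all add: function_algebra_zero[OF assms(1)] function_algebraD(3)[OF assms(1)])

lemma bounded_range_add:
  fixes f g :: "'x \<Rightarrow> complex"
  assumes "bounded (range f)" "bounded (range g)" shows "bounded (range (\<lambda>x. f x + g x))"
proof -
  obtain a b where "\<And>x. cmod (f x) \<le> a" "\<And>x. cmod (g x) \<le> b"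
    using assms by (auto simp: bounded_iff)
  then have "cmod (f x + g x) \<le> a + b" for x by (meson norm_triangle_mono)
  then show ?thesis by (auto simp: bounded_iff)
qed

lemma bounded_range_mult:
  fixes f g :: "'x \<Rightarrow> complex"
  assumes "bounded (range f)" "bounded (range g)" shows "bounded (range (\<lambda>x. f x * g x))"
proof -
  obtain a b where "\<And>x. cmod (f x) \<le> a" "\<And>x. cmod (g x) \<le> b"
    using assms by (auto simp: bounded_iff)
  then have "cmod (f x * g x) \<le> a * b" for x
    by (metis mult_mono' norm_ge_zero norm_mult)
  then show ?thesis by (auto simp: bounded_iff)
qed

lemma bounded_range_unif_limit:
  assumes "unif_limit E f" "\<And>g. g \<in> E \<Longrightarrow> bounded (range g)" shows "bounded (range f)"
proof -
  obtain g where g: "g \<in> E" "\<And>x. cmod (f x - g x) \<le> 1"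
    using assms(1) unfolding unif_limit_def by (metis zero_less_one)
  then have "bounded (range (\<lambda>x. g x + (f x - g x)))"
    using assms(2)[OF g(1)] by (intro bounded_range_add) (auto simp: bounded_iff)
  then show ?thesis by simp
qed

lemma unif_limit_eq:
  assumes "unif_limit E f" "\<And>g. g \<in> E \<Longrightarrow> g x = c" shows "f x = c"
proof (rule ccontr)
  assume "f x \<noteq> c"
  then have "cmod (f x - c) > 0" by simp
  then obtain g where "g \<in> E" "cmod (f x - g x) \<le> cmod (f x - c) / 2"
    using assms(1) unfolding unif_limit_def by (metis half_gt_zero)
  with assms(2)[of g] \<open>cmod (f x - c) > 0\<close> show False by simp
qed

lemma unif_limit_mono: "unif_limit E f \<Longrightarrow> E \<subseteq> F \<Longrightarrow> unif_limit F f"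
  unfolding unif_limit_def by blast

lemma function_algebra_bounded_functions:
  "function_algebra X (carrier (bounded_functions X))" (is "function_algebra X ?C")
  unfolding function_algebra_def
proof (intro conjI ballI allI impI)
  have C: "f \<in> ?C \<longleftrightarrow> bounded (range f) \<and> (\<forall>x. x \<notin> X \<longrightarrow> f x = 0)" for f
    by (simp add: carrier_bounded_functions)
  show "indicator X \<in> ?C"
    by (auto simp: C bounded_iff indicator_def intro!: exI[of _ 1])
  fix f g c
  assume f: "f \<in> ?C"
  then show "(\<lambda>x. cnj (f x)) \<in> ?C" by (simp add: C bounded_iff)
  show "(\<lambda>x. c * f x) \<in> ?C"
    unfolding C
  proof
    show "bounded (range (\<lambda>x. c * f x))" by (rule bounded_range_mult) (use f in \<open>auto simp: C\<close>)
  qed (use f in \<open>auto simp: C\<close>)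
  assume g: "g \<in> ?C"
  show "(\<lambda>x. f x + g x) \<in> ?C"
    unfolding C
  proof
    show "bounded (range (\<lambda>x. f x + g x))" by (rule bounded_range_add) (use f g in \<open>auto simp: C\<close>)
  qed (use f g in \<open>auto simp: C\<close>)
  show "(\<lambda>x. f x * g x) \<in> ?C"
    unfolding C
  proof
    show "bounded (range (\<lambda>x. f x * g x))" by (rule bounded_range_mult) (use f g in \<open>auto simp: C\<close>)
  qed (use f g in \<open>auto simp: C\<close>)
next
  fix f assume f: "unif_limit ?C f"
  have "bounded (range f)"
    by (rule bounded_range_unif_limit[OF f]) (simp add: carrier_bounded_functions)
  moreover have "f x = 0" if "x \<notin> X" for x
    by (rule unif_limit_eq[OF f]) (simp add: carrier_bounded_functions that)
  ultimately show "f \<in> ?C" by (simp add: carrier_bounded_functions)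
qed simp

text \<open>\<open>a_inv\<close> is a definite description over the carrier, so the additive inverse
  has to be identified within each \<open>E\<close> separately.\<close>

lemma fn_alg_minus:
  assumes E: "function_algebra X E" and f: "f \<in> E" "g \<in> E"
  shows "f \<ominus>\<^bsub>fn_alg X E\<^esub> g = (\<lambda>x. f x - g x)"
proof -
  have "\<ominus>\<^bsub>fn_alg X E\<^esub> g = (\<lambda>x. - g x)"
    unfolding a_inv_def m_inv_def
  proof (rule the_equality)
    show "(\<lambda>x. - g x) \<in> carrier (add_monoid (fn_alg X E)) \<and>
      g \<otimes>\<^bsub>add_monoid (fn_alg X E)\<^esub> (\<lambda>x. - g x) = \<one>\<^bsub>add_monoid (fn_alg X E)\<^esub> \<and>
      (\<lambda>x. - g x) \<otimes>\<^bsub>add_monoid (fn_alg X E)\<^esub> g = \<one>\<^bsub>add_monoid (fn_alg X E)\<^esub>"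
      using function_algebraD(4)[OF E f(2), of "-1"] by simp
    fix y
    assume "y \<in> carrier (add_monoid (fn_alg X E)) \<and>
      g \<otimes>\<^bsub>add_monoid (fn_alg X E)\<^esub> y = \<one>\<^bsub>add_monoid (fn_alg X E)\<^esub> \<and>
      y \<otimes>\<^bsub>add_monoid (fn_alg X E)\<^esub> g = \<one>\<^bsub>add_monoid (fn_alg X E)\<^esub>"
    then have "(\<lambda>x. y x + g x) = (\<lambda>x. 0)" by simp
    then show "y = (\<lambda>x. - g x)" by (metis eq_neg_iff_add_eq_0)
  qed
  then show ?thesis by (simp add: a_minus_def)
qed

lemma SUP_cmod_le_iff:
  assumes "bounded (range (f :: 'x \<Rightarrow> complex))" shows "(SUP x. cmod (f x)) \<le> e \<longleftrightarrow> (\<forall>x. cmod (f x) \<le> e)"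
proof -
  have "bdd_above (range (\<lambda>x. cmod (f x)))"
    using assms by (auto simp: bounded_iff bdd_above_def)
  then show ?thesis by (simp add: cSUP_le_iff)
qed

lemma cmod_le_SUP: "bounded (range (f :: 'x \<Rightarrow> complex)) \<Longrightarrow> cmod (f x) \<le> (SUP x. cmod (f x))"
  using SUP_cmod_le_iff by blast

lemma Metric_space_fn_alg:
  assumes E: "function_algebra X E"
  shows "Metric_space E (cstar_dist (fn_alg X E))"
proof
  note b = function_algebraD(9)[OF E] and m = function_algebra_minus[OF E]
  let ?d = "cstar_dist (fn_alg X E)"
  have d: "?d f g = (SUP x. cmod (f x - g x))" if "f \<in> E" "g \<in> E" for f g
    using that by (simp add: cstar_dist_def fn_alg_minus[OF E])
  show "0 \<le> ?d f g" for f g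
    using d[of f g] order_trans[OF norm_ge_zero cmod_le_SUP[OF b[OF m]]]
    by (cases "f \<in> E \<and> g \<in> E") (auto simp: cstar_dist_def)
  show "?d f g = ?d g f" for f g
    using d[of f g] d[of g f] by (cases "f \<in> E \<and> g \<in> E") (auto simp: cstar_dist_def norm_minus_commute)
  show "?d f g = 0 \<longleftrightarrow> f = g" if "f \<in> E" "g \<in> E" for f g
  proof
    assume "?d f g = 0"
    then have "cmod (f x - g x) \<le> 0" for x
      using cmod_le_SUP[OF b[OF m[OF that]], of x] d[OF that] by simp
    then show "f = g" by (simp add: fun_eq_iff)
  qed (use that in \<open>simp add: d\<close>)
  show "?d f h \<le> ?d f g + ?d g h" if "f \<in> E" "g \<in> E" "h \<in> E" for f g h
  proof -
    have "cmod (f x - h x) \<le> ?d f g + ?d g h" for x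
      using cmod_le_SUP[OF b[OF m], of f g x] cmod_le_SUP[OF b[OF m], of g h x]
        norm_triangle_ineq[of "f x - g x" "g x - h x"] that by (simp add: d)
    then show ?thesis using that d[of f h] SUP_cmod_le_iff[OF b[OF m], of f h] by simp
  qed
qed

lemma closedin_fn_alg_iff:
  assumes E: "function_algebra X E"
  shows "closedin (Metric_space.mtopology E (cstar_dist (fn_alg X E))) V \<longleftrightarrow>
    V \<subseteq> E \<and> (\<forall>f\<in>E. unif_limit V f \<longrightarrow> f \<in> V)"
proof -
  interpret M: Metric_space E "cstar_dist (fn_alg X E)" by (rule Metric_space_fn_alg[OF E])
  have d: "cstar_dist (fn_alg X E) f g \<le> e \<longleftrightarrow> (\<forall>x. cmod (f x - g x) \<le> e)" if "f \<in> E" "g \<in> E" for f g e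
    using that function_algebraD(9)[OF E function_algebra_minus[OF E that]]
    by (simp add: cstar_dist_def fn_alg_minus[OF E] SUP_cmod_le_iff)
  have "unif_limit V f \<longleftrightarrow> \<not> (\<exists>r>0. disjnt V (M.mcball f r))" if "V \<subseteq> E" "f \<in> E" for f
    unfolding unif_limit_def disjnt_iff M.in_mcball using that d by (metis subsetD)
  \<comment> \<open>\<open>unif_limit\<close> uses non-strict bounds and thus corresponds to closed
    balls, while closedness is expressed by open ones; halving radii reconciles the two.\<close>
  moreover have "(\<exists>r>0. disjnt V (M.mcball f r)) \<longleftrightarrow> (\<exists>r>0. disjnt V (M.mball f r))" for f
    unfolding disjnt_iff M.in_mball M.in_mcball by (meson dense le_less_trans less_imp_le)
  ultimately show ?thesis unfolding M.closedin_metric by blast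
qed

lemma cstar_subalgebra_fn_alg_iff:
  assumes E: "function_algebra X E"
  shows "cstar_subalgebra (fn_alg X E) S \<longleftrightarrow> S \<subseteq> E \<and> (\<lambda>x. 0) \<in> S \<and>
     (\<forall>f\<in>S. \<forall>g\<in>S. (\<lambda>x. f x + g x) \<in> S) \<and> (\<forall>c. \<forall>f\<in>S. (\<lambda>x. c * f x) \<in> S) \<and>
     (\<forall>f\<in>S. \<forall>g\<in>S. (\<lambda>x. f x * g x) \<in> S) \<and> (\<forall>f\<in>S. (\<lambda>x. cnj (f x)) \<in> S) \<and>
     (\<forall>f. unif_limit S f \<longrightarrow> f \<in> S)"
proof -
  have "unif_limit S f \<Longrightarrow> S \<subseteq> E \<Longrightarrow> f \<in> E" for f
    using unif_limit_mono function_algebraD(7)[OF E] by blast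
  then show ?thesis
    by (auto simp: cstar_subalgebra_def closed_subspace_def closedin_fn_alg_iff[OF E])
qed

lemma function_algebra_generated:
  assumes E: "function_algebra X E" and G: "G \<subseteq> E" "indicator X \<in> G"
  shows "function_algebra X (cstar_generated (fn_alg X E) G)" "cstar_generated (fn_alg X E) G \<subseteq> E"
    "G \<subseteq> cstar_generated (fn_alg X E) G"
proof -
  let ?S = "cstar_generated (fn_alg X E) G"
  have "cstar_subalgebra (fn_alg X E) E"
    unfolding cstar_subalgebra_fn_alg_iff[OF E]
    using E function_algebra_zero[OF E] by (auto simp: function_algebra_def)
  with G show E': "?S \<subseteq> E" by (auto simp: cstar_generated_def)
  show "G \<subseteq> ?S" by (auto simp: cstar_generated_def)
  then have "indicator X \<in> ?S" using G by auto
  moreover have "f \<in> ?S" if f: "unif_limit ?S f" for f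
  proof -
    have "f \<in> S" if S: "cstar_subalgebra (fn_alg X E) S" "G \<subseteq> S" for S
    proof -
      have "?S \<subseteq> S" using S by (auto simp: cstar_generated_def)
      then have "unif_limit S f" using f unif_limit_mono by blast
      with S show ?thesis unfolding cstar_subalgebra_fn_alg_iff[OF E] by blast
    qed
    then show ?thesis by (auto simp: cstar_generated_def)
  qed
  moreover have "cstar_subalgebra (fn_alg X E) S \<Longrightarrow> (\<forall>f\<in>S. \<forall>g\<in>S. (\<lambda>x. f x + g x) \<in> S) \<and>
     (\<forall>c. \<forall>f\<in>S. (\<lambda>x. c * f x) \<in> S) \<and> (\<forall>f\<in>S. \<forall>g\<in>S. (\<lambda>x. f x * g x) \<in> S) \<and>
     (\<forall>f\<in>S. (\<lambda>x. cnj (f x)) \<in> S)" for S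
    unfolding cstar_subalgebra_fn_alg_iff[OF E] by blast
  then have "(\<forall>f\<in>?S. \<forall>g\<in>?S. (\<lambda>x. f x + g x) \<in> ?S) \<and>
     (\<forall>c. \<forall>f\<in>?S. (\<lambda>x. c * f x) \<in> ?S) \<and> (\<forall>f\<in>?S. \<forall>g\<in>?S. (\<lambda>x. f x * g x) \<in> ?S) \<and>
     (\<forall>f\<in>?S. (\<lambda>x. cnj (f x)) \<in> ?S)"
    unfolding cstar_generated_def by simp
  moreover have "?S \<subseteq> carrier (bounded_functions X)"
    using E' function_algebraD(1)[OF E] by blast
  ultimately show "function_algebra X ?S"
    unfolding function_algebra_def by blast
qed

text \<open>The rule is shaped to have no case for conjugation. Intertwining relations
  \<open>k f \<otimes> T a = T a \<otimes> k (lambda_op X a f)\<close> could not meet such a case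
  directly, since taking adjoints replaces \<open>T a\<close> by its adjoint.\<close>

lemma cstar_generated_fn_alg_induct:
  assumes E: "function_algebra X E" and G: "G \<subseteq> E" and unit: "indicator X \<in> G"
    and real: "\<forall>f\<in>G. \<forall>x. cnj (f x) = f x"
    and f: "f \<in> cstar_generated (fn_alg X E) G" and gen: "\<And>f. f \<in> G \<Longrightarrow> P f"
    and add: "\<And>f g. \<lbrakk>f \<in> cstar_generated (fn_alg X E) G;
      g \<in> cstar_generated (fn_alg X E) G; P f; P g\<rbrakk> \<Longrightarrow> P (\<lambda>x. f x + g x)"
    and smult: "\<And>c f. \<lbrakk>f \<in> cstar_generated (fn_alg X E) G; P f\<rbrakk> \<Longrightarrow> P (\<lambda>x. c * f x)"
    and mult: "\<And>f g. \<lbrakk>f \<in> cstar_generated (fn_alg X E) G;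
      g \<in> cstar_generated (fn_alg X E) G; P f; P g\<rbrakk> \<Longrightarrow> P (\<lambda>x. f x * g x)"
    and limit: "\<And>f. \<lbrakk>f \<in> cstar_generated (fn_alg X E) G; unif_limit {g \<in> cstar_generated (fn_alg X E) G. P g} f\<rbrakk> \<Longrightarrow> P f"
  shows "P f"
proof -
  let ?S = "cstar_generated (fn_alg X E) G"
  note S = function_algebra_generated[OF E G unit]
  note SD = function_algebraD[OF S(1)]
  \<comment> \<open>Symmetrizing \<open>P\<close> makes closure under conjugation automatic.\<close>
  define V where "V = {f \<in> ?S. P f \<and> P (\<lambda>x. cnj (f x))}"
  have V: "g \<in> V \<longleftrightarrow> g \<in> ?S \<and> P g \<and> P (\<lambda>x. cnj (g x))" for g by (simp add: V_def)
  have GV: "G \<subseteq> V"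
  proof
    fix g assume g: "g \<in> G"
    have eq: "(\<lambda>x. cnj (g x)) = g" by (rule ext) (rule real[rule_format, OF g])
    show "g \<in> V" unfolding V eq using S(3) gen[OF g] g by blast
  qed
  have limV: "g \<in> V" if g: "unif_limit V g" for g
  proof -
    have VP: "V \<subseteq> {g \<in> ?S. P g}" unfolding V_def by blast
    then have d: "unif_limit {g \<in> ?S. P g} g" by (rule unif_limit_mono[OF g])
    have "unif_limit ?S g" by (rule unif_limit_mono[OF g]) (auto simp: V)
    then have gS: "g \<in> ?S" by (rule SD(7))
    have "unif_limit {g \<in> ?S. P g} (\<lambda>x. cnj (g x))"
      unfolding unif_limit_def
    proof (intro allI impI)
      fix e :: real assume "e > 0"
      then obtain h where h: "h \<in> V" "\<And>x. cmod (g x - h x) \<le> e" using g unfolding unif_limit_def by blast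
      have "cmod (cnj (g x) - cnj (h x)) \<le> e" for x
        using h(2)[of x] by (metis complex_cnj_diff complex_mod_cnj)
      then show "\<exists>h\<in>{g \<in> ?S. P g}. \<forall>x. cmod (cnj (g x) - h x) \<le> e"
        using h(1) SD(6)[of h] unfolding V
        by (intro bexI[of _ "\<lambda>x. cnj (h x)"] CollectI conjI allI) simp_all
    qed
    from gS limit[OF gS d] limit[OF SD(6)[OF gS] this] show ?thesis unfolding V by (intro conjI)
  qed
  have addV: "(\<lambda>x. f x + g x) \<in> V" "(\<lambda>x. f x * g x) \<in> V" if fg: "f \<in> V" "g \<in> V" for f g
  proof -
    have m: "f \<in> ?S" "P f" "P (\<lambda>x. cnj (f x))" "g \<in> ?S" "P g" "P (\<lambda>x. cnj (g x))" using fg unfolding V by blast+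
    show "(\<lambda>x. f x + g x) \<in> V" "(\<lambda>x. f x * g x) \<in> V"
      unfolding V complex_cnj_add complex_cnj_mult
      by (intro conjI SD(3,5)[OF m(1,4)] add[OF m(1,4,2,5)] add[OF SD(6)[OF m(1)] SD(6)[OF m(4)] m(3,6)]
          mult[OF m(1,4,2,5)] mult[OF SD(6)[OF m(1)] SD(6)[OF m(4)] m(3,6)])+
  qed
  have smultV: "(\<lambda>x. c * f x) \<in> V" if f: "f \<in> V" for c f
  proof -
    have m: "f \<in> ?S" "P f" "P (\<lambda>x. cnj (f x))" using f unfolding V by blast+
    show ?thesis
      unfolding V complex_cnj_mult by (intro conjI SD(4)[OF m(1)] smult[OF m(1,2)] smult[OF SD(6)[OF m(1)] m(3)])
  qed
  have cnjV: "(\<lambda>x. cnj (f x)) \<in> V" if f: "f \<in> V" for f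
  proof -
    have "f \<in> ?S" "P f" "P (\<lambda>x. cnj (f x))" using f unfolding V by blast+
    then show ?thesis unfolding V complex_cnj_cnj by (simp only: SD(6) simp_thms)
  qed
  have zeroV: "(\<lambda>x. 0) \<in> V" using smultV[of "indicator X" 0] subsetD[OF GV unit] by simp
  have subV: "V \<subseteq> E" using S(2) by (auto simp: V)
  have "cstar_subalgebra (fn_alg X E) V"
    unfolding cstar_subalgebra_fn_alg_iff[OF E]
    by (intro conjI ballI allI impI subV zeroV smultV addV cnjV) (assumption | erule limV)+
  then have "?S \<subseteq> V" using GV by (auto simp: cstar_generated_def)
  with f have "f \<in> V" by blast
  then show ?thesis unfolding V by blast
qed

text \<open>Bernstein polynomials approximate \<open>sqrt (1 - t)\<close> uniformly on the unit
  interval, and \<open>t = f\<^sup>2\<close> may be substituted because \<open>f\<close> is real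
  with values in \<open>[-1, 1]\<close>. The factor \<open>indicator X\<close> cancels the value
  \<open>1\<close> taken off \<open>X\<close>.\<close>

lemma function_algebra_sqrt:
  assumes E: "function_algebra X E" and f: "f \<in> E" "\<And>x. f x \<in> \<real>" "\<And>x. cmod (f x) \<le> 1"
  shows "(\<lambda>x. indicator X x * of_real (sqrt (1 - (Re (f x))\<^sup>2))) \<in> E"
proof (rule function_algebraD(7)[OF E])
  let ?w = "\<lambda>x. indicator X x * complex_of_real (sqrt (1 - (Re (f x))\<^sup>2))"
  \<comment> \<open>The Bernstein summand as an element of \<open>E\<close>:
    \<open>indicator X\<close> plays the role of \<open>1\<close>, and multiplying each power by it
    makes zeroth powers vanish off \<open>X\<close>.\<close>
  define T where "T n k x = complex_of_real (sqrt (1 - real k / real n) * real (n choose k)) *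
     ((indicator X x * (f x * f x) ^ k) * (indicator X x * (indicator X x - f x * f x) ^ (n - k)))" for n k x
  have pow: "(\<lambda>x. indicator X x * h x ^ n) \<in> E" if h: "h \<in> E" for h n
  proof (induction n)
    case (Suc n)
    then show ?case using function_algebraD(5)[OF E Suc h] by (simp add: mult_ac)
  qed (simp add: function_algebraD(2)[OF E])
  have T: "T n k \<in> E" for n k
    unfolding T_def
    by (intro function_algebraD(4,5)[OF E] pow function_algebra_minus[OF E] f function_algebraD(2)[OF E])
  show "unif_limit E ?w"
    unfolding unif_limit_def
  proof (intro allI impI)
    fix e :: real assume "e > 0"
    have "continuous_on {0..1} (\<lambda>t. sqrt (1 - t) :: real)" by (intro continuous_intros)
    from Bernstein_Weierstrass[OF this \<open>e > 0\<close>] obtain n where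
      n: "\<And>t. t \<in> {0..1} \<Longrightarrow> \<bar>sqrt (1 - t) - (\<Sum>k\<le>n. sqrt (1 - real k / real n) * Bernstein n k t)\<bar> < e"
      by blast
    let ?g = "\<lambda>x. \<Sum>k\<le>n. T n k x"
    have "?g \<in> E" by (intro function_algebra_sum[OF E] T) simp
    moreover have "cmod (?w x - ?g x) \<le> e" for x
    proof (cases "x \<in> X")
      case True
      define s where "s = Re (f x)"
      have fx: "f x = of_real s" using f(2)[of x] by (simp add: s_def)
      have s: "s * s \<in> {0..1}" using f(3)[of x] abs_square_le_1[of s] by (simp add: fx power2_eq_square)
      have "?g x = of_real (\<Sum>k\<le>n. sqrt (1 - real k / real n) * Bernstein n k (s * s))"
        using True by (simp add: T_def fx Bernstein_def mult_ac)
      moreover have "?w x = of_real (sqrt (1 - s * s))" using True by (simp add: s_def power2_eq_square)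
      ultimately have "cmod (?w x - ?g x) = \<bar>sqrt (1 - s * s) - (\<Sum>k\<le>n. sqrt (1 - real k / real n) * Bernstein n k (s * s))\<bar>"
        by (simp only: of_real_diff[symmetric] norm_of_real)
      then show ?thesis using n[OF s] by simp
    qed (use \<open>e > 0\<close> in \<open>simp add: T_def\<close>)
    ultimately show "\<exists>g\<in>E. \<forall>x. cmod (?w x - g x) \<le> e" by (intro bexI[of _ ?g]) auto
  qed
qed

section \<open>Homomorphisms defined on function algebras\<close>

lemma star_hom_fn_algD:
  assumes "star_hom (fn_alg X E) B k"
  shows "f \<in> E \<Longrightarrow> k f \<in> carrier B"
    "f \<in> E \<Longrightarrow> g \<in> E \<Longrightarrow> k (\<lambda>x. f x + g x) = k f \<oplus>\<^bsub>B\<^esub> k g"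
    "f \<in> E \<Longrightarrow> k (\<lambda>x. c * f x) = c \<odot>\<^bsub>B\<^esub> k f"
    "f \<in> E \<Longrightarrow> g \<in> E \<Longrightarrow> k (\<lambda>x. f x * g x) = k f \<otimes>\<^bsub>B\<^esub> k g"
    "f \<in> E \<Longrightarrow> k (\<lambda>x. cnj (f x)) = star B (k f)"
  using assms by (auto simp: star_hom_def)

lemma star_hom_fn_algI:
  assumes "\<And>f. f \<in> E \<Longrightarrow> k f \<in> carrier B"
    "\<And>f g. f \<in> E \<Longrightarrow> g \<in> E \<Longrightarrow> k (\<lambda>x. f x + g x) = k f \<oplus>\<^bsub>B\<^esub> k g"
    "\<And>c f. f \<in> E \<Longrightarrow> k (\<lambda>x. c * f x) = c \<odot>\<^bsub>B\<^esub> k f"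
    "\<And>f g. f \<in> E \<Longrightarrow> g \<in> E \<Longrightarrow> k (\<lambda>x. f x * g x) = k f \<otimes>\<^bsub>B\<^esub> k g"
    "\<And>f. f \<in> E \<Longrightarrow> k (\<lambda>x. cnj (f x)) = star B (k f)"
  shows "star_hom (fn_alg X E) B k"
  using assms by (auto simp: star_hom_def)

lemma star_hom_fn_alg_subset:
  assumes k: "star_hom (fn_alg X E) B k" and F: "F \<subseteq> E" shows "star_hom (fn_alg X F) B k"
proof (rule star_hom_fn_algI)
  fix f g c assume "f \<in> F"
  then have f: "f \<in> E" using F by blast
  show "k f \<in> carrier B" "k (\<lambda>x. c * f x) = c \<odot>\<^bsub>B\<^esub> k f" "k (\<lambda>x. cnj (f x)) = star B (k f)"
    by (rule star_hom_fn_algD[OF k f])+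
  assume "g \<in> F"
  then have g: "g \<in> E" using F by blast
  show "k (\<lambda>x. f x + g x) = k f \<oplus>\<^bsub>B\<^esub> k g" "k (\<lambda>x. f x * g x) = k f \<otimes>\<^bsub>B\<^esub> k g"
    by (rule star_hom_fn_algD(2,4)[OF k f g])+
qed

context cstar_algebra
begin

lemma star_hom_zero:
  assumes E: "function_algebra X E" and k: "star_hom (fn_alg X E) A k"
  shows "k (\<lambda>x. 0) = \<zero>"
  using star_hom_fn_algD(3)[OF k function_algebra_zero[OF E], of 0] star_hom_fn_algD(1)[OF k function_algebra_zero[OF E]]
  by simp

lemma star_hom_minus:
  assumes E: "function_algebra X E" and k: "star_hom (fn_alg X E) A k" and f: "f \<in> E" "g \<in> E"
  shows "k (\<lambda>x. f x - g x) = k f \<ominus> k g"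
  using star_hom_fn_algD(2)[OF k f(1) function_algebraD(4)[OF E f(2), of "-1"]]
    star_hom_fn_algD(3)[OF k f(2), of "-1"] star_hom_fn_algD(1)[OF k] f
  by (simp add: minus_eq_smult)

text \<open>A real function \<open>f\<close> with \<open>\<bar>f\<bar> \<le> 1\<close> is the real part of the unitary function
  \<open>f + \<i> sqrt (1 - f\<^sup>2)\<close>.\<close>

lemma star_hom_contractive:
  fixes X :: "'x set"
  assumes E: "function_algebra X E" and k: "star_hom (fn_alg X E) A k"
    and f: "f \<in> E" and M: "\<And>x. cmod (f x) \<le> M"
  shows "nrm A (k f) \<le> M"
proof -
  note kD = star_hom_fn_algD[OF k] and ED = function_algebraD[OF E]
  have ind: "(\<lambda>x. cnj (indicator X x)) = indicator X" "(\<lambda>x. indicator X x * indicator X x) = (indicator X :: 'x \<Rightarrow> complex)"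
    by (auto simp: indicator_def)
  \<comment> \<open>\<open>k\<close> need not send \<open>indicator X\<close> to a unit of the
    target, but the image is a projection, which suffices for the norm bound.\<close>
  have k1: "nrm A (k (indicator X)) \<le> 1"
    using kD(5)[OF ED(2)] kD(4)[OF ED(2) ED(2)] unfolding ind
    by (intro nrm_projection_le kD(1) ED(2)) simp_all
  have real: "nrm A (k g) \<le> 1" if g: "g \<in> E" "\<And>x. g x \<in> \<real>" "\<And>x. cmod (g x) \<le> 1" for g
  proof -
    define w where "w = (\<lambda>x. indicator X x * complex_of_real (sqrt (1 - (Re (g x))\<^sup>2)))"
    have w: "w \<in> E" unfolding w_def by (rule function_algebra_sqrt[OF E g])
    define u where "u = (\<lambda>x. g x + \<i> * w x)"
    have u: "u \<in> E" unfolding u_def by (intro ED(3,4) g w)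
    have u': "(\<lambda>x. cnj (u x)) \<in> E" by (intro ED(6) u)
    have "(\<lambda>x. cnj (u x) * u x) = indicator X"
    proof
      fix x
      define s where "s = Re (g x)"
      have gx: "g x = of_real s" using g(2)[of x] by (simp add: s_def)
      have s: "s^2 \<le> 1" using g(3)[of x] abs_square_le_1[of s] by (simp add: gx)
      show "cnj (u x) * u x = indicator X x"
      proof (cases "x \<in> X")
        case True
        then have "cnj (u x) * u x = of_real (s^2 + (sqrt (1 - s^2))^2)"
          by (simp add: u_def w_def gx algebra_simps power2_eq_square complex_eq_iff)
        then show ?thesis using True s by (simp add: real_sqrt_pow2)
      qed (use ED(8)[OF g(1)] in \<open>simp add: u_def w_def\<close>)
    qed
    then have "star A (k u) \<otimes> k u = k (indicator X)"
      using kD(4)[OF u' u] kD(5)[OF u] by simp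
    then have "(nrm A (k u))\<^sup>2 \<le> 1" using cstar_identity[of "k u"] kD(1)[OF u] k1 by simp
    then have ku: "nrm A (k u) \<le> 1" using abs_square_le_1[of "nrm A (k u)"] by simp
    have "cnj (g x) = g x" "cnj (w x) = w x" for x using g(2)[of x] by (auto simp: Reals_cnj_iff w_def indicator_def)
    then have "(\<lambda>x. u x + cnj (u x)) = (\<lambda>x. 2 * g x)" by (simp add: u_def)
    then have "2 \<odot> k g = k u \<oplus> star A (k u)"
      using kD(2)[OF u u'] kD(5)[OF u] kD(3)[OF g(1), of 2] by simp
    moreover have "nrm A (2 \<odot> k g) = 2 * nrm A (k g)" using kD(1)[OF g(1)] by (simp add: nrm_smult)
    ultimately show ?thesis
      using nrm_triangle[of "k u" "star A (k u)"] nrm_star[of "k u"] kD(1)[OF u] ku by simp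
  qed
  \<comment> \<open>The C*-identity reduces a complex \<open>g\<close> to the real function
    \<open>cnj g * g\<close>.\<close>
  have unit: "nrm A (k g) \<le> 1" if g: "g \<in> E" "\<And>x. cmod (g x) \<le> 1" for g
  proof -
    have "(\<lambda>x. cnj (g x) * g x) \<in> E" by (intro ED g)
    have eq: "cnj (g x) * g x = of_real ((cmod (g x))\<^sup>2)" for x
      by (metis complex_norm_square mult.commute)
    have "nrm A (k (\<lambda>x. cnj (g x) * g x)) \<le> 1"
    proof (rule real)
      show "cmod (cnj (g x) * g x) \<le> 1" for x
        using g(2)[of x] by (simp add: norm_mult mult_le_one)
      show "cnj (g x) * g x \<in> \<real>" for x by (simp only: eq Reals_of_real)
    qed fact
    also have "k (\<lambda>x. cnj (g x) * g x) = star A (k g) \<otimes> k g"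
      using kD(4)[OF ED(6)[OF g(1)] g(1)] kD(5)[OF g(1)] by simp
    finally have "(nrm A (k g))\<^sup>2 \<le> 1" using cstar_identity[of "k g"] kD(1)[OF g(1)] by simp
    then show ?thesis using abs_square_le_1[of "nrm A (k g)"] by simp
  qed
  \<comment> \<open>Functions live on the whole type, so evaluating the bound at any point, here
    \<open>undefined\<close>, shows that it is nonnegative. The value \<open>M = 0\<close> is split
    off because the general case divides by \<open>M\<close>.\<close>
  have M0: "0 \<le> M" using order_trans[OF norm_ge_zero M[of undefined]] .
  show ?thesis
  proof (cases "M = 0")
    case True
    then have "f = (\<lambda>x. 0)" using M by (simp add: fun_eq_iff)
    then show ?thesis using True star_hom_zero[OF E k] by simp
  next
    case False
    then have "M > 0" using M0 by simp
    have "nrm A (k (\<lambda>x. of_real (1/M) * f x)) \<le> 1"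
      using M \<open>M > 0\<close> by (intro unit ED(4) f) (simp add: norm_divide)
    then have "cmod (of_real (1/M)) * nrm A (k f) \<le> 1"
      unfolding kD(3)[OF f] nrm_smult[OF kD(1)[OF f]] .
    then show ?thesis using \<open>M > 0\<close> by (simp add: norm_divide)
  qed
qed

end

section \<open>The function algebras of a subshift\<close>

lemma follower_Nil [simp]: "follower_set X [] = X" "cylinder X [] = X"
  by (simp_all add: follower_set_def cylinder_def)

lemma lambda_op_distribs:
  "lambda_op X a (\<lambda>x. f x + g x) = (\<lambda>x. lambda_op X a f x + lambda_op X a g x)"
  "lambda_op X a (\<lambda>x. f x * g x) = (\<lambda>x. lambda_op X a f x * lambda_op X a g x)"
  "lambda_op X a (\<lambda>x. c * f x) = (\<lambda>x. c * lambda_op X a f x)"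
  "lambda_op X a (\<lambda>x. cnj (f x)) = (\<lambda>x. cnj (lambda_op X a f x))"
  "lambda_op X a (\<lambda>x. 0) = (\<lambda>x. 0)"
  by (auto simp: lambda_op_def)

lemma lambda_op_diff_le:
  "\<lbrakk>\<And>x. cmod (f x - g x) \<le> e; 0 \<le> e\<rbrakk> \<Longrightarrow> cmod (lambda_op X a f x - lambda_op X a g x) \<le> e"
  by (auto simp: lambda_op_def)

text \<open>\<open>lambda_op\<close> is a sup-norm contraction. The set comprehension in the premise
  matches the limit case of the induction rules.\<close>

lemma unif_limit_lambda_op:
  assumes "unif_limit {g \<in> E. P g} f" "\<And>g. P g \<Longrightarrow> lambda_op X a g \<in> F"
  shows "unif_limit F (lambda_op X a f)"
  unfolding unif_limit_def
proof (intro allI impI)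
  fix e :: real assume "e > 0"
  with assms(1) obtain g where "P g" "\<And>x. cmod (f x - g x) \<le> e" unfolding unif_limit_def by blast
  with assms(2)[of g] \<open>e > 0\<close> show "\<exists>g\<in>F. \<forall>x. cmod (lambda_op X a f x - g x) \<le> e"
    by (auto intro!: bexI[of _ "lambda_op X a g"] lambda_op_diff_le)
qed

locale finite_subshift =
  fixes \<AA> :: "'a set" and X :: "(nat \<Rightarrow> 'a) set"
  assumes finite_alphabet: "finite \<AA>" and subshift: "subshift \<AA> X"
begin

abbreviation "D \<equiv> carrier (D_alg \<AA> X)"
abbreviation "AX \<equiv> carrier (A_alg \<AA> X)"
abbreviation "fol a \<equiv> follower_set X [a]"
abbreviation "H \<equiv> H_mod \<AA> X"

lemma shift_closed: "x \<in> X \<Longrightarrow> shift x \<in> X"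
  using subshift by (auto simp: subshift_def)

lemma shift_case_nat [simp]: "shift (case_nat a x) = x"
  by (simp add: shift_def)

lemma shift_funpow: "(shift ^^ n) x = (\<lambda>i. x (n + i))"
  by (induction n arbitrary: x) (simp_all add: shift_def)

lemma case_nat_in: "case_nat a x \<in> X \<Longrightarrow> x \<in> X"
  using shift_closed[of "case_nat a x"] by simp

lemma follower_subset: "follower_set X \<mu> \<subseteq> X"
proof -
  have "x \<in> X \<Longrightarrow> (shift ^^ n) x \<in> X" for n x
    by (induction n) (auto intro: shift_closed)
  then show ?thesis by (auto simp: follower_set_def cylinder_def)
qed

text \<open>The same point \<open>y\<close>, starting with \<open>\<mu>\<close> followed by
  \<open>a\<close>, witnesses both sides: dropping \<open>length \<mu>\<close> letters leaves
  \<open>case_nat a x\<close>, dropping one more leaves \<open>x\<close>.\<close>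

lemma follower_snoc: "follower_set X (\<mu> @ [a]) = {x. case_nat a x \<in> follower_set X \<mu>}"
proof safe
  fix x assume "x \<in> follower_set X (\<mu> @ [a])"
  then obtain y where y: "y \<in> X" "map y [0..<length \<mu>] = \<mu>" "y (length \<mu>) = a"
    and x: "x = (shift ^^ Suc (length \<mu>)) y"
    by (auto simp: follower_set_def cylinder_def)
  have "case_nat a x = (shift ^^ length \<mu>) y"
    using y(3) by (auto simp: x shift_funpow fun_eq_iff simp del: funpow.simps split: nat.split)
  with y show "case_nat a x \<in> follower_set X \<mu>" by (auto simp: follower_set_def cylinder_def)
next
  fix x assume "case_nat a x \<in> follower_set X \<mu>"
  then obtain y where y: "y \<in> X" "map y [0..<length \<mu>] = \<mu>" "case_nat a x = (shift ^^ length \<mu>) y"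
    by (auto simp: follower_set_def cylinder_def)
  then have "y (length \<mu>) = a" by (metis add.right_neutral old.nat.simps(4) shift_funpow)
  moreover have "x = (shift ^^ Suc (length \<mu>)) y" using y(3) by (metis comp_apply funpow.simps(2) shift_case_nat)
  ultimately show "x \<in> follower_set X (\<mu> @ [a])" using y
    by (auto simp: follower_set_def cylinder_def simp del: funpow.simps intro!: image_eqI[of _ _ y])
qed

lemma follower_single: "fol a = {x. case_nat a x \<in> X}"
  using follower_snoc[of "[]" a] by simp

lemma cylinder2_Nil: "cylinder2 X \<mu> [] = follower_set X \<mu>"
  using follower_subset[of \<mu>] by (auto simp: cylinder2_def)

lemma cylinder2_Cons: "cylinder2 X \<mu> (b # \<nu>) = {x \<in> X. x 0 = b \<and> shift x \<in> cylinder2 X \<mu> \<nu>}"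
proof -
  have "map x [0..<length (b # \<nu>)] = b # \<nu> \<longleftrightarrow> x 0 = b \<and> map (shift x) [0..<length \<nu>] = \<nu>" for x
    by (simp add: map_upt_Suc shift_def[abs_def] del: upt_Suc)
  then show ?thesis
    by (auto simp: cylinder2_def cylinder_def shift_closed funpow_swap1 simp del: upt_Suc)
qed

lemma cylinder2_subset: "cylinder2 X \<mu> \<nu> \<subseteq> X"
  by (auto simp: cylinder2_def cylinder_def)

lemma lambda_op_follower:
  "lambda_op X a (indicator (follower_set X \<mu>)) = indicator (follower_set X (\<mu> @ [a]))"
  using follower_subset[of \<mu>] case_nat_in[of a] by (auto simp: lambda_op_def follower_snoc indicator_def fun_eq_iff)

lemma lambda_op_unit: "lambda_op X a (indicator X) = indicator (fol a)"
  using lambda_op_follower[of a "[]"] by simp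

text \<open>Pulling back along \<open>a\<close> strips the first letter of the second word, and
  \<open>indicator (fol a)\<close> records that prepending \<open>a\<close> stays in
  \<open>X\<close>. All inductions on \<open>\<nu>\<close> rest on this.\<close>

lemma lambda_op_cylinder2:
  "lambda_op X a (indicator (cylinder2 X \<mu> (b # \<nu>))) =
    (if a = b then (\<lambda>x. indicator (cylinder2 X \<mu> \<nu>) x * indicator (fol a) x) else (\<lambda>x. 0))"
  using case_nat_in[of a]
  by (auto simp: lambda_op_def cylinder2_Cons follower_single indicator_def fun_eq_iff)

lemma lambda_op_follower_mult [simp]:
  "lambda_op X a f x * indicator (fol a) x = lambda_op X a f x"
  "indicator (fol a) x * lambda_op X a f x = lambda_op X a f x"
  by (auto simp: lambda_op_def follower_single)

lemma indicator_in_bounded: "Y \<subseteq> X \<Longrightarrow> indicator Y \<in> carrier (bounded_functions X)"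
  by (auto simp: carrier_bounded_functions bounded_iff indicator_def intro!: exI[of _ 1])

section \<open>Generators and induction rules for \<open>D\<close> and \<open>AX\<close>\<close>

definition "cyl_gens = {indicator (cylinder2 X \<mu> \<nu>) :: _ \<Rightarrow> complex | \<mu> \<nu>. \<mu> \<in> lists \<AA> \<and> \<nu> \<in> lists \<AA>}"
definition "fol_gens = {indicator (follower_set X \<mu>) :: _ \<Rightarrow> complex | \<mu>. \<mu> \<in> lists \<AA>}"

text \<open>The abbreviation \<open>D\<close> on the right contains \<open>D_alg\<close> again, so
  the equation is applied by single \<open>subst\<close> steps or from right to left.\<close>

lemma D_alg_eq: "D_alg \<AA> X = fn_alg X D"
  by (simp add: D_alg_def)

lemma A_alg_eq: "A_alg \<AA> X = fn_alg X AX"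
  by (simp add: A_alg_def D_alg_def)

lemma D_eq: "D = cstar_generated (fn_alg X (carrier (bounded_functions X))) cyl_gens"
  by (simp add: D_alg_def cyl_gens_def)

lemma AX_eq: "AX = cstar_generated (fn_alg X D) fol_gens"
  by (simp add: A_alg_def fol_gens_def D_alg_eq[symmetric])

lemma cyl_gens_subset: "cyl_gens \<subseteq> carrier (bounded_functions X)"
  using cylinder2_subset by (auto simp: cyl_gens_def intro!: indicator_in_bounded)

lemma fol_gens_subset': "fol_gens \<subseteq> cyl_gens"
  unfolding fol_gens_def cyl_gens_def cylinder2_Nil[symmetric] by blast

lemma unit_in_gens: "indicator X \<in> cyl_gens" "indicator X \<in> fol_gens"
proof -
  show "indicator X \<in> fol_gens"
    unfolding fol_gens_def by (rule CollectI, rule exI[of _ "[]"]) simp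
  then show "indicator X \<in> cyl_gens" using fol_gens_subset' by blast
qed

lemmas D_fa = function_algebra_generated[OF function_algebra_bounded_functions cyl_gens_subset unit_in_gens(1), folded D_eq]

lemma fol_gens_subset: "fol_gens \<subseteq> D"
  using fol_gens_subset' D_fa(3) by blast

lemmas AX_fa = function_algebra_generated[OF D_fa(1) fol_gens_subset unit_in_gens(2), folded AX_eq]

lemma gens_real: "\<forall>f\<in>cyl_gens. \<forall>x. cnj (f x) = f x" "\<forall>f\<in>fol_gens. \<forall>x. cnj (f x) = f x"
  by (auto simp: cyl_gens_def fol_gens_def indicator_def)

lemmas D_induct = cstar_generated_fn_alg_induct[OF function_algebra_bounded_functions cyl_gens_subset
    unit_in_gens(1) gens_real(1), folded D_eq, consumes 1, case_names gen add smult mult limit]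

lemmas AX_induct = cstar_generated_fn_alg_induct[OF D_fa(1) fol_gens_subset
    unit_in_gens(2) gens_real(2), folded AX_eq, consumes 1, case_names gen add smult mult limit]

lemma follower_in_AX: "\<mu> \<in> lists \<AA> \<Longrightarrow> indicator (follower_set X \<mu>) \<in> AX"
  using AX_fa(3) by (auto simp: fol_gens_def)

lemma fol_in: "a \<in> \<AA> \<Longrightarrow> indicator (fol a) \<in> AX" "a \<in> \<AA> \<Longrightarrow> indicator (fol a) \<in> D"
  using follower_in_AX[of "[a]"] AX_fa(2) by auto

lemma cylinder2_in_D: "\<mu> \<in> lists \<AA> \<Longrightarrow> \<nu> \<in> lists \<AA> \<Longrightarrow> indicator (cylinder2 X \<mu> \<nu>) \<in> D"
  using D_fa(3) by (auto simp: cyl_gens_def)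

lemma lambda_op_D:
  assumes a: "a \<in> \<AA>" and f: "f \<in> D" shows "lambda_op X a f \<in> D"
  using f
proof (induction rule: D_induct)
  case (gen f)
  then obtain \<mu> \<nu> where f: "f = indicator (cylinder2 X \<mu> \<nu>)" and l: "\<mu> \<in> lists \<AA>" "\<nu> \<in> lists \<AA>"
    by (auto simp: cyl_gens_def)
  show ?case
  proof (cases \<nu>)
    case Nil
    then show ?thesis
      using l a AX_fa(2) follower_in_AX[of "\<mu> @ [a]"] by (auto simp: f cylinder2_Nil lambda_op_follower)
  next
    case (Cons b \<nu>')
    then show ?thesis
      using l a function_algebraD(5)[OF D_fa(1) cylinder2_in_D fol_in(2)] function_algebra_zero[OF D_fa(1)]
      by (simp add: f lambda_op_cylinder2)
  qed
next
  case (limit f)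
  show ?case
    by (rule function_algebraD(7)[OF D_fa(1)]) (rule unif_limit_lambda_op[OF limit(2)])
next
  case (smult c f)
  then show ?case by (simp only: lambda_op_distribs(3) function_algebraD(4)[OF D_fa(1)])
qed (simp_all add: lambda_op_distribs function_algebraD[OF D_fa(1)])

lemma lambda_op_AX:
  assumes a: "a \<in> \<AA>" and f: "f \<in> AX" shows "lambda_op X a f \<in> AX"
  using f
proof (induction rule: AX_induct)
  case (gen f)
  then show ?case using a by (auto simp: fol_gens_def lambda_op_follower intro!: follower_in_AX)
next
  case (limit f)
  show ?case
    by (rule function_algebraD(7)[OF AX_fa(1)]) (rule unif_limit_lambda_op[OF limit(2)])
next
  case (smult c f)
  then show ?case by (simp only: lambda_op_distribs(3) function_algebraD(4)[OF AX_fa(1)])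
qed (simp_all add: lambda_op_distribs function_algebraD[OF AX_fa(1)])

text \<open>An ideal generated by a projection in a commutative algebra is its corner: a function
  supported in \<open>fol a\<close> equals its product with \<open>indicator (fol a)\<close>, and
  the support condition is closed. Ideal membership thereby becomes a pointwise condition.\<close>

lemma D_ideal_eq:
  assumes a: "a \<in> \<AA>"
  shows "D_ideal \<AA> X a = {f \<in> D. \<forall>x. x \<notin> fol a \<longrightarrow> f x = 0}" (is "_ = ?J")
proof
  note DD = function_algebraD[OF D_fa(1)]
  have "\<forall>f\<in>D. unif_limit ?J f \<longrightarrow> f \<in> ?J"
    using unif_limit_eq[of ?J] by auto
  then have "closed_ideal (fn_alg X D) ?J"
    using DD(3-5) function_algebra_zero[OF D_fa(1)]
    by (auto simp: closed_ideal_def closed_subspace_def closedin_fn_alg_iff[OF D_fa(1)] simp del: Pi_I)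
  moreover have "indicator (fol a) \<in> ?J" using fol_in(2)[OF a] by simp
  ultimately show "D_ideal \<AA> X a \<subseteq> ?J"
    unfolding D_ideal_def generated_ideal_def by (subst D_alg_eq) blast
  show "?J \<subseteq> D_ideal \<AA> X a"
    unfolding D_ideal_def generated_ideal_def
  proof safe
    fix f J assume f: "f \<in> D" "\<forall>x. x \<notin> fol a \<longrightarrow> f x = 0"
      and J: "closed_ideal (D_alg \<AA> X) J" "{indicator (fol a)} \<subseteq> J"
    have "(\<lambda>x. f x * indicator (fol a) x) \<in> J"
      using f(1) J by (subst (asm) D_alg_eq) (auto simp: closed_ideal_def)
    moreover have "(\<lambda>x. f x * indicator (fol a) x) = f"
      using f(2) by (intro ext) (auto simp: indicator_def)
    ultimately show "f \<in> J" by simp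
  qed
qed

section \<open>The module as families of functions supported on follower sets\<close>

lemma H_carrier:
  "\<xi> \<in> carrier H \<longleftrightarrow> (\<forall>a\<in>\<AA>. \<xi> a \<in> D \<and> (\<forall>x. x \<notin> fol a \<longrightarrow> \<xi> a x = 0)) \<and> (\<forall>a. a \<notin> \<AA> \<longrightarrow> \<xi> a = (\<lambda>x. 0))"
  by (simp add: H_mod_def D_ideal_eq)

lemma H_simps [simp]:
  "\<zero>\<^bsub>H\<^esub> = (\<lambda>a x. 0)" "\<xi> \<oplus>\<^bsub>H\<^esub> \<eta> = (\<lambda>a x. \<xi> a x + \<eta> a x)" "c \<odot>\<^bsub>H\<^esub> \<xi> = (\<lambda>a x. c * \<xi> a x)"
  "ract H \<xi> f = (\<lambda>a x. \<xi> a x * f x)" "iprod H \<xi> \<eta> = (\<lambda>x. \<Sum>a\<in>\<AA>. cnj (\<xi> a x) * \<eta> a x)"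
  by (simp_all add: H_mod_def)

lemma H_in:
  "\<xi> \<in> carrier H \<Longrightarrow> a \<in> \<AA> \<Longrightarrow> \<xi> a \<in> D" "\<xi> \<in> carrier H \<Longrightarrow> x \<notin> fol a \<Longrightarrow> \<xi> a x = 0"
  "\<xi> \<in> carrier H \<Longrightarrow> a \<notin> \<AA> \<Longrightarrow> \<xi> a = (\<lambda>x. 0)"
  by (auto simp: H_carrier)

lemma H_closed:
  assumes "\<xi> \<in> carrier H"
  shows "\<eta> \<in> carrier H \<Longrightarrow> (\<lambda>a x. \<xi> a x + \<eta> a x) \<in> carrier H"
    "(\<lambda>a x. c * \<xi> a x) \<in> carrier H" "f \<in> D \<Longrightarrow> (\<lambda>a x. \<xi> a x * f x) \<in> carrier H"
    "\<eta> \<in> carrier H \<Longrightarrow> (\<lambda>x. \<Sum>a\<in>\<AA>. cnj (\<xi> a x) * \<eta> a x) \<in> D"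
    "f \<in> D \<Longrightarrow> (\<lambda>a x. lambda_op X a f x * \<xi> a x) \<in> carrier H"
  using assms function_algebraD(3-6)[OF D_fa(1)] finite_alphabet lambda_op_D
  by (auto simp: H_carrier intro!: function_algebra_sum[OF D_fa(1)])

lemma H_zero: "(\<lambda>a x. 0) \<in> carrier H"
  using function_algebra_zero[OF D_fa(1)] by (simp add: H_carrier)

lemma H_follower_mult: "\<xi> \<in> carrier H \<Longrightarrow> indicator (fol a) x * \<xi> a x = \<xi> a x"
  using H_in(2)[of \<xi> x a] by (auto simp: indicator_def)

lemma xi_in_H: "a \<in> \<AA> \<Longrightarrow> xi X a \<in> carrier H"
  using function_algebra_zero[OF D_fa(1)] fol_in(2) by (auto simp: H_carrier xi_def)

text \<open>The \<open>xi X a\<close> act like an orthonormal basis, except that their inner squares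
  are the projections \<open>indicator (fol a)\<close>. Coordinates of module elements absorb these
  projections.\<close>

lemma iprod_xi: "a \<in> \<AA> \<Longrightarrow> \<eta> \<in> carrier H \<Longrightarrow> iprod H (xi X a) \<eta> = \<eta> a"
proof
  fix x assume a: "a \<in> \<AA>" "\<eta> \<in> carrier H"
  have "(\<Sum>b\<in>\<AA>. cnj (xi X a b x) * \<eta> b x) = (\<Sum>b\<in>\<AA>. if b = a then \<eta> a x else 0)"
    using H_follower_mult[OF a(2), of a x] by (intro sum.cong) (auto simp: xi_def)
  then show "iprod H (xi X a) \<eta> x = \<eta> a x" using a finite_alphabet by simp
qed

lemma xi_sum:
  assumes "\<xi> \<in> carrier H" shows "\<xi> b x = (\<Sum>a\<in>\<AA>. xi X a b x * \<xi> a x)"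
proof (cases "b \<in> \<AA>")
  case True
  have "(\<Sum>a\<in>\<AA>. xi X a b x * \<xi> a x) = (\<Sum>a\<in>\<AA>. if a = b then \<xi> b x else 0)"
    using H_follower_mult[OF assms, of b x] by (intro sum.cong) (auto simp: xi_def)
  then show ?thesis using True finite_alphabet by simp
next
  case False
  then have "(\<Sum>a\<in>\<AA>. xi X a b x * \<xi> a x) = 0" by (intro sum.neutral) (auto simp: xi_def)
  then show ?thesis using H_in(3)[OF assms False] by simp
qed

lemma left_action_apply:
  "\<xi> \<in> carrier H \<Longrightarrow> left_action \<AA> X f \<xi> = (\<lambda>a x. lambda_op X a f x * \<xi> a x)"
  by (simp add: left_action_def)

section \<open>Adjointable operators on the subshift module\<close>

abbreviation "L \<equiv> adjointable_ops (D_alg \<AA> X) H"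
abbreviation "K \<equiv> compact_ops (D_alg \<AA> X) H"
abbreviation "hn \<equiv> hnorm (D_alg \<AA> X) H"

lemma adjointable_simps:
  "add L = (\<lambda>S T. \<lambda>\<xi>\<in>carrier H. \<lambda>a x. S \<xi> a x + T \<xi> a x)" "zero L = (\<lambda>\<xi>\<in>carrier H. \<lambda>a x. 0)"
  "smult L = (\<lambda>c T. \<lambda>\<xi>\<in>carrier H. \<lambda>a x. c * T \<xi> a x)" "mult L = (\<lambda>S T. compose (carrier H) S T)"
  "star L = (\<lambda>T. THE T'. adjoint_pair H T T')"
  by (simp_all add: adjointable_ops_def)

lemma adjointable_carrier: "U \<in> carrier L \<longleftrightarrow> (\<exists>U'. adjoint_pair H U U')"
  by (simp add: adjointable_ops_def)

lemma iprod_cnj: "cnj (iprod H \<xi> \<eta> x) = iprod H \<eta> \<xi> x"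
  by (simp add: mult.commute)

lemma adjoint_pair_sym: "adjoint_pair H U U' \<Longrightarrow> adjoint_pair H U' U"
  unfolding adjoint_pair_def by (metis (no_types, lifting) ext iprod_cnj)

lemma adjoint_pairD:
  assumes "adjoint_pair H U U'"
  shows "\<xi> \<in> carrier H \<Longrightarrow> U \<xi> \<in> carrier H" "\<xi> \<in> carrier H \<Longrightarrow> U' \<xi> \<in> carrier H"
    "\<xi> \<notin> carrier H \<Longrightarrow> U \<xi> = undefined"
    "\<xi> \<in> carrier H \<Longrightarrow> \<eta> \<in> carrier H \<Longrightarrow> iprod H (U \<xi>) \<eta> = iprod H \<xi> (U' \<eta>)"
  using assms unfolding adjoint_pair_def by (auto simp: PiE_def extensional_def)

text \<open>\<open>adjoint_pair\<close> does not assume additivity or module linearity. Both come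
  from moving \<open>U\<close> to the other side of the pairing with \<open>xi X b\<close>, which
  describes \<open>U\<close> by the matrix of its adjoint.\<close>

lemma adjoint_formula:
  assumes U: "adjoint_pair H U U'" and xi: "\<xi> \<in> carrier H" and b: "b \<in> \<AA>"
  shows "U \<xi> b x = (\<Sum>a\<in>\<AA>. cnj (U' (xi X b) a x) * \<xi> a x)"
proof -
  have "U \<xi> b = iprod H (xi X b) (U \<xi>)"
    by (rule iprod_xi[OF b adjoint_pairD(1)[OF U xi], symmetric])
  also have "\<dots> = iprod H (U' (xi X b)) \<xi>"
    by (rule adjoint_pairD(4)[OF adjoint_pair_sym[OF U] xi_in_H[OF b] xi, symmetric])
  finally show ?thesis by simp
qed

lemma adjoint_entry:
  assumes U: "adjoint_pair H U U'" and a: "a \<in> \<AA>" and b: "b \<in> \<AA>"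
  shows "U (xi X a) b x = cnj (U' (xi X b) a x)"
proof -
  have "U (xi X a) b = iprod H (xi X b) (U (xi X a))"
    by (rule iprod_xi[OF b adjoint_pairD(1)[OF U xi_in_H[OF a]], symmetric])
  also have "\<dots> = iprod H (U' (xi X b)) (xi X a)"
    by (rule adjoint_pairD(4)[OF adjoint_pair_sym[OF U] xi_in_H[OF b] xi_in_H[OF a], symmetric])
  finally have "U (xi X a) b x = iprod H (U' (xi X b)) (xi X a) x" by (rule fun_cong)
  also have "\<dots> = cnj (iprod H (xi X a) (U' (xi X b)) x)" by (rule iprod_cnj[symmetric])
  also have "iprod H (xi X a) (U' (xi X b)) = U' (xi X b) a"
    by (rule iprod_xi[OF a adjoint_pairD(2)[OF U xi_in_H[OF b]]])
  finally show ?thesis .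
qed

text \<open>Matrix form of \<open>U\<close> in terms of its own values at the \<open>xi X a\<close>,
  obtained by exchanging the adjoint's entries for those of \<open>U\<close>.\<close>

lemma adjoint_expand:
  assumes U: "adjoint_pair H U U'" and xi: "\<xi> \<in> carrier H"
  shows "U \<xi> b x = (\<Sum>a\<in>\<AA>. U (xi X a) b x * \<xi> a x)"
proof (cases "b \<in> \<AA>")
  case True
  show ?thesis unfolding adjoint_formula[OF U xi True]
    by (intro sum.cong refl) (simp only: adjoint_entry[OF U _ True])
next
  case False
  have "U (xi X a) b x = 0" if "a \<in> \<AA>" for a
    using H_in(3)[OF adjoint_pairD(1)[OF U xi_in_H[OF that]] False] by simp
  moreover have "U \<xi> b x = 0" using H_in(3)[OF adjoint_pairD(1)[OF U xi] False] by simp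
  ultimately show ?thesis by (simp add: sum.neutral)
qed

lemma adjoint_unique: "adjoint_pair H U U' \<Longrightarrow> adjoint_pair H U U'' \<Longrightarrow> U' = U''"
proof
  fix \<xi> assume U: "adjoint_pair H U U'" "adjoint_pair H U U''"
  note s = adjoint_pair_sym[OF U(1)] adjoint_pair_sym[OF U(2)]
  show "U' \<xi> = U'' \<xi>"
  proof (cases "\<xi> \<in> carrier H")
    case True
    show ?thesis
    proof (intro ext)
      fix b x show "U' \<xi> b x = U'' \<xi> b x"
      proof (cases "b \<in> \<AA>")
        case True': True
        show ?thesis unfolding adjoint_formula[OF s(1) True True'] adjoint_formula[OF s(2) True True'] by (rule refl)
      next
        case False
        then show ?thesis
          using H_in(3)[OF adjoint_pairD(1)[OF s(1) True] False] H_in(3)[OF adjoint_pairD(1)[OF s(2) True] False] by simp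
      qed
    qed
  next
    case False
    then show ?thesis using adjoint_pairD(3)[OF s(1)] adjoint_pairD(3)[OF s(2)] by simp
  qed
qed

lemma star_adjointable: "adjoint_pair H U U' \<Longrightarrow> star L U = U'"
  unfolding adjointable_simps using adjoint_unique by blast

lemma adjoint_add:
  assumes "adjoint_pair H U U'" "adjoint_pair H V V'"
  shows "adjoint_pair H (U \<oplus>\<^bsub>L\<^esub> V) (U' \<oplus>\<^bsub>L\<^esub> V')"
proof -
  note d = adjoint_pairD[OF assms(1)] adjoint_pairD[OF assms(2)]
  have "iprod H (\<lambda>a x. U \<xi> a x + V \<xi> a x) \<eta> = iprod H \<xi> (\<lambda>a x. U' \<eta> a x + V' \<eta> a x)"
    if "\<xi> \<in> carrier H" "\<eta> \<in> carrier H" for \<xi> \<eta>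
  proof
    fix x show "iprod H (\<lambda>a x. U \<xi> a x + V \<xi> a x) \<eta> x = iprod H \<xi> (\<lambda>a x. U' \<eta> a x + V' \<eta> a x) x"
      using fun_cong[OF d(4)[OF that], of x] fun_cong[OF d(8)[OF that], of x]
      by (simp add: algebra_simps sum.distrib)
  qed
  then show ?thesis
    unfolding adjoint_pair_def adjointable_simps using d H_closed(1) by (auto simp del: H_simps)
qed

lemma adjoint_smult:
  assumes "adjoint_pair H U U'"
  shows "adjoint_pair H (c \<odot>\<^bsub>L\<^esub> U) (cnj c \<odot>\<^bsub>L\<^esub> U')"
proof -
  note d = adjoint_pairD[OF assms(1)]
  have "iprod H (\<lambda>a x. c * U \<xi> a x) \<eta> = iprod H \<xi> (\<lambda>a x. cnj c * U' \<eta> a x)"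
    if "\<xi> \<in> carrier H" "\<eta> \<in> carrier H" for \<xi> \<eta>
  proof
    fix x
    have "cnj c * iprod H (U \<xi>) \<eta> x = cnj c * iprod H \<xi> (U' \<eta>) x" using d(4)[OF that] by simp
    then show "iprod H (\<lambda>a x. c * U \<xi> a x) \<eta> x = iprod H \<xi> (\<lambda>a x. cnj c * U' \<eta> a x) x"
      by (simp add: sum_distrib_left mult_ac)
  qed
  then show ?thesis
    unfolding adjoint_pair_def adjointable_simps using d H_closed(2) by (auto simp del: H_simps)
qed

lemma adjoint_zero: "adjoint_pair H \<zero>\<^bsub>L\<^esub> \<zero>\<^bsub>L\<^esub>"
  unfolding adjoint_pair_def adjointable_simps using H_zero by auto

lemma adjoint_theta:
  assumes "\<xi> \<in> carrier H" "\<eta> \<in> carrier H"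
  shows "adjoint_pair H (theta H \<xi> \<eta>) (theta H \<eta> \<xi>)"
proof -
  have c: "(\<lambda>a x. \<xi> a x * (\<Sum>a\<in>\<AA>. cnj (\<eta> a x) * \<zeta> a x)) \<in> carrier H"
    if "\<xi> \<in> carrier H" "\<eta> \<in> carrier H" "\<zeta> \<in> carrier H" for \<xi> \<eta> \<zeta>
    by (rule H_closed(3)[OF that(1) H_closed(4)[OF that(2,3)]])
  have "iprod H (\<lambda>a x. \<xi> a x * (\<Sum>a\<in>\<AA>. cnj (\<eta> a x) * \<zeta> a x)) \<zeta>' x
    = iprod H \<zeta> (\<lambda>a x. \<eta> a x * (\<Sum>a\<in>\<AA>. cnj (\<xi> a x) * \<zeta>' a x)) x" for \<zeta> \<zeta>' x
    by (simp add: sum_distrib_left sum_distrib_right mult_ac) (rule sum.swap)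
  then have "iprod H (\<lambda>a x. \<xi> a x * (\<Sum>a\<in>\<AA>. cnj (\<eta> a x) * \<zeta> a x)) \<zeta>'
    = iprod H \<zeta> (\<lambda>a x. \<eta> a x * (\<Sum>a\<in>\<AA>. cnj (\<xi> a x) * \<zeta>' a x))" for \<zeta> \<zeta>' by (intro ext)
  then show ?thesis
    unfolding adjoint_pair_def theta_def H_simps(4) H_simps(5)[of \<eta>] H_simps(5)[of \<xi>, abs_def] using c assms
    by (auto simp del: H_simps)
qed

section \<open>Fibre norms and the operator norm\<close>

definition pnorm where "pnorm \<xi> x = L2_set (\<lambda>a. cmod (\<xi> a x)) \<AA>"

text \<open>Since \<open>D\<close> is commutative, the module norm is the supremum over the points
  \<open>x\<close> of Euclidean norms of the fibres. Norm estimates reduce to those for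
  \<open>L2_set\<close>.\<close>

lemma hnorm_le_iff:
  assumes xi: "\<xi> \<in> carrier H" and r: "0 \<le> r"
  shows "hn \<xi> \<le> r \<longleftrightarrow> (\<forall>x. pnorm \<xi> x \<le> r)"
proof -
  have sq: "cmod (iprod H \<xi> \<xi> x) = (pnorm \<xi> x)\<^sup>2" for x
  proof -
    have "iprod H \<xi> \<xi> x = of_real (\<Sum>a\<in>\<AA>. (cmod (\<xi> a x))\<^sup>2)"
      by (simp add: mult.commute[of "cnj _"] flip: complex_norm_square)
    then have "cmod (iprod H \<xi> \<xi> x) = \<bar>\<Sum>a\<in>\<AA>. (cmod (\<xi> a x))\<^sup>2\<bar>" by (simp only: norm_of_real)
    then show ?thesis by (simp add: pnorm_def L2_set_def sum_nonneg)
  qed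
  have b: "bounded (range (iprod H \<xi> \<xi>))"
    using function_algebraD(9)[OF D_fa(1)] H_closed(4)[OF xi xi] by simp
  have "hn \<xi> = sqrt (SUP x. cmod (iprod H \<xi> \<xi> x))"
    unfolding hnorm_def by (subst D_alg_eq) simp
  also have "\<dots> \<le> r \<longleftrightarrow> (SUP x. cmod (iprod H \<xi> \<xi> x)) \<le> r\<^sup>2"
    using r by (metis real_sqrt_le_iff real_sqrt_abs abs_of_nonneg)
  also have "\<dots> \<longleftrightarrow> (\<forall>x. (pnorm \<xi> x)\<^sup>2 \<le> r\<^sup>2)" 
    using SUP_cmod_le_iff[OF b, of "r\<^sup>2"] by (simp only: sq)
  also have "\<dots> \<longleftrightarrow> (\<forall>x. pnorm \<xi> x \<le> r)"
    using r by (simp add: abs_le_square_iff[symmetric] pnorm_def)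
  finally show ?thesis .
qed

lemma pnorm_nonneg: "0 \<le> pnorm \<xi> x"
  by (simp add: pnorm_def)

text \<open>The real \<open>sqrt\<close> is odd and does not by itself exclude negative values. A
  negative norm would make all fibres vanish, and then the norm is the root of zero.\<close>

lemma hnorm_nonneg: "\<xi> \<in> carrier H \<Longrightarrow> 0 \<le> hn \<xi>"
proof (rule ccontr)
  assume xi: "\<xi> \<in> carrier H" and n: "\<not> 0 \<le> hn \<xi>"
  then have "\<forall>x. pnorm \<xi> x \<le> 0" using hnorm_le_iff[OF xi, of 0] by simp
  then have "pnorm \<xi> x = 0" for x using pnorm_nonneg[of \<xi> x] by (meson order_antisym)
  then have "\<xi> a x = 0" for a x
    using finite_alphabet H_in(3)[OF xi, of a] by (cases "a \<in> \<AA>") (auto simp: pnorm_def L2_set_eq_0_iff)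
  then have "\<xi> = (\<lambda>a x. 0)" by blast
  then have "hn \<xi> = sqrt (SUP x. cmod 0)"
    unfolding hnorm_def by (subst D_alg_eq) simp
  with n show False by simp
qed

lemma pnorm_le_hnorm: "\<xi> \<in> carrier H \<Longrightarrow> pnorm \<xi> x \<le> hn \<xi>"
  using hnorm_le_iff[of \<xi> "hn \<xi>"] hnorm_nonneg by blast

definition op_norm where
  "op_norm U = Sup {hn (U \<xi>) | \<xi>. \<xi> \<in> carrier H \<and> hn \<xi> \<le> 1}"

lemma op_norm_le:
  assumes U: "U \<in> carrier L"
    and *: "\<And>\<xi>. \<xi> \<in> carrier H \<Longrightarrow> hn \<xi> \<le> 1 \<Longrightarrow> hn (U \<xi>) \<le> r"
  shows "op_norm U \<le> r"
  unfolding op_norm_def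
proof (rule cSup_least)
  have "hn (\<lambda>a x. 0) \<le> 1"
    using hnorm_le_iff[OF H_zero, of 1] by (simp add: pnorm_def L2_set_def)
  then show "{hn (U \<xi>) |\<xi>. \<xi> \<in> carrier H \<and> hn \<xi> \<le> 1} \<noteq> {}"
    using H_zero by blast
qed (use * in blast)

text \<open>The supremum in \<open>op_norm\<close> is usable only for a bounded set, so boundedness
  of adjointable operators is established here: their finitely many matrix entries are bounded
  functions.\<close>

lemma hnorm_le_op_norm:
  assumes U: "U \<in> carrier L" and xi: "\<xi> \<in> carrier H" "hn \<xi> \<le> 1"
  shows "hn (U \<xi>) \<le> op_norm U"
  unfolding op_norm_def
proof (rule cSup_upper)
  show "hn (U \<xi>) \<in> {hn (U \<xi>) |\<xi>. \<xi> \<in> carrier H \<and> hn \<xi> \<le> 1}"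
    using xi by blast
  obtain U' where U': "adjoint_pair H U U'" using U adjointable_carrier by blast
  have "\<exists>K. \<forall>x. cmod (U' (xi X b) a x) \<le> K" if "a \<in> \<AA>" "b \<in> \<AA>" for a b
    using function_algebraD(9)[OF D_fa(1) H_in(1)[OF adjoint_pairD(2)[OF U' xi_in_H[OF that(2)]] that(1)]]
    by (auto simp: bounded_iff)
  then obtain K where K: "\<And>a b x. a \<in> \<AA> \<Longrightarrow> b \<in> \<AA> \<Longrightarrow> cmod (U' (xi X b) a x) \<le> K a b" by metis
  \<comment> \<open>A crude bound, the sum of the bounds of all entries; it works because each
    coordinate of a vector of norm at most \<open>1\<close> is bounded by \<open>1\<close>.\<close>
  define M where "M = (\<Sum>b\<in>\<AA>. \<Sum>a\<in>\<AA>. \<bar>K a b\<bar>)"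
  have M0: "0 \<le> M" by (simp add: M_def sum_nonneg)
  have "hn (U \<zeta>) \<le> M" if z: "\<zeta> \<in> carrier H" "hn \<zeta> \<le> 1" for \<zeta>
    unfolding hnorm_le_iff[OF adjoint_pairD(1)[OF U' z(1)] M0]
  proof
    fix x
    have le1: "cmod (\<zeta> a x) \<le> 1" if "a \<in> \<AA>" for a
      using member_le_L2_set[OF finite_alphabet that, of "\<lambda>a. cmod (\<zeta> a x)"] pnorm_le_hnorm[OF z(1), of x] z(2)
      by (simp add: pnorm_def)
    have "cmod (U \<zeta> b x) \<le> (\<Sum>a\<in>\<AA>. \<bar>K a b\<bar>)" if b: "b \<in> \<AA>" for b
      unfolding adjoint_formula[OF U' z(1) b]
    proof (rule sum_norm_le)
      fix a assume a: "a \<in> \<AA>"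
      have "cmod (U' (xi X b) a x) \<le> \<bar>K a b\<bar>" using K[OF a b, of x] by linarith
      then show "cmod (cnj (U' (xi X b) a x) * \<zeta> a x) \<le> \<bar>K a b\<bar>"
        using mult_mono[OF _ le1[OF a]] by (simp add: norm_mult)
    qed
    then have "(\<Sum>b\<in>\<AA>. cmod (U \<zeta> b x)) \<le> M" unfolding M_def by (intro sum_mono)
    then show "pnorm (U \<zeta>) x \<le> M"
      unfolding pnorm_def using L2_set_le_sum[of \<AA> "\<lambda>b. cmod (U \<zeta> b x)"] by simp
  qed
  then show "bdd_above {hn (U \<xi>) |\<xi>. \<xi> \<in> carrier H \<and> hn \<xi> \<le> 1}"
    by (intro bdd_aboveI[of _ M]) auto
qed

text \<open>As for functions, the additive inverse is pinned down from its description. Candidates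
  agree outside \<open>carrier H\<close> because operators are extensional.\<close>

lemma adjointable_minus:
  assumes "U \<in> carrier L" "V \<in> carrier L"
  shows "U \<ominus>\<^bsub>L\<^esub> V = (\<lambda>\<xi>\<in>carrier H. \<lambda>a x. U \<xi> a x - V \<xi> a x)" "U \<ominus>\<^bsub>L\<^esub> V \<in> carrier L"
proof -
  obtain U' V' where a: "adjoint_pair H U U'" "adjoint_pair H V V'" using assms adjointable_carrier by blast
  let ?N = "(-1) \<odot>\<^bsub>L\<^esub> V"
  have N: "?N \<in> carrier L" using adjoint_smult[OF a(2)] adjointable_carrier by blast
  have "\<ominus>\<^bsub>L\<^esub> V = ?N"
    unfolding a_inv_def m_inv_def
  proof (rule the_equality)
    show "?N \<in> carrier (add_monoid L) \<and> V \<otimes>\<^bsub>add_monoid L\<^esub> ?N = \<one>\<^bsub>add_monoid L\<^esub> \<and>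
      ?N \<otimes>\<^bsub>add_monoid L\<^esub> V = \<one>\<^bsub>add_monoid L\<^esub>"
      using N by (auto simp: adjointable_simps)
    fix Y assume Y: "Y \<in> carrier (add_monoid L) \<and> V \<otimes>\<^bsub>add_monoid L\<^esub> Y = \<one>\<^bsub>add_monoid L\<^esub> \<and>
      Y \<otimes>\<^bsub>add_monoid L\<^esub> V = \<one>\<^bsub>add_monoid L\<^esub>"
    then obtain Y' where Y': "adjoint_pair H Y Y'" using adjointable_carrier by auto
    show "Y = ?N"
    proof
      fix \<xi>
      show "Y \<xi> = ?N \<xi>"
      proof (cases "\<xi> \<in> carrier H")
        case True
        have "(Y \<oplus>\<^bsub>L\<^esub> V) \<xi> = \<zero>\<^bsub>L\<^esub> \<xi>" using Y by simp
        then have "Y \<xi> a x + V \<xi> a x = 0" for a x using True by (simp add: adjointable_simps fun_eq_iff)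
        then show ?thesis using True by (simp add: adjointable_simps fun_eq_iff eq_neg_iff_add_eq_0)
      qed (use adjoint_pairD(3)[OF Y'] in \<open>simp add: adjointable_simps\<close>)
    qed
  qed
  then have eq: "U \<ominus>\<^bsub>L\<^esub> V = U \<oplus>\<^bsub>L\<^esub> ?N" by (simp add: a_minus_def)
  show "U \<ominus>\<^bsub>L\<^esub> V = (\<lambda>\<xi>\<in>carrier H. \<lambda>a x. U \<xi> a x - V \<xi> a x)"
    unfolding eq by (auto simp: adjointable_simps)
  show "U \<ominus>\<^bsub>L\<^esub> V \<in> carrier L"
    unfolding eq adjointable_carrier using adjoint_add[OF a(1) adjoint_smult[OF a(2)]] by blast
qed

text \<open>Closed subspaces are defined through \<open>Metric_space.mtopology\<close>, which is meaningful only once the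
  operator norm is known to give a metric.\<close>

lemma Metric_space_adjointable: "Metric_space (carrier L) (cstar_dist L)"
proof
  have d: "cstar_dist L U V = op_norm (U \<ominus>\<^bsub>L\<^esub> V)" if "U \<in> carrier L" "V \<in> carrier L" for U V
  proof -
    have "nrm L = op_norm" unfolding op_norm_def[abs_def] by (simp add: adjointable_ops_def)
    with that show ?thesis by (simp add: cstar_dist_def)
  qed
  have maps: "U \<xi> \<in> carrier H" if "U \<in> carrier L" "\<xi> \<in> carrier H" for U \<xi>
  proof -
    obtain U' where "adjoint_pair H U U'" using \<open>U \<in> carrier L\<close> adjointable_carrier by blast
    then show ?thesis by (rule adjoint_pairD(1)[OF _ \<open>\<xi> \<in> carrier H\<close>])
  qed
  have h0: "hn (\<lambda>a x. 0) \<le> 1"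
    using hnorm_le_iff[OF H_zero, of 1] by (simp add: pnorm_def L2_set_def)
  show nonneg: "0 \<le> cstar_dist L U V" for U V
  proof (cases "U \<in> carrier L \<and> V \<in> carrier L")
    case True
    then have c: "U \<ominus>\<^bsub>L\<^esub> V \<in> carrier L" using adjointable_minus(2) by blast
    have "0 \<le> hn ((U \<ominus>\<^bsub>L\<^esub> V) (\<lambda>a x. 0))" by (rule hnorm_nonneg[OF maps[OF c H_zero]])
    also have "\<dots> \<le> op_norm (U \<ominus>\<^bsub>L\<^esub> V)" by (rule hnorm_le_op_norm[OF c H_zero h0])
    finally show ?thesis using True d by simp
  qed (auto simp: cstar_dist_def)
  have pn: "pnorm (\<lambda>a x. f a x - g a x) = pnorm (\<lambda>a x. g a x - f a x)" for f g
    by (simp add: pnorm_def fun_eq_iff norm_minus_commute)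
  have le: "cstar_dist L U V \<le> cstar_dist L V U" if "U \<in> carrier L" "V \<in> carrier L" for U V
    unfolding d[OF that]
  proof (rule op_norm_le[OF adjointable_minus(2)[OF that]])
    fix \<xi> assume xi: "\<xi> \<in> carrier H" "hn \<xi> \<le> 1"
    note c = maps[OF adjointable_minus(2)[OF that] xi(1)] maps[OF adjointable_minus(2)[OF that(2,1)] xi(1)]
    have "pnorm ((U \<ominus>\<^bsub>L\<^esub> V) \<xi>) x \<le> cstar_dist L V U" for x
    proof -
      have "pnorm ((U \<ominus>\<^bsub>L\<^esub> V) \<xi>) x = pnorm ((V \<ominus>\<^bsub>L\<^esub> U) \<xi>) x"
        using xi(1) pn[of "U \<xi>" "V \<xi>"] by (simp add: adjointable_minus(1)[OF that] adjointable_minus(1)[OF that(2,1)])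
      also have "\<dots> \<le> hn ((V \<ominus>\<^bsub>L\<^esub> U) \<xi>)" by (rule pnorm_le_hnorm[OF c(2)])
      also have "\<dots> \<le> cstar_dist L V U"
        unfolding d[OF that(2,1)] by (rule hnorm_le_op_norm[OF adjointable_minus(2)[OF that(2,1)] xi])
      finally show ?thesis .
    qed
    then show "hn ((U \<ominus>\<^bsub>L\<^esub> V) \<xi>) \<le> cstar_dist L V U" unfolding hnorm_le_iff[OF c(1) nonneg] by (rule allI)
  qed
  show "cstar_dist L U V = cstar_dist L V U" for U V
  proof (cases "U \<in> carrier L \<and> V \<in> carrier L")
    case True
    then show ?thesis by (intro antisym le) auto
  qed (auto simp: cstar_dist_def)
  show "cstar_dist L U V = 0 \<longleftrightarrow> U = V" if uv: "U \<in> carrier L" "V \<in> carrier L" for U V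
  proof
    assume 0: "cstar_dist L U V = 0"
    obtain U' V' where a: "adjoint_pair H U U'" "adjoint_pair H V V'" using uv adjointable_carrier by blast
    \<comment> \<open>Distance zero is tested on the vectors \<open>xi X c\<close>, whose norm is at
      most \<open>1\<close>; by \<open>adjoint_expand\<close> agreement there determines the
      operators.\<close>
    have gen: "U (xi X c) b x = V (xi X c) b x" if c: "c \<in> \<AA>" for c b x
    proof (cases "b \<in> \<AA>")
      case True
      have "pnorm (xi X c) x \<le> 1" for x
      proof -
        have "pnorm (xi X c) x \<le> (\<Sum>b\<in>\<AA>. cmod (xi X c b x))"
          unfolding pnorm_def by (rule L2_set_le_sum) simp
        also have "\<dots> = (\<Sum>b\<in>\<AA>. if b = c then cmod (indicator (fol c) x) else 0)"
          by (intro sum.cong) (auto simp: xi_def)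
        also have "\<dots> \<le> 1" using finite_alphabet c by (simp add: indicator_def)
        finally show ?thesis .
      qed
      then have h1: "hn (xi X c) \<le> 1" using hnorm_le_iff[OF xi_in_H[OF c], of 1] by simp
      have m: "(U \<ominus>\<^bsub>L\<^esub> V) (xi X c) \<in> carrier H" by (rule maps[OF adjointable_minus(2)[OF uv] xi_in_H[OF c]])
      have "hn ((U \<ominus>\<^bsub>L\<^esub> V) (xi X c)) \<le> 0"
        using hnorm_le_op_norm[OF adjointable_minus(2)[OF uv] xi_in_H[OF c] h1] 0 d[OF uv] by simp
      then have "pnorm ((U \<ominus>\<^bsub>L\<^esub> V) (xi X c)) x \<le> 0" using hnorm_le_iff[OF m, of 0] by simp
      then have "cmod ((U \<ominus>\<^bsub>L\<^esub> V) (xi X c) b x) \<le> 0"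
        using member_le_L2_set[OF finite_alphabet True, of "\<lambda>a. cmod ((U \<ominus>\<^bsub>L\<^esub> V) (xi X c) a x)"]
        unfolding pnorm_def by (meson order_trans)
      then show ?thesis using xi_in_H[OF c] by (simp add: adjointable_minus(1)[OF uv])
    qed (use H_in(3)[OF adjoint_pairD(1)[OF a(1) xi_in_H[OF c]]] H_in(3)[OF adjoint_pairD(1)[OF a(2) xi_in_H[OF c]]] in simp)
    show "U = V"
    proof
      fix \<xi> show "U \<xi> = V \<xi>"
      proof (cases "\<xi> \<in> carrier H")
        case True
        have eq: "(\<Sum>c\<in>\<AA>. U (xi X c) b x * \<xi> c x) = (\<Sum>c\<in>\<AA>. V (xi X c) b x * \<xi> c x)" for b x
          by (rule sum.cong[OF refl], rule arg_cong2[where f = "(*)"], erule gen, rule refl)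
        show ?thesis
          by (intro ext, rule trans[OF adjoint_expand[OF a(1) True] trans[OF eq adjoint_expand[OF a(2) True, symmetric]]])
      qed (use adjoint_pairD(3)[OF a(1)] adjoint_pairD(3)[OF a(2)] in simp)
    qed
  next
    assume "U = V"
    then have "pnorm ((U \<ominus>\<^bsub>L\<^esub> V) \<xi>) x \<le> 0" if "\<xi> \<in> carrier H" for \<xi> x
      unfolding adjointable_minus(1)[OF uv] using that by (simp add: pnorm_def L2_set_def)
    then have "cstar_dist L U V \<le> 0"
      unfolding d[OF uv]
    proof (intro op_norm_le[OF adjointable_minus(2)[OF uv]])
      fix \<xi> assume "\<xi> \<in> carrier H"
      then show "hn ((U \<ominus>\<^bsub>L\<^esub> V) \<xi>) \<le> 0"
        unfolding hnorm_le_iff[OF maps[OF adjointable_minus(2)[OF uv] \<open>\<xi> \<in> carrier H\<close>] order_refl]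
        using \<open>\<And>x \<xi>. \<xi> \<in> carrier H \<Longrightarrow> pnorm ((U \<ominus>\<^bsub>L\<^esub> V) \<xi>) x \<le> 0\<close> by blast
    qed
    then show "cstar_dist L U V = 0" using nonneg[of U V] by simp
  qed
  show "cstar_dist L U W \<le> cstar_dist L U V + cstar_dist L V W"
    if uvw: "U \<in> carrier L" "V \<in> carrier L" "W \<in> carrier L" for U V W
    unfolding d[OF uvw(1,3)]
  proof (rule op_norm_le[OF adjointable_minus(2)[OF uvw(1,3)]])
    fix \<xi> assume xi: "\<xi> \<in> carrier H" "hn \<xi> \<le> 1"
    note c = adjointable_minus(2)[OF uvw(1,2)] adjointable_minus(2)[OF uvw(2,3)] adjointable_minus(2)[OF uvw(1,3)]
    have "pnorm ((U \<ominus>\<^bsub>L\<^esub> W) \<xi>) x \<le> cstar_dist L U V + cstar_dist L V W" for x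
    proof -
      have "pnorm ((U \<ominus>\<^bsub>L\<^esub> W) \<xi>) x
        \<le> L2_set (\<lambda>a. cmod ((U \<ominus>\<^bsub>L\<^esub> V) \<xi> a x) + cmod ((V \<ominus>\<^bsub>L\<^esub> W) \<xi> a x)) \<AA>"
        unfolding pnorm_def
      proof (rule L2_set_mono)
        fix a
        show "cmod ((U \<ominus>\<^bsub>L\<^esub> W) \<xi> a x) \<le> cmod ((U \<ominus>\<^bsub>L\<^esub> V) \<xi> a x) + cmod ((V \<ominus>\<^bsub>L\<^esub> W) \<xi> a x)"
          using xi(1) norm_triangle_ineq[of "U \<xi> a x - V \<xi> a x" "V \<xi> a x - W \<xi> a x"]
          by (simp add: adjointable_minus(1)[OF uvw(1,2)] adjointable_minus(1)[OF uvw(2,3)] adjointable_minus(1)[OF uvw(1,3)])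
      qed simp
      also have "\<dots> \<le> pnorm ((U \<ominus>\<^bsub>L\<^esub> V) \<xi>) x + pnorm ((V \<ominus>\<^bsub>L\<^esub> W) \<xi>) x"
        unfolding pnorm_def by (rule L2_set_triangle_ineq)
      also have "\<dots> \<le> hn ((U \<ominus>\<^bsub>L\<^esub> V) \<xi>) + hn ((V \<ominus>\<^bsub>L\<^esub> W) \<xi>)"
        by (intro add_mono pnorm_le_hnorm maps[OF c(1) xi(1)] maps[OF c(2) xi(1)])
      also have "\<dots> \<le> cstar_dist L U V + cstar_dist L V W"
        unfolding d[OF uvw(1,2)] d[OF uvw(2,3)] by (rule add_mono[OF hnorm_le_op_norm[OF c(1) xi] hnorm_le_op_norm[OF c(2) xi]])
      finally show ?thesis .
    qed
    then show "hn ((U \<ominus>\<^bsub>L\<^esub> W) \<xi>) \<le> cstar_dist L U V + cstar_dist L V W"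
      unfolding hnorm_le_iff[OF maps[OF c(3) xi(1)] add_nonneg_nonneg[OF nonneg nonneg]] by (rule allI)
  qed
qed

text \<open>\<open>closed_span\<close> is an intersection, and the space of all adjointable
  operators belongs to the intersected family, being closed in its own metric. In particular every
  compact operator has an adjoint.\<close>

lemma compact_subset: "carrier (compact_ops (D_alg \<AA> X) H) \<subseteq> carrier L"
proof -
  interpret M: Metric_space "carrier L" "cstar_dist L" by (rule Metric_space_adjointable)
  have "closed_subspace L (carrier L)"
    unfolding closed_subspace_def
  proof (intro conjI ballI allI)
    show "\<zero>\<^bsub>L\<^esub> \<in> carrier L" using adjoint_zero adjointable_carrier by blast
    fix U assume U: "U \<in> carrier L"
    show "c \<odot>\<^bsub>L\<^esub> U \<in> carrier L" for c using U adjoint_smult adjointable_carrier by blast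
    show "U \<oplus>\<^bsub>L\<^esub> V \<in> carrier L" if "V \<in> carrier L" for V
      using U that adjoint_add adjointable_carrier by blast
  qed (use M.closedin_mspace in auto)
  moreover have "{theta H \<xi> \<eta> | \<xi> \<eta>. \<xi> \<in> carrier H \<and> \<eta> \<in> carrier H} \<subseteq> carrier L"
    using adjoint_theta adjointable_carrier by blast
  ultimately have "carrier L \<in> {V. closed_subspace L V \<and>
      {theta H \<xi> \<eta> | \<xi> \<eta>. \<xi> \<in> carrier H \<and> \<eta> \<in> carrier H} \<subseteq> V}" by (intro CollectI conjI)
  then show ?thesis
    by (simp only: compact_ops_def closed_span_def cstar.simps) (simp add: Inter_lower del: H_simps)
qed

end

section \<open>The canonical generators\<close>

text \<open>Kept apart from coinvariance and generation because it serves twice: for the canonical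
  maps into \<open>Q\<close>, and later for the representation constructed in an arbitrary target
  algebra.\<close>

locale subshift_toeplitz = finite_subshift \<AA> X + cstar_algebra Q
  for \<AA> :: "'a set" and X and Q :: "'o cstar" (structure) +
  fixes kH kD
  assumes toeplitz: "toeplitz_representation (D_alg \<AA> X) H (left_action \<AA> X) Q kH kD"
begin

lemma kD_hom: "star_hom (fn_alg X D) Q kD"
  using toeplitz unfolding toeplitz_representation_def by (simp flip: D_alg_eq)

lemmas kD = star_hom_fn_algD[OF kD_hom]

lemma kH:
  "\<xi> \<in> carrier H \<Longrightarrow> kH \<xi> \<in> carrier Q"
  "\<xi> \<in> carrier H \<Longrightarrow> \<eta> \<in> carrier H \<Longrightarrow> kH (\<lambda>a x. \<xi> a x + \<eta> a x) = kH \<xi> \<oplus> kH \<eta>"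
  "\<xi> \<in> carrier H \<Longrightarrow> kH (\<lambda>a x. c * \<xi> a x) = c \<odot>\<^bsub>Q\<^esub> kH \<xi>"
  "\<xi> \<in> carrier H \<Longrightarrow> f \<in> D \<Longrightarrow> kH (\<lambda>a x. \<xi> a x * f x) = kH \<xi> \<otimes> kD f"
  "\<xi> \<in> carrier H \<Longrightarrow> \<eta> \<in> carrier H \<Longrightarrow> star Q (kH \<xi>) \<otimes> kH \<eta> = kD (iprod H \<xi> \<eta>)"
  "\<xi> \<in> carrier H \<Longrightarrow> f \<in> D \<Longrightarrow> kH (\<lambda>a x. lambda_op X a f x * \<xi> a x) = kD f \<otimes> kH \<xi>"
proof -
  note t = toeplitz[unfolded toeplitz_representation_def H_simps(1-4)]
  show "\<xi> \<in> carrier H \<Longrightarrow> kH \<xi> \<in> carrier Q" using t by blast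
  show "\<xi> \<in> carrier H \<Longrightarrow> \<eta> \<in> carrier H \<Longrightarrow> kH (\<lambda>a x. \<xi> a x + \<eta> a x) = kH \<xi> \<oplus> kH \<eta>" using t by blast
  show "\<xi> \<in> carrier H \<Longrightarrow> kH (\<lambda>a x. c * \<xi> a x) = c \<odot>\<^bsub>Q\<^esub> kH \<xi>" using t by blast
  show "\<xi> \<in> carrier H \<Longrightarrow> f \<in> D \<Longrightarrow> kH (\<lambda>a x. \<xi> a x * f x) = kH \<xi> \<otimes> kD f" using t by blast
  show "\<xi> \<in> carrier H \<Longrightarrow> \<eta> \<in> carrier H \<Longrightarrow> star Q (kH \<xi>) \<otimes> kH \<eta> = kD (iprod H \<xi> \<eta>)" using t by blast
  show "kH (\<lambda>a x. lambda_op X a f x * \<xi> a x) = kD f \<otimes> kH \<xi>" if "\<xi> \<in> carrier H" "f \<in> D"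
  proof -
    have "kH (left_action \<AA> X f \<xi>) = kD f \<otimes> kH \<xi>" using t that by blast
    then show ?thesis unfolding left_action_apply[OF that(1)] .
  qed
qed

lemma kH_sum:
  assumes "F \<subseteq> \<AA>" "\<And>a. a \<in> F \<Longrightarrow> \<eta> a \<in> carrier H"
  shows "(\<lambda>b x. \<Sum>a\<in>F. \<eta> a b x) \<in> carrier H \<and> kH (\<lambda>b x. \<Sum>a\<in>F. \<eta> a b x) = (\<Oplus>a\<in>F. kH (\<eta> a))"
  using finite_subset[OF assms(1) finite_alphabet] assms(2)
proof (induction F)
  case empty
  show ?case using kH(3)[OF H_zero, of 0] kH(1)[OF H_zero] H_zero by simp
next
  case (insert a F)
  then have "(\<lambda>a. kH (\<eta> a)) \<in> F \<rightarrow> carrier Q" "\<eta> a \<in> carrier H" using kH(1) by auto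
  moreover have IH: "(\<lambda>b x. \<Sum>a\<in>F. \<eta> a b x) \<in> carrier H" "kH (\<lambda>b x. \<Sum>a\<in>F. \<eta> a b x) = (\<Oplus>a\<in>F. kH (\<eta> a))"
    using insert by auto
  moreover have "(\<lambda>b x. \<Sum>a\<in>insert a F. \<eta> a b x) = (\<lambda>b x. \<eta> a b x + (\<Sum>a\<in>F. \<eta> a b x))"
    using insert(1,2) by simp
  ultimately show ?case
    using H_closed(1)[of "\<eta> a", OF _ IH(1)] kH(1)[of "\<eta> a"] kH(2)[of "\<eta> a", OF _ IH(1)] insert(1,2)
    by (simp only: finsum_insert simp_thms)
qed

end

section \<open>Unit, relations and generation in \<open>Q\<close>\<close>

locale generating_representation = subshift_toeplitz +
  assumes coinvariant: "cuntz_pimsner_coinvariant (D_alg \<AA> X) H (left_action \<AA> X) Q kH kD"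
    and generated: "cstar_generated Q (kH ` carrier H \<union> kD ` D) = carrier Q"
begin

abbreviation "I \<equiv> kD (indicator X)"
abbreviation "S \<equiv> \<lambda>a. kH (xi X a)"
abbreviation "W \<equiv> word_elem Q I S"

lemma S_closed: "a \<in> \<AA> \<Longrightarrow> S a \<in> carrier Q"
  by (intro kH(1) xi_in_H)

lemma unit_in_D: "indicator X \<in> D"
  using function_algebraD(2)[OF D_fa(1)] .

lemma star_I: "star Q I = I"
proof -
  have "(\<lambda>x. cnj (indicator X x)) = indicator X" by (auto simp: indicator_def)
  then show ?thesis using kD(5)[OF unit_in_D] by (simp only:)
qed

lemma kD_mult_I: "f \<in> D \<Longrightarrow> kD f \<otimes> I = kD f" "f \<in> D \<Longrightarrow> I \<otimes> kD f = kD f"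
proof -
  assume f: "f \<in> D"
  have "(\<lambda>x. f x * indicator X x) = f" "(\<lambda>x. indicator X x * f x) = f"
    using function_algebraD(8)[OF D_fa(1) f] by (auto simp: indicator_def fun_eq_iff)
  then show "kD f \<otimes> I = kD f" "I \<otimes> kD f = kD f"
    using kD(4)[OF f unit_in_D] kD(4)[OF unit_in_D f] by metis+
qed

text \<open>By \<open>cstar_subalgebra_unit_for\<close> it suffices to test the generators. On
  \<open>kH\<close> the left test works because the left action of \<open>indicator X\<close>
  multiplies each coordinate by \<open>indicator (fol a)\<close>, which fixes it.\<close>

lemma unit: "cstar_unit Q I"
proof -
  let ?V = "{x \<in> carrier Q. I \<otimes> x = x \<and> x \<otimes> I = x}"
  have "kH ` carrier H \<subseteq> ?V"
  proof safe
    fix \<xi> assume xi: "\<xi> \<in> carrier H"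
    show "kH \<xi> \<in> carrier Q" by (rule kH(1)[OF xi])
    have "(\<lambda>a x. lambda_op X a (indicator X) x * \<xi> a x) = \<xi>"
      by (intro ext) (simp only: lambda_op_unit H_follower_mult[OF xi])
    then show "I \<otimes> kH \<xi> = kH \<xi>" using kH(6)[OF xi unit_in_D] by metis
    have "(\<lambda>a x. \<xi> a x * indicator X x) = \<xi>"
      using H_in(2)[OF xi] follower_subset[of "[_]"] by (auto simp: indicator_def fun_eq_iff)
    then show "kH \<xi> \<otimes> I = kH \<xi>" using kH(4)[OF xi unit_in_D] by metis
  qed
  moreover have "kD ` D \<subseteq> ?V" using kD_mult_I kD(1) by auto
  ultimately have "kH ` carrier H \<union> kD ` D \<subseteq> ?V" by blast
  from cstar_generated_least[OF cstar_subalgebra_unit_for[OF kD(1)[OF unit_in_D] star_I] this]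
  have "carrier Q \<subseteq> ?V" unfolding generated .
  then show ?thesis using kD(1)[OF unit_in_D] unfolding cstar_unit_def by blast
qed

lemma I: "I \<in> carrier Q" "x \<in> carrier Q \<Longrightarrow> I \<otimes> x = x" "x \<in> carrier Q \<Longrightarrow> x \<otimes> I = x"
  using unit unfolding cstar_unit_def by blast+

text \<open>At \<open>xi X a\<close>, which has a single nonzero coordinate, the left action by
  \<open>f\<close> coincides with the right action by \<open>lambda_op X a f\<close>.\<close>

lemma kD_S: 
  assumes a: "a \<in> \<AA>" and f: "f \<in> D" shows "kD f \<otimes> S a = S a \<otimes> kD (lambda_op X a f)"
proof -
  have "(\<lambda>b x. lambda_op X b f x * xi X a b x) = (\<lambda>b x. xi X a b x * lambda_op X a f x)"
    by (auto simp: xi_def fun_eq_iff)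
  then show ?thesis
    using kH(6)[OF xi_in_H[OF a] f] kH(4)[OF xi_in_H[OF a] lambda_op_D[OF a f]] by simp
qed

lemma star_S_S: "a \<in> \<AA> \<Longrightarrow> star Q (S a) \<otimes> S a = kD (indicator (fol a))"
  using kH(5)[OF xi_in_H xi_in_H, of a a] iprod_xi[OF _ xi_in_H, of a a] by (simp add: xi_def)

lemma S_star_S: assumes a: "a \<in> \<AA>" shows "S a \<otimes> star Q (S a) \<otimes> S a = S a"
proof -
  have "(\<lambda>b x. xi X a b x * indicator (fol a) x) = xi X a"
    by (auto simp: xi_def fun_eq_iff indicator_def)
  then have "S a \<otimes> (star Q (S a) \<otimes> S a) = S a"
    using kH(4)[OF xi_in_H[OF a] fol_in(2)[OF a]] unfolding star_S_S[OF a] by metis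
  then show ?thesis using S_closed[OF a] by (simp only: mult_assoc star_closed)
qed

lemma compact_sum:
  assumes rho: "induced_hom (D_alg \<AA> X) H Q kH \<rho>" and F: "F \<subseteq> \<AA>"
  defines "T \<equiv> \<lambda>\<zeta>\<in>carrier H. \<lambda>b x. \<Sum>a\<in>F. xi X a b x * \<zeta> a x"
  shows "T \<in> carrier (compact_ops (D_alg \<AA> X) H) \<and> \<rho> T = (\<Oplus>a\<in>F. S a \<otimes> star Q (S a))"
proof -
  let ?K = "compact_ops (D_alg \<AA> X) H"
  let ?L = "adjointable_ops (D_alg \<AA> X) H"
  have sub: "\<And>U V. U \<in> carrier ?K \<Longrightarrow> V \<in> carrier ?K \<Longrightarrow> U \<oplus>\<^bsub>?L\<^esub> V \<in> carrier ?K"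
    "\<zero>\<^bsub>?L\<^esub> \<in> carrier ?K"
    by (auto simp: compact_ops_def closed_span_def closed_subspace_def)
  have th: "theta H \<xi> \<eta> \<in> carrier ?K" if "\<xi> \<in> carrier H" "\<eta> \<in> carrier H" for \<xi> \<eta>
    using that by (auto simp: compact_ops_def closed_span_def simp del: H_simps)
  have hom: "star_hom ?K Q \<rho>" using rho by (simp add: induced_hom_def)
  have "\<zero>\<^bsub>?L\<^esub> = 0 \<odot>\<^bsub>?K\<^esub> \<zero>\<^bsub>?L\<^esub>"
    using H_zero by (simp add: compact_ops_def adjointable_ops_def fun_eq_iff)
  moreover have "\<rho> (0 \<odot>\<^bsub>?K\<^esub> \<zero>\<^bsub>?L\<^esub>) = 0 \<odot>\<^bsub>Q\<^esub> \<rho> \<zero>\<^bsub>?L\<^esub>" "\<rho> \<zero>\<^bsub>?L\<^esub> \<in> carrier Q"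
    using hom sub(2) unfolding star_hom_def by blast+
  ultimately have zero: "\<rho> \<zero>\<^bsub>?L\<^esub> = \<zero>" by simp
  show ?thesis
    using finite_subset[OF F finite_alphabet] F unfolding T_def
  proof (induction F)
    case empty
    have "(\<lambda>\<zeta>\<in>carrier H. \<lambda>b x. \<Sum>a\<in>{}. xi X a b x * \<zeta> a x) = \<zero>\<^bsub>?L\<^esub>"
      by (simp add: adjointable_ops_def)
    then show ?case using sub(2) zero by simp
  next
    case (insert a F)
    let ?U = "\<lambda>\<zeta>\<in>carrier H. \<lambda>b x. \<Sum>a\<in>F. xi X a b x * \<zeta> a x"
    have a: "a \<in> \<AA>" and F: "F \<subseteq> \<AA>" using insert by auto
    note tha = th[OF xi_in_H[OF a] xi_in_H[OF a]]
    have "theta H (xi X a) (xi X a) \<zeta> = (\<lambda>b x. xi X a b x * \<zeta> a x)" if "\<zeta> \<in> carrier H" for \<zeta>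
      using that iprod_xi[OF a that] by (simp add: theta_def del: H_simps(5))
    then have "(\<lambda>\<zeta>\<in>carrier H. \<lambda>b x. \<Sum>a\<in>insert a F. xi X a b x * \<zeta> a x) = theta H (xi X a) (xi X a) \<oplus>\<^bsub>?L\<^esub> ?U"
      using insert(1,2) by (auto simp: adjointable_ops_def restrict_def)
    moreover have "\<rho> (theta H (xi X a) (xi X a) \<oplus>\<^bsub>?L\<^esub> ?U) = \<rho> (theta H (xi X a) (xi X a)) \<oplus> \<rho> ?U"
    proof -
      have "?U \<in> carrier ?K" using insert(3)[OF F] ..
      then have "\<rho> (theta H (xi X a) (xi X a) \<oplus>\<^bsub>?K\<^esub> ?U) = \<rho> (theta H (xi X a) (xi X a)) \<oplus> \<rho> ?U"
        using hom tha unfolding star_hom_def by blast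
      then show ?thesis by (simp add: compact_ops_def)
    qed
    moreover have "\<rho> (theta H (xi X a) (xi X a)) = S a \<otimes> star Q (S a)"
      using rho xi_in_H[OF a] by (simp add: induced_hom_def)
    moreover have "(\<lambda>a. S a \<otimes> star Q (S a)) \<in> F \<rightarrow> carrier Q" using F S_closed by auto
    moreover have "?U \<in> carrier ?K" "\<rho> ?U = (\<Oplus>a\<in>F. S a \<otimes> star Q (S a))" using insert(3)[OF F] by blast+
    moreover from sub(1)[OF tha this(1)]
    have "theta H (xi X a) (xi X a) \<oplus>\<^bsub>?L\<^esub> ?U \<in> carrier ?K" .
    ultimately show ?case
      using insert(1,2) S_closed[OF a] by (simp only: finsum_insert) (simp add: finsum_insert)
  qed
qed

lemma sum_S_star_S: "(\<Oplus>a\<in>\<AA>. S a \<otimes> star Q (S a)) = I"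
proof -
  obtain \<rho> where rho: "induced_hom (D_alg \<AA> X) H Q kH \<rho>"
    and co: "\<And>f. f \<in> D \<Longrightarrow> left_action \<AA> X f \<in> carrier (compact_ops (D_alg \<AA> X) H) \<Longrightarrow> \<rho> (left_action \<AA> X f) = kD f"
    using coinvariant unfolding cuntz_pimsner_coinvariant_def by blast
  have eq: "left_action \<AA> X (indicator X) = (\<lambda>\<zeta>\<in>carrier H. \<lambda>b x. \<Sum>a\<in>\<AA>. xi X a b x * \<zeta> a x)"
    unfolding left_action_def
    by (intro restrict_ext ext) (simp only: xi_sum[symmetric] lambda_op_unit H_follower_mult)
  note sum = compact_sum[OF rho subset_refl, folded eq]
  show ?thesis
    using co[OF unit_in_D conjunct1[OF sum]] conjunct2[OF sum] by (rule trans[OF sym, rotated])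
qed

lemma W_closed: "\<mu> \<in> lists \<AA> \<Longrightarrow> W \<mu> \<in> carrier Q"
  by (rule word_elem_closed[OF I(1) S_closed])

lemma W_snoc: "\<mu> \<in> lists \<AA> \<Longrightarrow> a \<in> \<AA> \<Longrightarrow> W (\<mu> @ [a]) = W \<mu> \<otimes> S a"
  by (rule word_elem_snoc[OF unit S_closed])

lemma follower_in_D: "\<mu> \<in> lists \<AA> \<Longrightarrow> indicator (follower_set X \<mu>) \<in> D"
  using follower_in_AX AX_fa(2) by blast

text \<open>The induction appends letters: with \<open>kD_S\<close>, conjugating the projection of
  \<open>\<mu>\<close> by \<open>S a\<close> applies \<open>lambda_op X a\<close> to its indicator,
  and that is the follower set of the longer word.\<close>

lemma star_W_W: "\<mu> \<in> lists \<AA> \<Longrightarrow> star Q (W \<mu>) \<otimes> W \<mu> = kD (indicator (follower_set X \<mu>))"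
proof (induction \<mu> rule: rev_induct)
  case Nil
  then show ?case using star_I I by (simp add: word_elem_def)
next
  case (snoc a \<mu>)
  then have mu: "\<mu> \<in> lists \<AA>" and a: "a \<in> \<AA>" by auto
  let ?f = "indicator (follower_set X \<mu>)"
  note [simp] = W_closed[OF mu] S_closed[OF a] kD(1)[OF follower_in_D[OF mu]]
    kD(1)[OF lambda_op_D[OF a follower_in_D[OF mu]]]
  have "star Q (W (\<mu> @ [a])) \<otimes> W (\<mu> @ [a]) = star Q (S a) \<otimes> ((star Q (W \<mu>) \<otimes> W \<mu>) \<otimes> S a)"
    by (simp add: W_snoc[OF mu a] star_mult mult_assoc)
  also have "\<dots> = star Q (S a) \<otimes> (S a \<otimes> kD (lambda_op X a ?f))"
    by (simp only: snoc(1)[OF mu] kD_S[OF a follower_in_D[OF mu]])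
  also have "\<dots> = star Q (S a) \<otimes> S a \<otimes> kD (lambda_op X a ?f)"
    by (simp add: mult_assoc)
  also have "\<dots> = kD (lambda_op X a ?f)"
    by (simp only: star_S_S[OF a] lambda_op_follower_mult
        kD(4)[OF fol_in(2)[OF a] lambda_op_D[OF a follower_in_D[OF mu]], symmetric])
  finally show ?case by (simp add: lambda_op_follower)
qed

text \<open>\<open>g\<close> is the iterate of \<open>lambda_op\<close> along \<open>\<nu>\<close>,
  left existential to avoid naming it. Realness is carried along for the adjoint argument in
  \<open>kD_commute\<close>.\<close>

lemma kD_W:
  assumes "\<nu> \<in> lists \<AA>" "f \<in> D" "\<And>x. cnj (f x) = f x"
  shows "\<exists>g\<in>D. (\<forall>x. cnj (g x) = g x) \<and> kD f \<otimes> W \<nu> = W \<nu> \<otimes> kD g"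
  using assms
proof (induction \<nu> arbitrary: f)
  case Nil
  then show ?case using I kD(1) by (auto simp: word_elem_def intro!: bexI[of _ f])
next
  case (Cons a \<nu>)
  note a = Cons(1) and nu = Cons(2)
  have l: "lambda_op X a f \<in> D" by (rule lambda_op_D[OF a Cons(4)])
  have "cnj (lambda_op X a f x) = lambda_op X a f x" for x using Cons(5) by (simp add: lambda_op_def)
  from Cons(3)[OF l this] obtain g where g: "g \<in> D" "\<And>x. cnj (g x) = g x"
    "kD (lambda_op X a f) \<otimes> W \<nu> = W \<nu> \<otimes> kD g" by blast
  note [simp] = kD(1)[OF Cons(4)] kD(1)[OF l] kD(1)[OF g(1)] S_closed[OF a] W_closed[OF nu]
  have "kD f \<otimes> (S a \<otimes> W \<nu>) = (kD f \<otimes> S a) \<otimes> W \<nu>"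
    by (simp add: mult_assoc)
  also have "\<dots> = S a \<otimes> (kD (lambda_op X a f) \<otimes> W \<nu>)"
    unfolding kD_S[OF a Cons(4)] by (simp add: mult_assoc)
  also have "\<dots> = S a \<otimes> W \<nu> \<otimes> kD g"
    unfolding g(3) by (simp add: mult_assoc)
  finally have "kD f \<otimes> W (a # \<nu>) = W (a # \<nu>) \<otimes> kD g" by (simp add: word_elem_def)
  then show ?case using g by blast
qed

text \<open>Moving \<open>kD f\<close> through \<open>W \<nu>\<close> shows the product to be
  \<open>W \<nu> \<otimes> kD g \<otimes> star Q (W \<nu>)\<close>, self-adjoint because
  \<open>g\<close> is real; and two self-adjoint elements with self-adjoint product commute.\<close>

lemma kD_commute:
  assumes nu: "\<nu> \<in> lists \<AA>" and f: "f \<in> D" "\<And>x. cnj (f x) = f x"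
  shows "kD f \<otimes> (W \<nu> \<otimes> star Q (W \<nu>)) = W \<nu> \<otimes> star Q (W \<nu>) \<otimes> kD f"
proof -
  obtain g where g: "g \<in> D" "\<And>x. cnj (g x) = g x" "kD f \<otimes> W \<nu> = W \<nu> \<otimes> kD g"
    using kD_W[OF assms] by blast
  have s: "star Q (kD f) = kD f" "star Q (kD g) = kD g"
    using kD(5)[OF f(1)] kD(5)[OF g(1)] unfolding f(2) g(2) by metis+
  note [simp] = W_closed[OF nu] kD(1)[OF f(1)] kD(1)[OF g(1)]
  have eq: "kD f \<otimes> (W \<nu> \<otimes> star Q (W \<nu>)) = W \<nu> \<otimes> kD g \<otimes> star Q (W \<nu>)"
    by (simp add: mult_assoc[symmetric] g(3))
  have "W \<nu> \<otimes> star Q (W \<nu>) \<otimes> kD f = star Q (kD f \<otimes> (W \<nu> \<otimes> star Q (W \<nu>)))"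
    by (simp add: star_mult s)
  also have "\<dots> = star Q (W \<nu> \<otimes> kD g \<otimes> star Q (W \<nu>))" by (simp only: eq)
  also have "\<dots> = W \<nu> \<otimes> kD g \<otimes> star Q (W \<nu>)" by (simp add: star_mult s mult_assoc)
  finally show ?thesis using eq by simp
qed

lemma kH_eq:
  assumes "\<xi> \<in> carrier H" shows "kH \<xi> = (\<Oplus>a\<in>\<AA>. S a \<otimes> kD (\<xi> a))"
proof -
  have "\<xi> = (\<lambda>b x. \<Sum>a\<in>\<AA>. xi X a b x * \<xi> a x)"
    by (intro ext) (rule xi_sum[OF assms])
  then have "kH \<xi> = kH (\<lambda>b x. \<Sum>a\<in>\<AA>. xi X a b x * \<xi> a x)" by (rule arg_cong)
  also have "\<dots> = (\<Oplus>a\<in>\<AA>. kH (\<lambda>b x. xi X a b x * \<xi> a x))"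
    using kH_sum[of \<AA> "\<lambda>a b x. xi X a b x * \<xi> a x"] H_closed(3)[OF xi_in_H H_in(1)[OF assms]] by simp
  also have "\<dots> = (\<Oplus>a\<in>\<AA>. S a \<otimes> kD (\<xi> a))"
    using kH(4)[OF xi_in_H H_in(1)[OF assms]] S_closed kD(1)[OF H_in(1)[OF assms]] by (intro finsum_cong') auto
  finally show ?thesis .
qed

text \<open>Recovers \<open>kD f\<close> from the values of \<open>kD\<close> at the pull-backs of
  \<open>f\<close>, by inserting (a) on the right. The converse direction turns this identity into
  the definition of \<open>step_map\<close>.\<close>

lemma kD_eq: 
  assumes f: "f \<in> D" shows "kD f = (\<Oplus>a\<in>\<AA>. S a \<otimes> kD (lambda_op X a f) \<otimes> star Q (S a))"
proof -
  have "kD f = kD f \<otimes> (\<Oplus>a\<in>\<AA>. S a \<otimes> star Q (S a))"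
    using kD_mult_I[OF f] by (simp add: sum_S_star_S)
  also have "\<dots> = (\<Oplus>a\<in>\<AA>. kD f \<otimes> (S a \<otimes> star Q (S a)))"
    using finite_alphabet S_closed kD(1)[OF f] by (intro mult_finsum) auto
  also have "\<dots> = (\<Oplus>a\<in>\<AA>. S a \<otimes> kD (lambda_op X a f) \<otimes> star Q (S a))"
    using S_closed kD(1)[OF f] kD(1)[OF lambda_op_D[OF _ f]] kD_S[OF _ f]
    by (intro finsum_cong') (auto simp: mult_assoc[symmetric])
  finally show ?thesis .
qed

text \<open>\<open>kD_eq\<close> reduces membership of \<open>kD f\<close> to that of its
  pull-backs, which settles cylinder sets by induction on \<open>\<nu>\<close>. From these to all of
  \<open>D\<close> the passage needs contractivity of \<open>kD\<close>, whose definition as a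
  homomorphism includes no continuity.\<close>

lemma S_generates: "cstar_generated Q (S ` \<AA>) = carrier Q"
proof
  let ?C = "cstar_generated Q (S ` \<AA>)"
  have SC: "S ` \<AA> \<subseteq> carrier Q" using S_closed by auto
  note sub = cstar_subalgebra_generated(1)[OF SC, unfolded cstar_subalgebra_iff]
  have C0: "?C \<subseteq> carrier Q" "\<zero> \<in> ?C" using sub by auto
  have C: "\<And>x y. x \<in> ?C \<Longrightarrow> y \<in> ?C \<Longrightarrow> x \<oplus> y \<in> ?C" "\<And>c x. x \<in> ?C \<Longrightarrow> c \<odot>\<^bsub>Q\<^esub> x \<in> ?C"
    "\<And>x y. x \<in> ?C \<Longrightarrow> y \<in> ?C \<Longrightarrow> x \<otimes> y \<in> ?C" "\<And>x. x \<in> ?C \<Longrightarrow> star Q x \<in> ?C"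
    using sub by auto
  have Cl: "x \<in> ?C" if "x \<in> carrier Q" "\<And>e. e > 0 \<Longrightarrow> \<exists>y\<in>?C. nrm Q (x \<ominus> y) < e" for x
    using sub that by auto
  have Csum: "(\<Oplus>a\<in>\<AA>. x a) \<in> ?C" if "\<And>a. a \<in> \<AA> \<Longrightarrow> x a \<in> ?C" for x
    using that by (intro finsum_closed_subset[OF finite_alphabet C0]) (auto intro: C)
  have S: "S a \<in> ?C" if "a \<in> \<AA>" for a using cstar_subalgebra_generated(2)[OF SC] that by blast
  have IC: "I \<in> ?C" unfolding sum_S_star_S[symmetric] by (intro Csum C S)
  have WC: "W \<mu> \<in> ?C" if "\<mu> \<in> lists \<AA>" for \<mu>
    using that by induction (auto simp: word_elem_def IC intro: C S)
  have foC: "kD (indicator (follower_set X \<mu>)) \<in> ?C" if "\<mu> \<in> lists \<AA>" for \<mu>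
    unfolding star_W_W[OF that, symmetric] by (intro C WC that)
  have cyC: "kD (indicator (cylinder2 X \<mu> \<nu>)) \<in> ?C" if "\<mu> \<in> lists \<AA>" "\<nu> \<in> lists \<AA>" for \<mu> \<nu>
    using that(2)
  proof (induction \<nu>)
    case Nil
    then show ?case using foC[OF that(1)] by (simp add: cylinder2_Nil)
  next
    case (Cons b \<nu>)
    have *: "kD (lambda_op X a (indicator (cylinder2 X \<mu> (b # \<nu>)))) \<in> ?C" if a: "a \<in> \<AA>" for a
      using kD(4)[OF cylinder2_in_D[OF \<open>\<mu> \<in> lists \<AA>\<close> Cons(2)] fol_in(2)[OF a]] C(3)[OF Cons(3) foC[of "[a]"]] a
        star_hom_zero[OF D_fa(1) kD_hom] C0
      by (cases "a = b") (simp_all add: lambda_op_cylinder2)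
    have "b # \<nu> \<in> lists \<AA>" using Cons by simp
    from kD_eq[OF cylinder2_in_D[OF \<open>\<mu> \<in> lists \<AA>\<close> this]] show ?case
      by (simp only:) (intro Csum C S *)
  qed
  have kDC: "kD f \<in> ?C" if "f \<in> D" for f
    using that
  proof (induction rule: D_induct)
    case (gen f)
    then show ?case using cyC by (auto simp: cyl_gens_def)
  next
    case (smult c f)
    then show ?case using kD(3)[OF smult(1)] C(2)[OF smult(2)] by simp
  next
    case (limit f)
    show ?case
    proof (rule Cl)
      fix e :: real assume "e > 0"
      then have "e / 2 > 0" by simp
      then obtain g where g: "g \<in> D" "kD g \<in> ?C" "\<And>x. cmod (f x - g x) \<le> e / 2"
        using limit(2) unfolding unif_limit_def by blast
      have "nrm Q (kD f \<ominus> kD g) \<le> e / 2"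
        using star_hom_contractive[OF D_fa(1) kD_hom function_algebra_minus[OF D_fa(1) limit(1) g(1)] g(3)]
          star_hom_minus[OF D_fa(1) kD_hom limit(1) g(1)] by simp
      then show "\<exists>y\<in>?C. nrm Q (kD f \<ominus> y) < e" using g(2) \<open>e > 0\<close> by (intro bexI[of _ "kD g"]) auto
    qed (rule kD(1)[OF limit(1)])
  qed (simp_all add: kD C)
  have "kH ` carrier H \<subseteq> ?C" 
  proof safe
    fix \<xi> assume xi: "\<xi> \<in> carrier H"
    show "kH \<xi> \<in> ?C" unfolding kH_eq[OF xi] by (intro Csum C(3) S kDC H_in(1)[OF xi])
  qed
  moreover have "kD ` D \<subseteq> ?C" using kDC by blast
  ultimately have "kH ` carrier H \<union> kD ` D \<subseteq> ?C" by (rule Un_least)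
  from cstar_generated_least[OF cstar_subalgebra_generated(1)[OF SC] this]
  show "carrier Q \<subseteq> ?C" unfolding generated .
  show "?C \<subseteq> carrier Q" by (rule C0)
qed

lemma S_family: "subshift_family \<AA> X Q I S"
  unfolding subshift_family_def Let_def partial_isometry_def S_generates
proof (intro conjI ballI exI[of _ kD])
  \<comment> \<open>The homomorphism required by (c) is \<open>kD\<close> restricted to
    \<open>AX\<close>; by \<open>S_generates\<close> its target is all of \<open>Q\<close>.\<close>
  have "star_hom (A_alg \<AA> X) Q kD"
    by (subst A_alg_eq) (rule star_hom_fn_alg_subset[OF kD_hom AX_fa(2)])
  then show "star_hom (A_alg \<AA> X) (Q\<lparr>carrier := carrier Q\<rparr>) kD" by simp
  show "\<And>a. a \<in> \<AA> \<Longrightarrow> S a \<in> carrier Q" by (rule S_closed)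
  show "\<And>a. a \<in> \<AA> \<Longrightarrow> S a \<otimes> star Q (S a) \<otimes> S a = S a" by (rule S_star_S)
  show "(\<Oplus>a\<in>\<AA>. S a \<otimes> star Q (S a)) = I" by (rule sum_S_star_S)
  fix \<mu> assume mu: "\<mu> \<in> lists \<AA>"
  then show "kD (indicator (follower_set X \<mu>)) = star Q (W \<mu>) \<otimes> W \<mu>" by (rule star_W_W[symmetric])
  fix \<nu> assume "\<nu> \<in> lists \<AA>"
  then show "star Q (W \<mu>) \<otimes> W \<mu> \<otimes> (W \<nu> \<otimes> star Q (W \<nu>)) = W \<nu> \<otimes> star Q (W \<nu>) \<otimes> (star Q (W \<mu>) \<otimes> W \<mu>)"
    unfolding star_W_W[OF mu] by (intro kD_commute follower_in_D mu) (auto simp: indicator_def)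
qed (rule refl)

end

section \<open>Extending the representation to the diagonal algebra\<close>

locale generating_family = finite_subshift \<AA> X + cstar_algebra B
  for \<AA> :: "'a set" and X and B :: "'c cstar" (structure) +
  fixes J T h
  assumes unit: "cstar_unit B J"
    and T_partial_isometry: "a \<in> \<AA> \<Longrightarrow> partial_isometry B (T a)"
    and sum_T: "(\<Oplus>a\<in>\<AA>. T a \<otimes> star B (T a)) = J"
    and word_commute: "\<lbrakk>\<mu> \<in> lists \<AA>; \<nu> \<in> lists \<AA>\<rbrakk> \<Longrightarrow>
      star B (word_elem B J T \<mu>) \<otimes> word_elem B J T \<mu> \<otimes> (word_elem B J T \<nu> \<otimes> star B (word_elem B J T \<nu>)) =
      word_elem B J T \<nu> \<otimes> star B (word_elem B J T \<nu>) \<otimes> (star B (word_elem B J T \<mu>) \<otimes> word_elem B J T \<mu>)"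
    and h_hom: "star_hom (fn_alg X AX) B h" and h_unit: "h (indicator X) = J"
    and h_follower: "\<mu> \<in> lists \<AA> \<Longrightarrow>
      h (indicator (follower_set X \<mu>)) = star B (word_elem B J T \<mu>) \<otimes> word_elem B J T \<mu>"
begin

abbreviation "W \<equiv> word_elem B J T"

lemma J [simp]: "J \<in> carrier B" "x \<in> carrier B \<Longrightarrow> J \<otimes> x = x" "x \<in> carrier B \<Longrightarrow> x \<otimes> J = x"
  using unit unfolding cstar_unit_def by blast+

lemma T [simp, intro]: "a \<in> \<AA> \<Longrightarrow> T a \<in> carrier B"
  using T_partial_isometry unfolding partial_isometry_def by blast

lemma T_star_T: "a \<in> \<AA> \<Longrightarrow> T a \<otimes> (star B (T a) \<otimes> T a) = T a"
  using T_partial_isometry[of a] unfolding partial_isometry_def by (metis T mult_assoc star_closed)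

lemma star_T_T: "a \<in> \<AA> \<Longrightarrow> star B (T a) \<otimes> (T a \<otimes> star B (T a)) = star B (T a)"
proof -
  assume a: "a \<in> \<AA>"
  have "star B (T a \<otimes> (star B (T a) \<otimes> T a)) = star B (T a) \<otimes> (T a \<otimes> star B (T a))"
    using a by (simp add: star_mult mult_assoc)
  then show ?thesis unfolding T_star_T[OF a] by (rule sym)
qed

text \<open>The relations of a partial isometry allow both range projections to be inserted between
  \<open>star B (T a)\<close> and \<open>T b\<close>, and their product vanishes.\<close>

lemma star_T_T_orthogonal:
  assumes ab: "a \<in> \<AA>" "b \<in> \<AA>" "a \<noteq> b" shows "star B (T a) \<otimes> T b = \<zero>"
proof -
  have p: "T k \<otimes> star B (T k) \<in> carrier B" "star B (T k \<otimes> star B (T k)) = T k \<otimes> star B (T k)"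
    "(T k \<otimes> star B (T k)) \<otimes> (T k \<otimes> star B (T k)) = T k \<otimes> star B (T k)" if "k \<in> \<AA>" for k
    using that star_T_T[OF that] by (simp_all add: star_mult mult_assoc)
  have "T a \<otimes> star B (T a) \<otimes> (T b \<otimes> star B (T b)) = \<zero>"
    using projections_orthogonal[OF unit finite_alphabet p sum_T ab(2,1)] ab(3) by blast
  moreover have "star B (T a) \<otimes> T b = (star B (T a) \<otimes> (T a \<otimes> star B (T a))) \<otimes> (T b \<otimes> (star B (T b) \<otimes> T b))"
    using ab by (simp only: star_T_T T_star_T)
  moreover have "\<dots> = star B (T a) \<otimes> ((T a \<otimes> star B (T a) \<otimes> (T b \<otimes> star B (T b))) \<otimes> T b)"
    using ab by (simp add: mult_assoc)
  ultimately show ?thesis using ab by simp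
qed

lemma W_single: "a \<in> \<AA> \<Longrightarrow> W [a] = T a"
  by (simp add: word_elem_def)

lemma W_closed: "\<mu> \<in> lists \<AA> \<Longrightarrow> W \<mu> \<in> carrier B"
  by (rule word_elem_closed) auto

lemma W_snoc: "\<mu> \<in> lists \<AA> \<Longrightarrow> a \<in> \<AA> \<Longrightarrow> W (\<mu> @ [a]) = W \<mu> \<otimes> T a"
  by (rule word_elem_snoc[OF unit]) auto

section \<open>Covariant representations of function algebras\<close>

definition covariant where
  "covariant E \<pi> \<longleftrightarrow> function_algebra X E \<and> star_hom (fn_alg X E) B \<pi> \<and> \<pi> (indicator X) = J \<and>
    (\<forall>a\<in>\<AA>. indicator (fol a) \<in> E \<and> \<pi> (indicator (fol a)) = star B (T a) \<otimes> T a \<and>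
      (\<forall>f\<in>E. lambda_op X a f \<in> E \<and> \<pi> f \<otimes> T a = T a \<otimes> \<pi> (lambda_op X a f)))"

lemma covariantD:
  assumes "covariant E \<pi>"
  shows "function_algebra X E" "star_hom (fn_alg X E) B \<pi>" "\<pi> (indicator X) = J"
    "a \<in> \<AA> \<Longrightarrow> indicator (fol a) \<in> E" "a \<in> \<AA> \<Longrightarrow> \<pi> (indicator (fol a)) = star B (T a) \<otimes> T a"
    "a \<in> \<AA> \<Longrightarrow> f \<in> E \<Longrightarrow> lambda_op X a f \<in> E"
    "a \<in> \<AA> \<Longrightarrow> f \<in> E \<Longrightarrow> \<pi> f \<otimes> T a = T a \<otimes> \<pi> (lambda_op X a f)"
  using assms unfolding covariant_def by blast+

text \<open>The source projection of \<open>T a\<close> is \<open>\<pi> (indicator (fol a))\<close>,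
  so functions supported in \<open>fol a\<close> are represented in its corner. This absorbs the
  factors \<open>star B (T a) \<otimes> T a\<close> that arise when \<open>T a\<close> meets its
  adjoint.\<close>

lemma covariant_fol_mult:
  assumes c: "covariant E \<pi>" and a: "a \<in> \<AA>" and f: "f \<in> E" "\<And>x. indicator (fol a) x * f x = f x"
  shows "star B (T a) \<otimes> T a \<otimes> \<pi> f = \<pi> f" "\<pi> f \<otimes> (star B (T a) \<otimes> T a) = \<pi> f"
proof -
  note k = star_hom_fn_algD(4)[OF covariantD(2)[OF c]]
  have "\<pi> (indicator (fol a)) \<otimes> \<pi> f = \<pi> (\<lambda>x. indicator (fol a) x * f x)"
    by (rule k[OF covariantD(4)[OF c a] f(1), symmetric])
  then show "star B (T a) \<otimes> T a \<otimes> \<pi> f = \<pi> f" unfolding f(2) covariantD(5)[OF c a] .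
  have f2: "f x * indicator (fol a) x = f x" for x
    using f(2)[of x] by (simp only: mult.commute[of "f x"])
  have "\<pi> f \<otimes> \<pi> (indicator (fol a)) = \<pi> (\<lambda>x. f x * indicator (fol a) x)"
    by (rule k[OF f(1) covariantD(4)[OF c a], symmetric])
  then show "\<pi> f \<otimes> (star B (T a) \<otimes> T a) = \<pi> f" unfolding f2 covariantD(5)[OF c a] .
qed

text \<open>\<open>b\<close> and \<open>c\<close> are approximated separately because
  \<open>t\<close> need not be invertible, so \<open>c\<close> is not determined by
  \<open>b\<close>. Used for limits inside one algebra and again for the passage to
  \<open>D\<close>.\<close>

lemma commutation_limit:
  assumes c: "b \<in> carrier B" "t \<in> carrier B" "c \<in> carrier B"
    and approx: "\<And>e. e > 0 \<Longrightarrow> \<exists>b'\<in>carrier B. \<exists>c'\<in>carrier B.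
      b' \<otimes> t = t \<otimes> c' \<and> nrm B (b \<ominus> b') \<le> e \<and> nrm B (c' \<ominus> c) \<le> e"
  shows "b \<otimes> t = t \<otimes> c"
proof (rule eq_if_close)
  show "b \<otimes> t \<in> carrier B" "t \<otimes> c \<in> carrier B" using c by auto
  fix e :: real assume "e > 0"
  then obtain b' c' where d: "b' \<in> carrier B" "c' \<in> carrier B" "b' \<otimes> t = t \<otimes> c'"
    "nrm B (b \<ominus> b') \<le> e" "nrm B (c' \<ominus> c) \<le> e" using approx by blast
  have "nrm B (b \<otimes> t \<ominus> t \<otimes> c) \<le> nrm B ((b \<ominus> b') \<otimes> t) + nrm B (t \<otimes> (c' \<ominus> c))"
    using nrm_minus_triangle[of "b \<otimes> t" "b' \<otimes> t" "t \<otimes> c"] c d(1-3) by (simp add: minus_distribs)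
  also have "\<dots> \<le> nrm B (b \<ominus> b') * nrm B t + nrm B t * nrm B (c' \<ominus> c)"
    using c d by (intro add_mono nrm_mult) auto
  also have "\<dots> \<le> e * nrm B t + nrm B t * e"
    using c d by (intro add_mono mult_left_mono mult_right_mono) (auto intro: nrm_nonneg)
  finally show "nrm B (b \<otimes> t \<ominus> t \<otimes> c) \<le> (2 * nrm B t) * e" by (simp add: mult_ac)
qed

lemma intertwining_limit:
  assumes E: "function_algebra X E" and k: "star_hom (fn_alg X E) B k" and a: "a \<in> \<AA>"
    and lam: "\<And>g. g \<in> E \<Longrightarrow> lambda_op X a g \<in> E" and f: "f \<in> E"
    and g: "unif_limit {g \<in> E. k g \<otimes> T a = T a \<otimes> k (lambda_op X a g)} f"
  shows "k f \<otimes> T a = T a \<otimes> k (lambda_op X a f)"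
proof (rule commutation_limit)
  note kc = star_hom_fn_algD(1)[OF k]
  show "k f \<in> carrier B" "T a \<in> carrier B" "k (lambda_op X a f) \<in> carrier B" using kc f lam a by auto
  fix e :: real assume e: "e > 0"
  then obtain g where g: "g \<in> E" "k g \<otimes> T a = T a \<otimes> k (lambda_op X a g)" "\<And>x. cmod (f x - g x) \<le> e"
    using g unfolding unif_limit_def by blast
  have 1: "nrm B (k f \<ominus> k g) \<le> e"
    using star_hom_contractive[OF E k function_algebra_minus[OF E f g(1)] g(3)]
    unfolding star_hom_minus[OF E k f g(1)] .
  have "cmod (lambda_op X a g x - lambda_op X a f x) \<le> e" for x
    using lambda_op_diff_le[of g f e X a x] g(3) e by (simp add: norm_minus_commute)
  from star_hom_contractive[OF E k function_algebra_minus[OF E lam[OF g(1)] lam[OF f]] this]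
  have 2: "nrm B (k (lambda_op X a g) \<ominus> k (lambda_op X a f)) \<le> e"
    unfolding star_hom_minus[OF E k lam[OF g(1)] lam[OF f]] .
  show "\<exists>b'\<in>carrier B. \<exists>c'\<in>carrier B. b' \<otimes> T a = T a \<otimes> c' \<and> nrm B (k f \<ominus> b') \<le> e \<and>
      nrm B (c' \<ominus> k (lambda_op X a f)) \<le> e"
    using g(2) 1 2 kc[OF g(1)] kc[OF lam[OF g(1)]] by blast
qed

lemma covariant_base: "covariant AX h"
proof -
  note hD = star_hom_fn_algD[OF h_hom]
  have rel: "h f \<otimes> T a = T a \<otimes> h (lambda_op X a f)" if a: "a \<in> \<AA>" and f: "f \<in> AX" for a f
    using f
  proof (induction rule: AX_induct)
    case (gen f)
    then obtain \<mu> where f: "f = indicator (follower_set X \<mu>)" and mu: "\<mu> \<in> lists \<AA>" by (auto simp: fol_gens_def)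
    note [simp] = W_closed[OF mu] T[OF a]
    have "h f \<otimes> T a = star B (W \<mu>) \<otimes> W \<mu> \<otimes> (W [a] \<otimes> star B (W [a])) \<otimes> T a"
      using T_star_T[OF a] by (simp add: f h_follower[OF mu] W_single[OF a] mult_assoc)
    \<comment> \<open>Expanding \<open>T a\<close> has produced its range projection, which (b) for
      the one-letter word \<open>[a]\<close> moves to the front. What then stands behind the leading
      \<open>T a\<close> is the source projection of the word \<open>\<mu>\<close> followed by
      \<open>a\<close>, to which (c) applies.\<close>
    also have "\<dots> = W [a] \<otimes> star B (W [a]) \<otimes> (star B (W \<mu>) \<otimes> W \<mu>) \<otimes> T a"
      using a by (subst word_commute[OF mu]) auto
    also have "\<dots> = T a \<otimes> (star B (W (\<mu> @ [a])) \<otimes> W (\<mu> @ [a]))"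
      by (simp add: W_single[OF a] W_snoc[OF mu a] star_mult mult_assoc)
    also have "\<dots> = T a \<otimes> h (lambda_op X a f)"
      using mu a by (simp add: f lambda_op_follower h_follower)
    finally show ?case .
  next
    case (add f g)
    note c = add(1,2) lambda_op_AX[OF a add(1)] lambda_op_AX[OF a add(2)]
    from add(3,4) show ?case
      using hD(1)[OF c(1)] hD(1)[OF c(2)] hD(1)[OF c(3)] hD(1)[OF c(4)] a
      by (simp only: lambda_op_distribs(1) hD(2)[OF c(1,2)] hD(2)[OF c(3,4)] mult_l_distr mult_r_distr T)
  next
    case (mult f g)
    note c = mult(1,2) lambda_op_AX[OF a mult(1)] lambda_op_AX[OF a mult(2)]
    note [simp] = hD(1)[OF c(1)] hD(1)[OF c(2)] hD(1)[OF c(3)] hD(1)[OF c(4)] T[OF a]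
    have "h f \<otimes> h g \<otimes> T a = h f \<otimes> (h g \<otimes> T a)" by (simp add: mult_assoc)
    also have "\<dots> = (h f \<otimes> T a) \<otimes> h (lambda_op X a g)" unfolding mult(4) by (simp add: mult_assoc)
    also have "\<dots> = T a \<otimes> (h (lambda_op X a f) \<otimes> h (lambda_op X a g))" unfolding mult(3) by (simp add: mult_assoc)
    finally show ?case unfolding lambda_op_distribs(2) hD(4)[OF c(1,2)] hD(4)[OF c(3,4)] .
  next
    case (smult b f)
    note c = smult(1) lambda_op_AX[OF a smult(1)]
    show ?case
      unfolding lambda_op_distribs(3) hD(3)[OF c(1)] hD(3)[OF c(2)]
      using smult(2) hD(1)[OF c(1)] hD(1)[OF c(2)] a by (simp add: mult_smult_left mult_smult_right)
  next
    case (limit f)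
    have "unif_limit {g \<in> AX. h g \<otimes> T a = T a \<otimes> h (lambda_op X a g)} f" by (rule limit(2))
    from intertwining_limit[OF AX_fa(1) h_hom a lambda_op_AX[OF a] limit(1) this] show ?case .
  qed
  have fo: "h (indicator (fol a)) = star B (T a) \<otimes> T a" if "a \<in> \<AA>" for a
    using h_follower[of "[a]"] that by (simp add: W_single)
  show ?thesis
    unfolding covariant_def using AX_fa(1) h_hom h_unit fol_in(1) fo lambda_op_AX rel by blast
qed

section \<open>One-step extension along \<open>lambda_op\<close>\<close>

definition step_dom where
  "step_dom E = {f \<in> carrier (bounded_functions X). \<forall>a\<in>\<AA>. lambda_op X a f \<in> E}"

definition step_map where
  "step_map \<pi> f = (\<Oplus>a\<in>\<AA>. T a \<otimes> \<pi> (lambda_op X a f) \<otimes> star B (T a))"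

lemma function_algebra_step:
  assumes c: "covariant E \<pi>" shows "function_algebra X (step_dom E)"
proof -
  note E = covariantD(1)[OF c]
  note b = function_algebraD[OF function_algebra_bounded_functions] and e = function_algebraD[OF E]
  have mem: "f \<in> step_dom E \<longleftrightarrow> f \<in> carrier (bounded_functions X) \<and> (\<forall>a\<in>\<AA>. lambda_op X a f \<in> E)" for f
    by (simp add: step_dom_def)
  show ?thesis
    unfolding function_algebra_def
  proof (intro conjI ballI allI impI)
    show "step_dom E \<subseteq> carrier (bounded_functions X)" by (auto simp: mem)
    show "indicator X \<in> step_dom E"
      unfolding mem lambda_op_unit using b(2) covariantD(4)[OF c] by blast
    fix f g c assume f: "f \<in> step_dom E"
    then show "(\<lambda>x. c * f x) \<in> step_dom E" "(\<lambda>x. cnj (f x)) \<in> step_dom E"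
      unfolding mem lambda_op_distribs(3,4) using b(4,6) e(4,6) by blast+
    assume "g \<in> step_dom E"
    with f show "(\<lambda>x. f x + g x) \<in> step_dom E" "(\<lambda>x. f x * g x) \<in> step_dom E"
      unfolding mem lambda_op_distribs(1,2) using b(3,5) e(3,5) by blast+
  next
    fix f assume f: "unif_limit (step_dom E) f"
    have "f \<in> carrier (bounded_functions X)"
      by (rule b(7)) (rule unif_limit_mono[OF f], auto simp: mem)
    moreover have "lambda_op X a f \<in> E" if "a \<in> \<AA>" for a
      by (rule e(7), rule unif_limit_lambda_op[OF f[unfolded step_dom_def]]) (use that in auto)
    ultimately show "f \<in> step_dom E" by (simp add: mem)
  qed
qed

text \<open>Orthogonality of the ranges leaves only the summand at \<open>a\<close>.\<close>

lemma star_T_sum: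
  assumes a: "a \<in> \<AA>" and x: "\<And>b. b \<in> \<AA> \<Longrightarrow> x b \<in> carrier B"
  shows "star B (T a) \<otimes> (\<Oplus>b\<in>\<AA>. T b \<otimes> x b) = star B (T a) \<otimes> T a \<otimes> x a"
proof -
  have "star B (T a) \<otimes> (\<Oplus>b\<in>\<AA>. T b \<otimes> x b) = (\<Oplus>b\<in>\<AA>. star B (T a) \<otimes> (T b \<otimes> x b))"
    using a x finite_alphabet by (intro mult_finsum) auto
  also have "\<dots> = star B (T a) \<otimes> (T a \<otimes> x a)"
    using a x finite_alphabet star_T_T_orthogonal[OF a]
    by (intro finsum_single[where f = "\<lambda>b. star B (T a) \<otimes> (T b \<otimes> x b)"]) (auto simp: mult_assoc[symmetric])
  finally show ?thesis using a x by (simp add: mult_assoc)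
qed

lemma sum_T_mult:
  assumes a: "a \<in> \<AA>" and x: "\<And>b. b \<in> \<AA> \<Longrightarrow> x b \<in> carrier B"
  shows "(\<Oplus>b\<in>\<AA>. x b \<otimes> star B (T b)) \<otimes> T a = x a \<otimes> (star B (T a) \<otimes> T a)"
proof -
  have "(\<Oplus>b\<in>\<AA>. x b \<otimes> star B (T b)) \<otimes> T a = (\<Oplus>b\<in>\<AA>. x b \<otimes> star B (T b) \<otimes> T a)"
    using a x finite_alphabet by (intro finsum_mult) auto
  also have "\<dots> = x a \<otimes> star B (T a) \<otimes> T a"
    using a x finite_alphabet star_T_T_orthogonal[OF _ a]
    by (intro finsum_single[where f = "\<lambda>b. x b \<otimes> star B (T b) \<otimes> T a"]) (auto simp: mult_assoc)
  finally show ?thesis using a x by (simp add: mult_assoc)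
qed

text \<open>Inserting (a) after \<open>\<pi> f\<close> and moving \<open>\<pi> f\<close> past each
  \<open>T a\<close> produces the formula of \<open>step_map\<close>. The same computation forces
  this formula on any covariant extension.\<close>

lemma step_map_extends:
  assumes c: "covariant E \<pi>" and f: "f \<in> E" shows "f \<in> step_dom E" "step_map \<pi> f = \<pi> f"
proof -
  note E = covariantD(1)[OF c] and k = star_hom_fn_algD[OF covariantD(2)[OF c]] and cD = covariantD[OF c]
  show "f \<in> step_dom E" using f function_algebraD(1)[OF E] cD(6) by (auto simp: step_dom_def)
  have "step_map \<pi> f = (\<Oplus>a\<in>\<AA>. \<pi> f \<otimes> (T a \<otimes> star B (T a)))"
    unfolding step_map_def using f k(1) cD(6) cD(7)[OF _ f, symmetric] 
    by (intro finsum_cong') (auto simp: mult_assoc)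
  also have "\<dots> = \<pi> f \<otimes> J"
    unfolding sum_T[symmetric] using finite_alphabet k(1)[OF f] by (intro mult_finsum[symmetric]) auto
  finally show "step_map \<pi> f = \<pi> f" using k(1)[OF f] by simp
qed

lemma covariant_step:
  assumes c: "covariant E \<pi>" shows "covariant (step_dom E) (step_map \<pi>)"
proof -
  note E = covariantD(1)[OF c] and k = star_hom_fn_algD[OF covariantD(2)[OF c]] and cD = covariantD[OF c]
    and ext = step_map_extends[OF c]
  have dom: "lambda_op X a f \<in> E" if "a \<in> \<AA>" "f \<in> step_dom E" for a f using that by (simp add: step_dom_def)
  have P: "\<pi> (lambda_op X a f) \<in> carrier B" if "a \<in> \<AA>" "f \<in> step_dom E" for a f using k(1) dom that by blast
  have map_eq: "step_map \<pi> f = (\<Oplus>a\<in>\<AA>. T a \<otimes> (\<pi> (lambda_op X a f) \<otimes> star B (T a)))" if "f \<in> step_dom E" for f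
    unfolding step_map_def using P[OF _ that] by (intro finsum_cong') (auto simp: mult_assoc)
  \<comment> \<open>The counterpart of the covariance relation on the side of the adjoints.
    Multiplicativity is derived from it.\<close>
  have starT: "star B (T a) \<otimes> step_map \<pi> f = \<pi> (lambda_op X a f) \<otimes> star B (T a)"
    if a: "a \<in> \<AA>" and f: "f \<in> step_dom E" for a f
  proof -
    have "star B (T a) \<otimes> step_map \<pi> f = star B (T a) \<otimes> T a \<otimes> (\<pi> (lambda_op X a f) \<otimes> star B (T a))"
      unfolding map_eq[OF f] using P[OF _ f] by (intro star_T_sum[OF a]) auto
    also have "\<dots> = (star B (T a) \<otimes> T a \<otimes> \<pi> (lambda_op X a f)) \<otimes> star B (T a)"
      using a P[OF a f] by (simp add: mult_assoc)
    also have "star B (T a) \<otimes> T a \<otimes> \<pi> (lambda_op X a f) = \<pi> (lambda_op X a f)"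
      by (rule covariant_fol_mult(1)[OF c a dom[OF a f]]) simp
    finally show ?thesis .
  qed
  have closed: "step_map \<pi> f \<in> carrier B" if "f \<in> step_dom E" for f
    unfolding step_map_def using P[OF _ that] by (intro finsum_closed) auto
  have hom: "star_hom (fn_alg X (step_dom E)) B (step_map \<pi>)"
  proof (rule star_hom_fn_algI)
    fix f g :: "(nat \<Rightarrow> 'a) \<Rightarrow> complex" and d
    assume f: "f \<in> step_dom E"
    show "step_map \<pi> f \<in> carrier B" by (rule closed[OF f])
    show "step_map \<pi> (\<lambda>x. d * f x) = d \<odot>\<^bsub>B\<^esub> step_map \<pi> f"
      unfolding step_map_def lambda_op_distribs(3)
      using k(3)[OF dom[OF _ f]] P[OF _ f] finite_alphabet
      by (subst smult_finsum) (auto simp: mult_smult_left mult_smult_right intro!: finsum_cong')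
    show "step_map \<pi> (\<lambda>x. cnj (f x)) = star B (step_map \<pi> f)"
      unfolding step_map_def lambda_op_distribs(4)
      using k(5)[OF dom[OF _ f]] P[OF _ f] finite_alphabet
      by (subst star_finsum) (auto simp: star_mult mult_assoc intro!: finsum_cong')
    assume g: "g \<in> step_dom E"
    have "step_map \<pi> (\<lambda>x. f x + g x) = (\<Oplus>a\<in>\<AA>. T a \<otimes> \<pi> (lambda_op X a f) \<otimes> star B (T a) \<oplus> T a \<otimes> \<pi> (lambda_op X a g) \<otimes> star B (T a))"
      unfolding step_map_def lambda_op_distribs(1)
      using k(2)[OF dom[OF _ f] dom[OF _ g]] P[OF _ f] P[OF _ g]
      by (intro finsum_cong') (auto simp: mult_l_distr mult_r_distr)
    also have "\<dots> = step_map \<pi> f \<oplus> step_map \<pi> g"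
      unfolding step_map_def using P[OF _ f] P[OF _ g] by (intro finsum_addf) auto
    finally show "step_map \<pi> (\<lambda>x. f x + g x) = step_map \<pi> f \<oplus> step_map \<pi> g" .
    \<comment> \<open>Only the first factor is expanded; \<open>starT\<close> pulls the whole second
      factor through \<open>star B (T a)\<close>, so no double sum appears.\<close>
    have "step_map \<pi> f \<otimes> step_map \<pi> g = (\<Oplus>a\<in>\<AA>. T a \<otimes> \<pi> (lambda_op X a f) \<otimes> star B (T a) \<otimes> step_map \<pi> g)"
      unfolding step_map_def[of \<pi> f] using P[OF _ f] closed[OF g] finite_alphabet by (intro finsum_mult) auto
    also have "\<dots> = (\<Oplus>a\<in>\<AA>. T a \<otimes> \<pi> (lambda_op X a (\<lambda>x. f x * g x)) \<otimes> star B (T a))"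
      unfolding lambda_op_distribs(2)
      using P[OF _ f] P[OF _ g] closed[OF g] starT[OF _ g] k(4)[OF dom[OF _ f] dom[OF _ g]]
      by (intro finsum_cong') (auto simp: mult_assoc)
    finally show "step_map \<pi> (\<lambda>x. f x * g x) = step_map \<pi> f \<otimes> step_map \<pi> g" unfolding step_map_def[of \<pi> "\<lambda>x. f x * g x"] by (rule sym)
  qed
  have rel: "step_map \<pi> f \<otimes> T a = T a \<otimes> step_map \<pi> (lambda_op X a f)" if a: "a \<in> \<AA>" and f: "f \<in> step_dom E" for a f
  proof -
    have "step_map \<pi> f \<otimes> T a = T a \<otimes> \<pi> (lambda_op X a f) \<otimes> (star B (T a) \<otimes> T a)"
      unfolding step_map_def using P[OF _ f] by (intro sum_T_mult[OF a]) auto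
    also have "\<dots> = T a \<otimes> (\<pi> (lambda_op X a f) \<otimes> (star B (T a) \<otimes> T a))"
      using a P[OF a f] by (simp add: mult_assoc)
    also have "\<pi> (lambda_op X a f) \<otimes> (star B (T a) \<otimes> T a) = \<pi> (lambda_op X a f)"
      by (rule covariant_fol_mult(2)[OF c a dom[OF a f]]) simp
    also have "\<pi> (lambda_op X a f) = step_map \<pi> (lambda_op X a f)" by (rule ext(2)[OF dom[OF a f], symmetric])
    finally show ?thesis .
  qed
  have "step_map \<pi> (indicator X) = J"
    using ext(2)[OF function_algebraD(2)[OF E]] cD(3) by simp
  moreover have "indicator (fol a) \<in> step_dom E" "step_map \<pi> (indicator (fol a)) = star B (T a) \<otimes> T a" if "a \<in> \<AA>" for a
    using ext[OF cD(4)[OF that]] cD(5)[OF that] by simp_all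
  moreover have "lambda_op X a f \<in> step_dom E" if "a \<in> \<AA>" "f \<in> step_dom E" for a f
    by (rule ext(1)[OF dom[OF that]])
  ultimately show ?thesis
    unfolding covariant_def using function_algebra_step[OF c] hom rel by blast
qed

text \<open>\<open>cdom n\<close> consists of the \<open>f\<close> with \<open>\<lambda>\<^sub>\<mu> f \<in> A\<^sub>X\<close> for all words \<open>\<mu>\<close> of length \<open>n\<close>.\<close>

definition "cdom n = (step_dom ^^ n) AX"
definition "crep n = (step_map ^^ n) h"

lemma covariant_rep: "covariant (cdom n) (crep n)"
  by (induction n) (simp_all add: cdom_def crep_def covariant_base covariant_step)

lemma dom_mono: "m \<le> n \<Longrightarrow> cdom m \<subseteq> cdom n"
  by (rule lift_Suc_mono_le[of cdom]) (use step_map_extends(1)[OF covariant_rep] in \<open>auto simp: cdom_def\<close>)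

lemma rep_eq: "m \<le> n \<Longrightarrow> f \<in> cdom m \<Longrightarrow> crep n f = crep m f"
proof (induction n rule: dec_induct)
  case (step n)
  have "f \<in> cdom n" using dom_mono[OF step(1)] step(4) by blast
  then show ?case using step_map_extends(2)[OF covariant_rep[of n]] step by (simp add: crep_def)
qed simp

text \<open>Each application of \<open>step_dom\<close> pays for one letter: pull-backs strip the
  first letter of \<open>\<nu>\<close>, and after \<open>length \<nu>\<close> steps a follower set
  remains, whose indicator lies in \<open>AX\<close>.\<close>

lemma cylinder2_in_dom:
  assumes "\<mu> \<in> lists \<AA>" "\<nu> \<in> lists \<AA>" shows "indicator (cylinder2 X \<mu> \<nu>) \<in> cdom (length \<nu>)"
  using assms(2)
proof induction
  case Nil
  then show ?case using follower_in_AX[OF assms(1)] by (simp add: cdom_def cylinder2_Nil)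
next
  case (Cons b \<nu>)
  let ?n = "length \<nu>"
  note fa = covariantD(1)[OF covariant_rep[of ?n]]
  have "(\<lambda>x. indicator (cylinder2 X \<mu> \<nu>) x * indicator (fol b) x) \<in> cdom ?n"
    using Cons covariantD(4)[OF covariant_rep] by (intro function_algebraD(5)[OF fa]) auto
  then have "lambda_op X a (indicator (cylinder2 X \<mu> (b # \<nu>))) \<in> cdom ?n" for a
    using function_algebra_zero[OF fa] by (simp add: lambda_op_cylinder2)
  moreover have "cdom (Suc ?n) = step_dom (cdom ?n)" by (simp add: cdom_def)
  ultimately show ?case
    using cylinder2_subset by (simp add: step_dom_def indicator_in_bounded)
qed

text \<open>The graph of the continuous extension of the maps \<open>crep n\<close> to the closure of the union of their domains.\<close>

definition limit_rel where
  "limit_rel f b \<longleftrightarrow> f \<in> carrier (bounded_functions X) \<and> b \<in> carrier B \<and>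
    (\<forall>e>0. \<exists>n. \<exists>g\<in>cdom n. (\<forall>x. cmod (f x - g x) \<le> e) \<and> nrm B (b \<ominus> crep n g) \<le> e)"

lemma crep_closed [simp, intro]: "g \<in> cdom n \<Longrightarrow> crep n g \<in> carrier B"
  using star_hom_fn_algD(1)[OF covariantD(2)[OF covariant_rep]] .

lemmas cdom_fa = covariantD(1)[OF covariant_rep]
lemmas crep_hom = covariantD(2)[OF covariant_rep]

lemma limit_relE:
  assumes "limit_rel f b" "e > 0"
  obtains g n where "g \<in> cdom n" "\<And>x. cmod (f x - g x) \<le> e" "nrm B (b \<ominus> crep n g) \<le> e"
  using assms unfolding limit_rel_def by blast

lemma limit_relE2:
  assumes L: "limit_rel f b" "limit_rel f' b'" and e: "e > 0"
  obtains g n g' where "g \<in> cdom n" "\<And>x. cmod (f x - g x) \<le> e" "nrm B (b \<ominus> crep n g) \<le> e"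
    "g' \<in> cdom n" "\<And>x. cmod (f' x - g' x) \<le> e" "nrm B (b' \<ominus> crep n g') \<le> e"
proof -
  obtain g n where g: "g \<in> cdom n" "\<And>x. cmod (f x - g x) \<le> e" "nrm B (b \<ominus> crep n g) \<le> e"
    by (rule limit_relE[OF L(1) e]) blast
  obtain g' m where g': "g' \<in> cdom m" "\<And>x. cmod (f' x - g' x) \<le> e" "nrm B (b' \<ominus> crep m g') \<le> e"
    by (rule limit_relE[OF L(2) e]) blast
  let ?k = "max n m"
  have k: "g \<in> cdom ?k" "g' \<in> cdom ?k" using g(1) g'(1) dom_mono[of n ?k] dom_mono[of m ?k] by auto
  have eq: "crep ?k g = crep n g" "crep ?k g' = crep m g'" using rep_eq g(1) g'(1) by auto
  show thesis
    by (rule that[OF k(1) g(2) _ k(2) g'(2)]) (simp_all only: eq g(3) g'(3))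
qed

text \<open>\<open>C\<close> lets algebraic operations lose a fixed factor; restricting to
  \<open>e \<le> 1\<close> keeps approximants uniformly bounded, as the product estimate
  requires.\<close>

lemma limit_relI:
  assumes f: "f \<in> carrier (bounded_functions X)" and b: "b \<in> carrier B" and C: "C > 0"
    and *: "\<And>e. \<lbrakk>0 < e; e \<le> 1\<rbrakk> \<Longrightarrow>
      \<exists>n. \<exists>g\<in>cdom n. (\<forall>x. cmod (f x - g x) \<le> C * e) \<and> nrm B (b \<ominus> crep n g) \<le> C * e"
  shows "limit_rel f b"
  unfolding limit_rel_def
proof (intro conjI f b allI impI)
  fix e :: real assume "e > 0"
  define d where "d = min 1 (e / C)"
  have "0 < d" "d \<le> 1" using \<open>e > 0\<close> C by (auto simp: d_def)
  moreover have "C * d \<le> e"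
    using mult_left_mono[of d "e / C" C] C by (simp add: d_def)
  ultimately show "\<exists>n. \<exists>g\<in>cdom n. (\<forall>x. cmod (f x - g x) \<le> e) \<and> nrm B (b \<ominus> crep n g) \<le> e"
  proof -
    assume Cd: "C * d \<le> e" and d: "0 < d" "d \<le> 1"
    obtain g n where g: "g \<in> cdom n" "\<And>x. cmod (f x - g x) \<le> C * d" "nrm B (b \<ominus> crep n g) \<le> C * d"
      using *[OF d] by blast
    show ?thesis
      by (rule exI[of _ n], rule bexI[OF _ g(1)]) (intro conjI allI order_trans[OF _ Cd] g)
  qed
qed

lemma limit_rel_carrier: "limit_rel f b \<Longrightarrow> b \<in> carrier B" "limit_rel f b \<Longrightarrow> f \<in> carrier (bounded_functions X)"
  unfolding limit_rel_def by blast+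

lemma crep_diff:
  assumes "g \<in> cdom n" "g' \<in> cdom n" "\<And>x. cmod (g x - g' x) \<le> d"
  shows "nrm B (crep n g \<ominus> crep n g') \<le> d"
  using star_hom_contractive[OF cdom_fa crep_hom function_algebra_minus[OF cdom_fa assms(1,2)] assms(3)]
  unfolding star_hom_minus[OF cdom_fa crep_hom assms(1,2)] .

text \<open>The relation is the graph of a contraction. With \<open>d = 0\<close> this gives
  uniqueness of values, with small \<open>d\<close> the Cauchy property in
  \<open>limit_rel_exists\<close>.\<close>

lemma limit_rel_diff:
  assumes L: "limit_rel f b" "limit_rel f' b'" and d: "\<And>x. cmod (f x - f' x) \<le> d"
  shows "nrm B (b \<ominus> b') \<le> d"
proof (rule field_le_epsilon)
  fix e :: real assume "e > 0"
  \<comment> \<open>Each of the two approximations costs \<open>e / 4\<close> in the distance of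
    \<open>g\<close> from \<open>g'\<close> and another \<open>e / 4\<close> in \<open>B\<close>, in
    total \<open>e\<close>.\<close>
  then have e: "e / 4 > 0" by simp
  obtain g n g' where g: "g \<in> cdom n" "\<And>x. cmod (f x - g x) \<le> e / 4" "nrm B (b \<ominus> crep n g) \<le> e / 4"
    "g' \<in> cdom n" "\<And>x. cmod (f' x - g' x) \<le> e / 4" "nrm B (b' \<ominus> crep n g') \<le> e / 4"
    by (rule limit_relE2[OF L e]) blast
  have "cmod (g x - g' x) \<le> d + e / 2" for x
  proof -
    have "cmod (g x - g' x) \<le> cmod (g x - f x) + (cmod (f x - f' x) + cmod (f' x - g' x))"
      by (rule order_trans[OF norm_triangle_ineq[of "g x - f x" "f x - g' x", simplified]])
        (rule add_left_mono, use norm_triangle_ineq[of "f x - f' x" "f' x - g' x"] in simp)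
    then show ?thesis using g(2)[of x] g(5)[of x] d[of x] by (simp add: norm_minus_commute[of "g x"])
  qed
  then have 1: "nrm B (crep n g \<ominus> crep n g') \<le> d + e / 2" by (rule crep_diff[OF g(1,4)])
  note c = limit_rel_carrier(1)[OF L(1)] limit_rel_carrier(1)[OF L(2)] crep_closed[OF g(1)] crep_closed[OF g(4)]
  have "nrm B (b \<ominus> b') \<le> nrm B (b \<ominus> crep n g) + (nrm B (crep n g \<ominus> crep n g') + nrm B (crep n g' \<ominus> b'))"
    using nrm_minus_triangle[OF c(1,3,2)] nrm_minus_triangle[OF c(3,4,2)] by simp
  then show "nrm B (b \<ominus> b') \<le> d + e"
    using 1 g(3,6) nrm_minus_commute[OF c(2,4)] by simp
qed

lemma limit_rel_unique: "limit_rel f b \<Longrightarrow> limit_rel f b' \<Longrightarrow> b = b'"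
  using limit_rel_diff[of f b f b' 0] limit_rel_carrier(1) by (intro eq_if_close[where c = 0]) auto

lemma limit_rel_crep:
  assumes g: "g \<in> cdom n" shows "limit_rel g (crep n g)"
proof (rule limit_relI[where C = 1])
  show "g \<in> carrier (bounded_functions X)" using g function_algebraD(1)[OF cdom_fa] by blast
  show "\<exists>m. \<exists>g'\<in>cdom m. (\<forall>x. cmod (g x - g' x) \<le> 1 * e) \<and> nrm B (crep n g \<ominus> crep m g') \<le> 1 * e"
    if "0 < e" for e
    using g that by (intro exI[of _ n] bexI[of _ g]) auto
qed (use g in auto)

lemma limit_rel_add:
  assumes L: "limit_rel f b" "limit_rel f' b'"
  shows "limit_rel (\<lambda>x. f x + f' x) (b \<oplus> b')"
proof (rule limit_relI[where C = 2])
  note c = limit_rel_carrier(1)[OF L(1)] limit_rel_carrier(1)[OF L(2)]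
  show "(\<lambda>x. f x + f' x) \<in> carrier (bounded_functions X)"
    using function_algebraD(3)[OF function_algebra_bounded_functions] limit_rel_carrier(2) L by blast
  show "b \<oplus> b' \<in> carrier B" using c by simp
  fix e :: real assume e: "e > 0"
  obtain g n g' where g: "g \<in> cdom n" "\<And>x. cmod (f x - g x) \<le> e" "nrm B (b \<ominus> crep n g) \<le> e"
    "g' \<in> cdom n" "\<And>x. cmod (f' x - g' x) \<le> e" "nrm B (b' \<ominus> crep n g') \<le> e"
    by (rule limit_relE2[OF L e]) blast
  have "cmod (f x + f' x - (g x + g' x)) \<le> 2 * e" for x
    using norm_triangle_ineq[of "f x - g x" "f' x - g' x"] g(2)[of x] g(5)[of x] by (simp add: algebra_simps)
  moreover have "(\<lambda>x. g x + g' x) \<in> cdom n" by (rule function_algebraD(3)[OF cdom_fa g(1,4)])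
  moreover have "nrm B (b \<oplus> b' \<ominus> crep n (\<lambda>x. g x + g' x)) \<le> 2 * e"
    unfolding star_hom_fn_algD(2)[OF crep_hom g(1,4)] minus_swap[OF c crep_closed[OF g(1)] crep_closed[OF g(4)]]
    using nrm_triangle[of "b \<ominus> crep n g" "b' \<ominus> crep n g'"] g c by simp
  ultimately show "\<exists>n. \<exists>g\<in>cdom n. (\<forall>x. cmod (f x + f' x - g x) \<le> 2 * e) \<and> nrm B (b \<oplus> b' \<ominus> crep n g) \<le> 2 * e"
    by (intro exI[of _ n] bexI[of _ "\<lambda>x. g x + g' x"]) auto
qed simp

lemma limit_rel_smult:
  assumes L: "limit_rel f b" shows "limit_rel (\<lambda>x. d * f x) (d \<odot>\<^bsub>B\<^esub> b)"
proof (rule limit_relI[where C = "cmod d + 1"])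
  note c = limit_rel_carrier(1)[OF L(1)]
  show "(\<lambda>x. d * f x) \<in> carrier (bounded_functions X)"
    using function_algebraD(4)[OF function_algebra_bounded_functions] limit_rel_carrier(2) L by blast
  show "d \<odot>\<^bsub>B\<^esub> b \<in> carrier B" using c by simp
  fix e :: real assume e: "e > 0"
  obtain g n where g: "g \<in> cdom n" "\<And>x. cmod (f x - g x) \<le> e" "nrm B (b \<ominus> crep n g) \<le> e"
    by (rule limit_relE[OF L e]) blast
  have le: "cmod d * t \<le> (cmod d + 1) * e" if "t \<le> e" for t
    using mult_left_mono[OF that, of "cmod d"] e by (simp add: algebra_simps)
  have "cmod (d * f x - d * g x) \<le> (cmod d + 1) * e" for x
    using le[OF g(2)[of x]] by (simp add: norm_mult flip: right_diff_distrib)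
  moreover have "(\<lambda>x. d * g x) \<in> cdom n" by (rule function_algebraD(4)[OF cdom_fa g(1)])
  moreover have "nrm B (d \<odot>\<^bsub>B\<^esub> b \<ominus> crep n (\<lambda>x. d * g x)) \<le> (cmod d + 1) * e"
    unfolding star_hom_fn_algD(3)[OF crep_hom g(1)] smult_minus[OF c crep_closed[OF g(1)], symmetric]
    using le[OF g(3)] c g(1) by (simp add: nrm_smult)
  ultimately show "\<exists>n. \<exists>g\<in>cdom n. (\<forall>x. cmod (d * f x - g x) \<le> (cmod d + 1) * e) \<and>
      nrm B (d \<odot>\<^bsub>B\<^esub> b \<ominus> crep n g) \<le> (cmod d + 1) * e"
    by (intro exI[of _ n] bexI[of _ "\<lambda>x. d * g x"]) auto
qed (simp add: add_nonneg_pos)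

lemma limit_rel_cnj:
  assumes L: "limit_rel f b" shows "limit_rel (\<lambda>x. cnj (f x)) (star B b)"
proof (rule limit_relI[where C = 1])
  note c = limit_rel_carrier(1)[OF L(1)]
  show "(\<lambda>x. cnj (f x)) \<in> carrier (bounded_functions X)"
    using function_algebraD(6)[OF function_algebra_bounded_functions] limit_rel_carrier(2) L by blast
  show "star B b \<in> carrier B" using c by simp
  fix e :: real assume e: "e > 0"
  obtain g n where g: "g \<in> cdom n" "\<And>x. cmod (f x - g x) \<le> e" "nrm B (b \<ominus> crep n g) \<le> e"
    by (rule limit_relE[OF L e]) blast
  have "cmod (cnj (f x) - cnj (g x)) \<le> e" for x
    using g(2)[of x] by (metis complex_cnj_diff complex_mod_cnj)
  moreover have "(\<lambda>x. cnj (g x)) \<in> cdom n" by (rule function_algebraD(6)[OF cdom_fa g(1)])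
  moreover have "nrm B (star B b \<ominus> crep n (\<lambda>x. cnj (g x))) \<le> e"
    unfolding star_hom_fn_algD(5)[OF crep_hom g(1)] star_minus[OF c crep_closed[OF g(1)], symmetric]
    using g c by (simp add: nrm_star)
  ultimately show "\<exists>n. \<exists>g\<in>cdom n. (\<forall>x. cmod (cnj (f x) - g x) \<le> 1 * e) \<and>
      nrm B (star B b \<ominus> crep n g) \<le> 1 * e"
    by (intro exI[of _ n] bexI[of _ "\<lambda>x. cnj (g x)"]) auto
qed simp

lemma limit_rel_mult:
  assumes L: "limit_rel f b" "limit_rel f' b'"
  shows "limit_rel (\<lambda>x. f x * f' x) (b \<otimes> b')"
proof -
  note c = limit_rel_carrier(1)[OF L(1)] limit_rel_carrier(1)[OF L(2)]
  obtain K K' where K: "\<And>x. cmod (f x) \<le> K" "\<And>x. cmod (f' x) \<le> K'"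
  proof -
    have "bounded (range f)" "bounded (range f')"
      using limit_rel_carrier(2)[OF L(1)] limit_rel_carrier(2)[OF L(2)]
      by (simp_all add: carrier_bounded_functions)
    then show thesis using that unfolding bounded_iff by blast
  qed
  have K0: "0 \<le> K" "0 \<le> K'" using order_trans[OF norm_ge_zero K(1)[of undefined]] order_trans[OF norm_ge_zero K(2)[of undefined]] .
  \<comment> \<open>\<open>C\<close> serves both estimates: \<open>K' + 1\<close> bounds
    \<open>g'\<close> and \<open>nrm B b' + 1\<close> bounds the norm of \<open>crep n g'\<close>,
    the added \<open>1\<close> allowing for an error \<open>e \<le> 1\<close>.\<close>
  define C where "C = max (K + K' + 1) (nrm B b + nrm B b' + 1)"
  have C: "K + (K' + 1) \<le> C" "nrm B b + (nrm B b' + 1) \<le> C" by (simp_all add: C_def)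
  \<comment> \<open>\<open>uv - u'v' = u(v - v') + (u - u')v'\<close>\<close>
  show ?thesis
  proof (rule limit_relI[where C = C])
    show "(\<lambda>x. f x * f' x) \<in> carrier (bounded_functions X)"
      using function_algebraD(5)[OF function_algebra_bounded_functions] limit_rel_carrier(2) L by blast
    show "b \<otimes> b' \<in> carrier B" using c by simp
    show "C > 0" using C(1) K0 by linarith
    fix e :: real assume e: "e > 0" "e \<le> 1"
    obtain g n g' where g: "g \<in> cdom n" "\<And>x. cmod (f x - g x) \<le> e" "nrm B (b \<ominus> crep n g) \<le> e"
      "g' \<in> cdom n" "\<And>x. cmod (f' x - g' x) \<le> e" "nrm B (b' \<ominus> crep n g') \<le> e"
      by (rule limit_relE2[OF L e(1)]) blast
    have bound: "k * e + e * (k' + 1) \<le> C * e" if "k + (k' + 1) \<le> C" for k k'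
      using mult_right_mono[OF that, of e] e by (simp add: algebra_simps)
    have "cmod (f x * f' x - g x * g' x) \<le> C * e" for x
    proof -
      have "cmod (g' x) \<le> K' + 1"
        using norm_triangle_ineq2[of "g' x" "f' x"] g(5)[of x] K(2)[of x] e by (simp add: norm_minus_commute)
      then have "cmod (f x * (f' x - g' x)) \<le> K * e" "cmod ((f x - g x) * g' x) \<le> e * (K' + 1)"
        unfolding norm_mult using K(1)[of x] g(2)[of x] g(5)[of x] K0 e by (intro mult_mono; simp)+
      moreover have "f x * f' x - g x * g' x = f x * (f' x - g' x) + (f x - g x) * g' x" by (simp add: algebra_simps)
      ultimately have "cmod (f x * f' x - g x * g' x) \<le> K * e + e * (K' + 1)"
        by (simp only: order_trans[OF norm_triangle_ineq add_mono])
      then show ?thesis using bound[OF C(1)] by simp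
    qed
    moreover have "(\<lambda>x. g x * g' x) \<in> cdom n" by (rule function_algebraD(5)[OF cdom_fa g(1,4)])
    moreover have "nrm B (b \<otimes> b' \<ominus> crep n (\<lambda>x. g x * g' x)) \<le> C * e"
    proof -
      define y y' where y: "y = crep n g" "y' = crep n g'"
      have yc: "y \<in> carrier B" "y' \<in> carrier B" using g by (auto simp: y)
      have "nrm B y' \<le> nrm B b' + nrm B (b' \<ominus> y')"
      proof -
        have "nrm B ((y' \<ominus> b') \<oplus> b') \<le> nrm B (y' \<ominus> b') + nrm B b'"
          using yc c by (intro nrm_triangle) auto
        then show ?thesis using yc c by (simp add: minus_add_cancel nrm_minus_commute[of y'])
      qed
      then have "nrm B y' \<le> nrm B b' + 1" using g(6) e by (simp add: y)
      then have "nrm B b * nrm B (b' \<ominus> y') + nrm B (b \<ominus> y) * nrm B y' \<le> nrm B b * e + e * (nrm B b' + 1)"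
        using g(3,6) e yc c nrm_nonneg by (intro add_mono mult_mono) (auto simp: y)
      moreover have "nrm B (b \<otimes> b' \<ominus> y \<otimes> y') \<le> nrm B (b \<otimes> (b' \<ominus> y')) + nrm B ((b \<ominus> y) \<otimes> y')"
        using nrm_minus_triangle[of "b \<otimes> b'" "b \<otimes> y'" "y \<otimes> y'"] c yc by (simp add: minus_distribs)
      moreover have "nrm B (b \<otimes> (b' \<ominus> y')) \<le> nrm B b * nrm B (b' \<ominus> y')" "nrm B ((b \<ominus> y) \<otimes> y') \<le> nrm B (b \<ominus> y) * nrm B y'"
        using c yc by (auto intro!: nrm_mult)
      ultimately have "nrm B (b \<otimes> b' \<ominus> y \<otimes> y') \<le> C * e" using bound[OF C(2)] by linarith
      then show ?thesis unfolding star_hom_fn_algD(4)[OF crep_hom g(1,4)] y .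
    qed
    ultimately show "\<exists>n. \<exists>g\<in>cdom n. (\<forall>x. cmod (f x * f' x - g x) \<le> C * e) \<and> nrm B (b \<otimes> b' \<ominus> crep n g) \<le> C * e"
      by (intro exI[of _ n] bexI[of _ "\<lambda>x. g x * g' x"]) auto
  qed
qed

text \<open>Approximants within \<open>1 / Suc k\<close> are chosen in algebras
  \<open>cdom (N k)\<close>, where \<open>N k\<close> may be unbounded. Their images form a Cauchy
  sequence all the same, and completeness of \<open>B\<close> supplies the value at
  \<open>f\<close>.\<close>

lemma limit_rel_exists:
  assumes f: "unif_limit {g. \<exists>b. limit_rel g b} f"
  shows "\<exists>b. limit_rel f b"
proof -
  have "\<exists>n. \<exists>g\<in>cdom n. \<forall>x. cmod (f x - g x) \<le> e" if e: "e > 0" for e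
  proof -
    have "e / 2 > 0" using e by simp
    then obtain g b where g: "limit_rel g b" "\<And>x. cmod (f x - g x) \<le> e / 2"
      using f unfolding unif_limit_def by blast
    obtain g' n where g': "g' \<in> cdom n" "\<And>x. cmod (g x - g' x) \<le> e / 2"
      by (rule limit_relE[OF g(1) \<open>e / 2 > 0\<close>]) blast
    have "cmod (f x - g' x) \<le> e" for x
      using norm_triangle_ineq[of "f x - g x" "g x - g' x"] g(2)[of x] g'(2)[of x] by simp
    then show ?thesis using g'(1) by blast
  qed
  then have "\<forall>k. \<exists>n g. g \<in> cdom n \<and> (\<forall>x. cmod (f x - g x) \<le> 1 / real (Suc k))" 
    by (metis of_nat_0_less_iff zero_less_Suc zero_less_divide_1_iff)
  then obtain N G where G: "\<And>k. G k \<in> cdom (N k)" "\<And>k x. cmod (f x - G k x) \<le> 1 / real (Suc k)"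
    by metis
  define y where "y k = crep (N k) (G k)" for k
  have y: "limit_rel (G k) (y k)" for k unfolding y_def by (rule limit_rel_crep[OF G(1)])
  have yc: "y k \<in> carrier B" for k by (rule limit_rel_carrier[OF y])
  have small: "\<exists>N. \<forall>m\<ge>N. 1 / real (Suc m) \<le> e" if e: "e > 0" for e
  proof -
    obtain N where N: "1 / real (Suc N) < e" using reals_Archimedean[OF e] by (auto simp: inverse_eq_divide)
    have "1 / real (Suc m) \<le> 1 / real (Suc N)" if "m \<ge> N" for m using that by (intro divide_left_mono) auto
    with N show ?thesis by (meson less_imp_le order_trans)
  qed
  have ydiff: "nrm B (y m \<ominus> y n) \<le> 1 / real (Suc m) + 1 / real (Suc n)" for m n
  proof (rule limit_rel_diff[OF y y])
    fix x
    show "cmod (G m x - G n x) \<le> 1 / real (Suc m) + 1 / real (Suc n)"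
      using norm_triangle_ineq[of "G m x - f x" "f x - G n x"] G(2)[of x m] G(2)[of x n]
      by (simp add: norm_minus_commute[of "G m x"])
  qed
  have "\<exists>N. \<forall>m\<ge>N. \<forall>n\<ge>N. nrm B (y m \<ominus> y n) < e" if e: "e > 0" for e
  proof -
    have "e / 4 > 0" using e by simp
    then obtain N where N: "\<And>m. m \<ge> N \<Longrightarrow> 1 / real (Suc m) \<le> e / 4" using small by blast
    have "nrm B (y m \<ominus> y n) < e" if "m \<ge> N" "n \<ge> N" for m n
      using ydiff[of m n] N[OF that(1)] N[OF that(2)] e by linarith
    then show ?thesis by blast
  qed
  from Cauchy_limit[of y, OF yc this] obtain b where b: "b \<in> carrier B" "\<And>e. e > 0 \<Longrightarrow> \<exists>N. \<forall>n\<ge>N. nrm B (b \<ominus> y n) < e"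
    by blast
  have "unif_limit (carrier (bounded_functions X)) f"
    using f by (rule unif_limit_mono) (auto dest: limit_rel_carrier(2))
  then have fc: "f \<in> carrier (bounded_functions X)" by (rule function_algebraD(7)[OF function_algebra_bounded_functions])
  have "limit_rel f b"
  proof (rule limit_relI[OF fc b(1), where C = 1])
    fix e :: real assume e: "e > 0"
    obtain N1 where N1: "\<And>n. n \<ge> N1 \<Longrightarrow> nrm B (b \<ominus> y n) < e" using b(2)[OF e] by blast
    obtain N2 where N2: "\<And>m. m \<ge> N2 \<Longrightarrow> 1 / real (Suc m) \<le> e" using small[OF e] by blast
    let ?k = "max N1 N2"
    have "cmod (f x - G ?k x) \<le> 1 * e" for x using G(2)[of x ?k] N2[of ?k] by simp
    moreover have "nrm B (b \<ominus> crep (N ?k) (G ?k)) \<le> 1 * e" using N1[of ?k] by (simp add: y_def)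
    ultimately show "\<exists>n. \<exists>g\<in>cdom n. (\<forall>x. cmod (f x - g x) \<le> 1 * e) \<and> nrm B (b \<ominus> crep n g) \<le> 1 * e"
      using G(1)[of ?k] by (intro exI[of _ "N ?k"] bexI[of _ "G ?k"]) auto
  qed simp
  then show ?thesis ..
qed

lemma limit_rel_D: "f \<in> D \<Longrightarrow> \<exists>b. limit_rel f b"
proof (induction rule: D_induct)
  case (gen f)
  then show ?case using cylinder2_in_dom limit_rel_crep by (auto simp: cyl_gens_def) blast
next
  case (limit f)
  show ?case by (rule limit_rel_exists) (rule unif_limit_mono[OF limit(2)], auto)
qed (blast intro: limit_rel_add limit_rel_smult limit_rel_mult)+

lemma limit_rel_T:
  assumes a: "a \<in> \<AA>" and L: "limit_rel f b" "limit_rel (lambda_op X a f) c"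
  shows "b \<otimes> T a = T a \<otimes> c"
proof (rule commutation_limit)
  show "b \<in> carrier B" "c \<in> carrier B" "T a \<in> carrier B" using limit_rel_carrier(1) L a by auto
  fix e :: real assume e: "e > 0"
  obtain g n where g: "g \<in> cdom n" "\<And>x. cmod (f x - g x) \<le> e" "nrm B (b \<ominus> crep n g) \<le> e"
    by (rule limit_relE[OF L(1) e]) blast
  have lg: "lambda_op X a g \<in> cdom n" by (rule covariantD(6)[OF covariant_rep a g(1)])
  have 2: "nrm B (crep n (lambda_op X a g) \<ominus> c) \<le> e"
  proof (rule limit_rel_diff[OF limit_rel_crep[OF lg] L(2)])
    show "cmod (lambda_op X a g x - lambda_op X a f x) \<le> e" for x
      using lambda_op_diff_le[of g f e X a x] g(2) e by (simp add: norm_minus_commute)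
  qed
  show "\<exists>b'\<in>carrier B. \<exists>c'\<in>carrier B. b' \<otimes> T a = T a \<otimes> c' \<and> nrm B (b \<ominus> b') \<le> e \<and> nrm B (c' \<ominus> c) \<le> e"
    using covariantD(7)[OF covariant_rep a g(1)] g(3) 2 crep_closed[OF g(1)] crep_closed[OF lg] by blast
qed

lemma covariant_D_exists: "\<exists>\<pi>. covariant D \<pi>"
proof -
  \<comment> \<open>The values are mere choices. Each algebraic law follows from uniqueness, as both
    of its sides are related to the same function.\<close>
  obtain \<pi> where pi: "\<And>f. f \<in> D \<Longrightarrow> limit_rel f (\<pi> f)"
    using limit_rel_D by metis
  note u = limit_rel_unique[OF pi] and fa = function_algebraD[OF D_fa(1)]
  have "star_hom (fn_alg X D) B \<pi>"
  proof (rule star_hom_fn_algI)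
    fix f g d assume f: "f \<in> D"
    show "\<pi> f \<in> carrier B" by (rule limit_rel_carrier(1)[OF pi[OF f]])
    show "\<pi> (\<lambda>x. d * f x) = d \<odot>\<^bsub>B\<^esub> \<pi> f" by (rule u[OF fa(4)[OF f] limit_rel_smult[OF pi[OF f]]])
    show "\<pi> (\<lambda>x. cnj (f x)) = star B (\<pi> f)" by (rule u[OF fa(6)[OF f] limit_rel_cnj[OF pi[OF f]]])
    assume g: "g \<in> D"
    show "\<pi> (\<lambda>x. f x + g x) = \<pi> f \<oplus> \<pi> g" by (rule u[OF fa(3)[OF f g] limit_rel_add[OF pi[OF f] pi[OF g]]])
    show "\<pi> (\<lambda>x. f x * g x) = \<pi> f \<otimes> \<pi> g" by (rule u[OF fa(5)[OF f g] limit_rel_mult[OF pi[OF f] pi[OF g]]])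
  qed
  \<comment> \<open>\<open>AX\<close> is \<open>cdom 0\<close> and \<open>h\<close> is
    \<open>crep 0\<close>, so uniqueness identifies \<open>\<pi>\<close> with \<open>h\<close>
    there.\<close>
  moreover have 0: "\<pi> f = h f" if "f \<in> AX" for f
    using u[of f "h f"] limit_rel_crep[of f 0] that AX_fa(2) by (auto simp: cdom_def crep_def)
  have "\<pi> (indicator X) = J" using 0[OF function_algebraD(2)[OF AX_fa(1)]] h_unit by simp
  moreover have "\<pi> (indicator (fol a)) = star B (T a) \<otimes> T a" if "a \<in> \<AA>" for a
    using 0[OF fol_in(1)[OF that]] covariantD(5)[OF covariant_base that] by simp
  moreover have "\<pi> f \<otimes> T a = T a \<otimes> \<pi> (lambda_op X a f)" if "a \<in> \<AA>" "f \<in> D" for a f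
    by (rule limit_rel_T[OF that(1) pi[OF that(2)] pi[OF lambda_op_D[OF that]]])
  ultimately have "covariant D \<pi>"
    unfolding covariant_def using D_fa(1) fol_in(2) lambda_op_D by blast
  then show ?thesis by (rule exI[of _ \<pi>])
qed

section \<open>The universal property\<close>

definition psi where "psi \<pi> \<xi> = (\<Oplus>a\<in>\<AA>. T a \<otimes> \<pi> (\<xi> a))"

context
  fixes \<pi> assumes cov: "covariant D \<pi>"
begin

lemmas pi_hom = covariantD(2)[OF cov]
lemmas pi = star_hom_fn_algD[OF pi_hom]

lemma pi_H: "\<xi> \<in> carrier H \<Longrightarrow> a \<in> \<AA> \<Longrightarrow> \<pi> (\<xi> a) \<in> carrier B"
  by (rule pi(1)[OF H_in(1)])

lemma pi_sum:
  assumes "finite F" "\<And>i. i \<in> F \<Longrightarrow> f i \<in> D"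
  shows "\<pi> (\<lambda>x. \<Sum>i\<in>F. f i x) = (\<Oplus>i\<in>F. \<pi> (f i))"
  using assms
proof (induction F)
  case empty
  show ?case using star_hom_zero[OF D_fa(1) pi_hom] by simp
next
  case (insert i F)
  have c: "(\<lambda>i. \<pi> (f i)) \<in> F \<rightarrow> carrier B" "\<pi> (f i) \<in> carrier B" using insert pi(1) by auto
  have "\<pi> (\<lambda>x. \<Sum>i\<in>insert i F. f i x) = \<pi> (\<lambda>x. f i x + (\<Sum>i\<in>F. f i x))"
    using insert(1,2) by simp
  also have "\<dots> = \<pi> (f i) \<oplus> \<pi> (\<lambda>x. \<Sum>i\<in>F. f i x)"
    using insert by (intro pi(2) function_algebra_sum[OF D_fa(1)]) auto
  also have "\<dots> = \<pi> (f i) \<oplus> (\<Oplus>i\<in>F. \<pi> (f i))" using insert by simp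
  finally show ?case unfolding finsum_insert[OF insert(1,2) c] .
qed

lemma psi_closed [simp, intro]: "\<xi> \<in> carrier H \<Longrightarrow> psi \<pi> \<xi> \<in> carrier B"
  unfolding psi_def by (intro finsum_closed) (auto intro: pi_H)

text \<open>\<open>star B (T a)\<close> reads off the coordinate at \<open>a\<close>, as pairing
  with \<open>xi X a\<close> does in the module. The remaining source projection is absorbed because
  \<open>\<xi> a\<close> vanishes outside \<open>fol a\<close>.\<close>

lemma star_T_psi:
  assumes a: "a \<in> \<AA>" and xi: "\<xi> \<in> carrier H" shows "star B (T a) \<otimes> psi \<pi> \<xi> = \<pi> (\<xi> a)"
proof -
  have "star B (T a) \<otimes> psi \<pi> \<xi> = star B (T a) \<otimes> T a \<otimes> \<pi> (\<xi> a)"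
    unfolding psi_def using pi_H[OF xi] by (intro star_T_sum[OF a]) auto
  also have "\<dots> = \<pi> (\<xi> a)"
    by (rule covariant_fol_mult(1)[OF cov a H_in(1)[OF xi a] H_follower_mult[OF xi]])
  finally show ?thesis .
qed

lemma psi_mult:
  assumes xi: "\<xi> \<in> carrier H" and f: "f \<in> D" shows "psi \<pi> (\<lambda>a x. \<xi> a x * f x) = psi \<pi> \<xi> \<otimes> \<pi> f"
proof -
  note [simp] = pi_H[OF xi]
  have "psi \<pi> \<xi> \<otimes> \<pi> f = (\<Oplus>a\<in>\<AA>. T a \<otimes> \<pi> (\<xi> a) \<otimes> \<pi> f)"
    unfolding psi_def using xi pi(1)[OF f] finite_alphabet by (intro finsum_mult) auto
  also have "\<dots> = psi \<pi> (\<lambda>a x. \<xi> a x * f x)"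
    unfolding psi_def using xi pi(1)[OF f] pi(4)[OF H_in(1)[OF xi] f]
    by (intro finsum_cong') (auto simp: mult_assoc)
  finally show ?thesis by (rule sym)
qed

lemma psi_toeplitz: "toeplitz_representation (D_alg \<AA> X) H (left_action \<AA> X) B (psi \<pi>) \<pi>"
  unfolding toeplitz_representation_def H_simps(1-4)
proof (intro conjI ballI allI)
  show "psi \<pi> \<in> carrier H \<rightarrow> carrier B" by auto
  show "star_hom (D_alg \<AA> X) B \<pi>" by (subst D_alg_eq) (rule pi_hom)
  fix \<xi> assume xi: "\<xi> \<in> carrier H"
  note [simp] = pi_H[OF xi]
  show "psi \<pi> (\<lambda>a x. \<xi> a x * f x) = psi \<pi> \<xi> \<otimes> \<pi> f" if "f \<in> D" for f
    by (rule psi_mult[OF xi that])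
  show "psi \<pi> (\<lambda>a x. c * \<xi> a x) = c \<odot>\<^bsub>B\<^esub> psi \<pi> \<xi>" for c
    unfolding psi_def using pi(3)[OF H_in(1)[OF xi]] xi finite_alphabet
    by (subst smult_finsum) (auto simp: mult_smult_right intro!: finsum_cong')
  show "psi \<pi> (left_action \<AA> X f \<xi>) = \<pi> f \<otimes> psi \<pi> \<xi>" if f: "f \<in> D" for f
  proof -
    have "\<pi> f \<otimes> psi \<pi> \<xi> = (\<Oplus>a\<in>\<AA>. \<pi> f \<otimes> (T a \<otimes> \<pi> (\<xi> a)))"
      unfolding psi_def using xi pi(1)[OF f] finite_alphabet by (intro mult_finsum) auto
    also have "\<dots> = (\<Oplus>a\<in>\<AA>. T a \<otimes> \<pi> (\<lambda>x. lambda_op X a f x * \<xi> a x))"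
    proof (intro finsum_cong' refl)
      fix a assume a: "a \<in> \<AA>"
      note c = pi(1)[OF f] pi(1)[OF lambda_op_D[OF a f]] pi_H[OF xi a] T[OF a]
      have "\<pi> f \<otimes> (T a \<otimes> \<pi> (\<xi> a)) = (\<pi> f \<otimes> T a) \<otimes> \<pi> (\<xi> a)" using c by (simp add: mult_assoc)
      also have "\<dots> = T a \<otimes> (\<pi> (lambda_op X a f) \<otimes> \<pi> (\<xi> a))"
        unfolding covariantD(7)[OF cov a f] using c by (simp add: mult_assoc)
      finally show "\<pi> f \<otimes> (T a \<otimes> \<pi> (\<xi> a)) = T a \<otimes> \<pi> (\<lambda>x. lambda_op X a f x * \<xi> a x)"
        unfolding pi(4)[OF lambda_op_D[OF a f] H_in(1)[OF xi a]] .
    qed (use pi(1)[OF function_algebraD(5)[OF D_fa(1) lambda_op_D[OF _ f] H_in(1)[OF xi]]] in auto)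
    finally show ?thesis unfolding left_action_apply[OF xi] psi_def by (rule sym)
  qed
  fix \<eta> assume eta: "\<eta> \<in> carrier H"
  note [simp] = pi_H[OF eta]
  have "psi \<pi> (\<lambda>a x. \<xi> a x + \<eta> a x) = (\<Oplus>a\<in>\<AA>. T a \<otimes> \<pi> (\<xi> a) \<oplus> T a \<otimes> \<pi> (\<eta> a))"
    unfolding psi_def using pi(2)[OF H_in(1)[OF xi] H_in(1)[OF eta]] xi eta
    by (intro finsum_cong') (auto simp: mult_r_distr)
  also have "\<dots> = psi \<pi> \<xi> \<oplus> psi \<pi> \<eta>"
    unfolding psi_def using xi eta by (intro finsum_addf) auto
  finally show "psi \<pi> (\<lambda>a x. \<xi> a x + \<eta> a x) = psi \<pi> \<xi> \<oplus> psi \<pi> \<eta>" .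
  have cn: "(\<lambda>x. cnj (\<xi> a x)) \<in> D" if "a \<in> \<AA>" for a by (rule function_algebraD(6)[OF D_fa(1) H_in(1)[OF xi that]])
  have "star B (psi \<pi> \<xi>) \<otimes> psi \<pi> \<eta> = (\<Oplus>a\<in>\<AA>. star B (T a \<otimes> \<pi> (\<xi> a))) \<otimes> psi \<pi> \<eta>"
    unfolding psi_def[of \<pi> \<xi>] using xi finite_alphabet by (subst star_finsum) auto
  also have "\<dots> = (\<Oplus>a\<in>\<AA>. star B (T a \<otimes> \<pi> (\<xi> a)) \<otimes> psi \<pi> \<eta>)"
    using xi eta finite_alphabet by (intro finsum_mult) auto
  also have "\<dots> = (\<Oplus>a\<in>\<AA>. \<pi> (\<lambda>x. cnj (\<xi> a x) * \<eta> a x))"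
  proof (intro finsum_cong' refl)
    fix a assume a: "a \<in> \<AA>"
    have "star B (T a \<otimes> \<pi> (\<xi> a)) \<otimes> psi \<pi> \<eta> = star B (\<pi> (\<xi> a)) \<otimes> (star B (T a) \<otimes> psi \<pi> \<eta>)"
      using a xi eta by (simp add: star_mult mult_assoc)
    then show "star B (T a \<otimes> \<pi> (\<xi> a)) \<otimes> psi \<pi> \<eta> = \<pi> (\<lambda>x. cnj (\<xi> a x) * \<eta> a x)"
      unfolding star_T_psi[OF a eta] pi(4)[OF cn[OF a] H_in(1)[OF eta a]] pi(5)[OF H_in(1)[OF xi a]] .
  qed (use pi(1)[OF function_algebraD(5)[OF D_fa(1) cn H_in(1)[OF eta]]] in auto)
  also have "\<dots> = \<pi> (\<lambda>x. \<Sum>a\<in>\<AA>. cnj (\<xi> a x) * \<eta> a x)"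
    using function_algebraD(5)[OF D_fa(1) cn H_in(1)[OF eta]] finite_alphabet by (intro pi_sum[symmetric]) auto
  finally show "star B (psi \<pi> \<xi>) \<otimes> psi \<pi> \<eta> = \<pi> (iprod H \<xi> \<eta>)" by (simp only: H_simps(5))
qed

interpretation R: subshift_toeplitz \<AA> X B "psi \<pi>" \<pi>
  by unfold_locales (rule psi_toeplitz)

lemma psi_xi: assumes a: "a \<in> \<AA>" shows "psi \<pi> (xi X a) = T a"
proof -
  have "psi \<pi> (xi X a) = T a \<otimes> \<pi> (xi X a a)"
    unfolding psi_def
  proof (rule finsum_single[where f = "\<lambda>b. T b \<otimes> \<pi> (xi X a b)", OF finite_alphabet a])
    show "T a \<otimes> \<pi> (xi X a a) \<in> carrier B" using pi_H[OF xi_in_H[OF a] a] a by simp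
    fix b assume b: "b \<in> \<AA>" "b \<noteq> a"
    then have "xi X a b = (\<lambda>x. 0)" by (simp add: xi_def)
    then show "T b \<otimes> \<pi> (xi X a b) = \<zero>" using b star_hom_zero[OF D_fa(1) pi_hom] by simp
  qed
  also have "xi X a a = indicator (fol a)" by (simp add: xi_def)
  finally show ?thesis unfolding covariantD(5)[OF cov a] T_star_T[OF a] .
qed

text \<open>By \<open>adjoint_expand\<close>, \<open>U\<close> acts as the finite sum of the
  operators \<open>theta H (U (xi X a)) (xi X a)\<close>. The formula is what an additive map
  sending \<open>theta H \<xi> \<eta>\<close> to
  \<open>psi \<pi> \<xi> \<otimes> star B (psi \<pi> \<eta>)\<close> must give on that sum.\<close>

definition rho where "rho U = (\<Oplus>a\<in>\<AA>. psi \<pi> (U (xi X a)) \<otimes> star B (T a))"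

lemma adjointable_xi: "adjoint_pair H U U' \<Longrightarrow> a \<in> \<AA> \<Longrightarrow> U (xi X a) \<in> carrier H"
  by (rule adjoint_pairD(1)[OF _ xi_in_H])

lemma rho_closed: "adjoint_pair H U U' \<Longrightarrow> rho U \<in> carrier B"
  unfolding rho_def using adjointable_xi by (intro finsum_closed) auto

text \<open>\<open>rho U\<close> acts on the image of \<open>psi \<pi>\<close> as \<open>U\<close>
  acts on the module; multiplicativity and the matrix entries of \<open>rho\<close> are read off
  from this. The proof collapses the sum by \<open>star_T_psi\<close>, which leaves the matrix form
  of \<open>U\<close>.\<close>

lemma rho_psi:
  assumes U: "adjoint_pair H U U'" and z: "\<zeta> \<in> carrier H"
  shows "rho U \<otimes> psi \<pi> \<zeta> = psi \<pi> (U \<zeta>)"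
proof -
  have Ux: "U (xi X a) \<in> carrier H" if "a \<in> \<AA>" for a by (rule adjointable_xi[OF U that])
  have "rho U \<otimes> psi \<pi> \<zeta> = (\<Oplus>a\<in>\<AA>. psi \<pi> (U (xi X a)) \<otimes> star B (T a) \<otimes> psi \<pi> \<zeta>)"
    unfolding rho_def using Ux z finite_alphabet by (intro finsum_mult) auto
  also have "\<dots> = (\<Oplus>a\<in>\<AA>. psi \<pi> (\<lambda>b x. U (xi X a) b x * \<zeta> a x))"
  proof (intro finsum_cong' refl)
    fix a assume a: "a \<in> \<AA>"
    have "psi \<pi> (U (xi X a)) \<otimes> star B (T a) \<otimes> psi \<pi> \<zeta> = psi \<pi> (U (xi X a)) \<otimes> (star B (T a) \<otimes> psi \<pi> \<zeta>)"
      using a z Ux[OF a] by (simp add: mult_assoc)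
    then show "psi \<pi> (U (xi X a)) \<otimes> star B (T a) \<otimes> psi \<pi> \<zeta> = psi \<pi> (\<lambda>b x. U (xi X a) b x * \<zeta> a x)"
      unfolding star_T_psi[OF a z] psi_mult[OF Ux[OF a] H_in(1)[OF z a]] .
  qed (use H_closed(3)[OF Ux H_in(1)[OF z]] in auto)
  also have "\<dots> = psi \<pi> (\<lambda>b x. \<Sum>a\<in>\<AA>. U (xi X a) b x * \<zeta> a x)"
    using R.kH_sum[of \<AA> "\<lambda>a b x. U (xi X a) b x * \<zeta> a x"] H_closed(3)[OF Ux H_in(1)[OF z]] by simp
  also have "(\<lambda>b x. \<Sum>a\<in>\<AA>. U (xi X a) b x * \<zeta> a x) = U \<zeta>"
    by (intro ext adjoint_expand[OF U z, symmetric])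
  finally show ?thesis .
qed

text \<open>Relation (a) resolves the identity on either side of \<open>x\<close>, so an element of
  \<open>B\<close> is determined by its matrix relative to the family \<open>T\<close>.\<close>

lemma eq_by_entries:
  assumes x: "x \<in> carrier B" "y \<in> carrier B"
    and eq: "\<And>a b. a \<in> \<AA> \<Longrightarrow> b \<in> \<AA> \<Longrightarrow> star B (T b) \<otimes> (x \<otimes> T a) = star B (T b) \<otimes> (y \<otimes> T a)"
  shows "x = y"
proof -
  have left: "u = v" if u: "u \<in> carrier B" "v \<in> carrier B"
    and "\<And>b. b \<in> \<AA> \<Longrightarrow> star B (T b) \<otimes> u = star B (T b) \<otimes> v" for u v
  proof -
    have e: "w = (\<Oplus>b\<in>\<AA>. T b \<otimes> (star B (T b) \<otimes> w))" if w: "w \<in> carrier B" for w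
    proof -
      have "w = (\<Oplus>b\<in>\<AA>. T b \<otimes> star B (T b)) \<otimes> w" using w by (simp add: sum_T)
      also have "\<dots> = (\<Oplus>b\<in>\<AA>. T b \<otimes> star B (T b) \<otimes> w)" using w finite_alphabet by (intro finsum_mult) auto
      also have "\<dots> = (\<Oplus>b\<in>\<AA>. T b \<otimes> (star B (T b) \<otimes> w))" using w by (intro finsum_cong') (auto simp: mult_assoc)
      finally show ?thesis .
    qed
    have "(\<Oplus>b\<in>\<AA>. T b \<otimes> (star B (T b) \<otimes> u)) = (\<Oplus>b\<in>\<AA>. T b \<otimes> (star B (T b) \<otimes> v))"
      using that by (intro finsum_cong') auto
    from trans[OF e[OF u(1)] trans[OF this e[OF u(2), symmetric]]] show ?thesis .
  qed
  have xT: "x \<otimes> T a = y \<otimes> T a" if "a \<in> \<AA>" for a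
    by (rule left[OF _ _ eq[OF that]]) (use x that in auto)
  \<comment> \<open>Cancelling the factors on the right is the left-hand argument applied to
    adjoints.\<close>
  have "star B x = star B y"
  proof (rule left)
    fix b assume b: "b \<in> \<AA>"
    have "star B (x \<otimes> T b) = star B (y \<otimes> T b)" by (simp only: xT[OF b])
    then show "star B (T b) \<otimes> star B x = star B (T b) \<otimes> star B y"
      using x b by (simp only: star_mult T)
  qed (use x in auto)
  then show ?thesis using x by (metis star_star)
qed

lemma rho_entry:
  assumes U: "adjoint_pair H U U'" and ab: "a \<in> \<AA>" "b \<in> \<AA>"
  shows "star B (T b) \<otimes> (rho U \<otimes> T a) = \<pi> (U (xi X a) b)"
  using rho_psi[OF U xi_in_H[OF ab(1)]] star_T_psi[OF ab(2) adjointable_xi[OF U ab(1)]]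
  unfolding psi_xi[OF ab(1)] by (simp only:)

text \<open>The formula for \<open>rho\<close> treats source and range differently, so the adjoint
  is not visible in it. Matrix entries are symmetric in the two, and \<open>adjoint_entry\<close>
  matches them.\<close>

lemma rho_star:
  assumes U: "adjoint_pair H U U'" shows "rho U' = star B (rho U)"
proof (rule eq_by_entries)
  note U2 = adjoint_pair_sym[OF U]
  show "rho U' \<in> carrier B" "star B (rho U) \<in> carrier B" using rho_closed[OF U] rho_closed[OF U2] by auto
  fix a b assume ab: "a \<in> \<AA>" "b \<in> \<AA>"
  have "star B (T b) \<otimes> (star B (rho U) \<otimes> T a) = star B (star B (T a) \<otimes> (rho U \<otimes> T b))"
    using ab rho_closed[OF U] by (simp add: star_mult mult_assoc)
  also have "\<dots> = \<pi> (\<lambda>x. cnj (U (xi X b) a x))"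
    unfolding rho_entry[OF U ab(2,1)] by (rule pi(5)[symmetric, OF H_in(1)[OF adjointable_xi[OF U ab(2)] ab(1)]])
  also have "(\<lambda>x. cnj (U (xi X b) a x)) = U' (xi X a) b"
    by (intro ext) (simp only: adjoint_entry[OF U2 ab])
  also have "\<pi> (U' (xi X a) b) = star B (T b) \<otimes> (rho U' \<otimes> T a)" by (rule rho_entry[OF U2 ab, symmetric])
  finally show "star B (T b) \<otimes> (rho U' \<otimes> T a) = star B (T b) \<otimes> (star B (rho U) \<otimes> T a)" by (rule sym)
qed

lemma rho_hom: "star_hom (compact_ops (D_alg \<AA> X) H) B rho"
proof -
  let ?K = "compact_ops (D_alg \<AA> X) H"
  have K: "add ?K = add L" "mult ?K = mult L" "smult ?K = smult L" "star ?K = star L"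
    by (simp_all add: compact_ops_def)
  \<comment> \<open>The closed span enters only through this inclusion: the arguments below work
    with operators that have an adjoint.\<close>
  have adj: "\<exists>U'. adjoint_pair H U U'" if "U \<in> carrier ?K" for U
    using that compact_subset adjointable_carrier by blast
  note kH = R.kH
  have Ux: "U (xi X a) \<in> carrier H" if "U \<in> carrier ?K" "a \<in> \<AA>" for U a
    using adj[OF that(1)] adjointable_xi that(2) by blast
  show ?thesis
    unfolding star_hom_def K
  proof (intro conjI ballI allI)
    show "rho \<in> carrier ?K \<rightarrow> carrier B" using adj rho_closed by blast
    fix U assume U: "U \<in> carrier ?K"
    obtain U' where U': "adjoint_pair H U U'" using adj[OF U] by blast
    show "rho (star L U) = star B (rho U)" unfolding star_adjointable[OF U'] by (rule rho_star[OF U'])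
    show "rho (c \<odot>\<^bsub>L\<^esub> U) = c \<odot>\<^bsub>B\<^esub> rho U" for c
    proof -
      have "rho (c \<odot>\<^bsub>L\<^esub> U) = (\<Oplus>a\<in>\<AA>. c \<odot>\<^bsub>B\<^esub> (psi \<pi> (U (xi X a)) \<otimes> star B (T a)))"
        unfolding rho_def using Ux[OF U] kH(3)[OF Ux[OF U]]
        by (intro finsum_cong') (auto simp: adjointable_simps xi_in_H mult_smult_left)
      then show ?thesis unfolding rho_def using Ux[OF U] finite_alphabet by (subst smult_finsum) auto
    qed
    fix V assume V: "V \<in> carrier ?K"
    obtain V' where V': "adjoint_pair H V V'" using adj[OF V] by blast
    have "rho (U \<oplus>\<^bsub>L\<^esub> V) = (\<Oplus>a\<in>\<AA>. psi \<pi> (U (xi X a)) \<otimes> star B (T a) \<oplus> psi \<pi> (V (xi X a)) \<otimes> star B (T a))"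
      unfolding rho_def using Ux[OF U] Ux[OF V] kH(2)[OF Ux[OF U] Ux[OF V]]
      by (intro finsum_cong') (auto simp: adjointable_simps xi_in_H mult_l_distr)
    also have "\<dots> = rho U \<oplus> rho V"
      unfolding rho_def using Ux[OF U] Ux[OF V] by (intro finsum_addf) auto
    finally show "rho (U \<oplus>\<^bsub>L\<^esub> V) = rho U \<oplus> rho V" .
    have "rho U \<otimes> rho V = (\<Oplus>a\<in>\<AA>. rho U \<otimes> (psi \<pi> (V (xi X a)) \<otimes> star B (T a)))"
      unfolding rho_def[of V] using Ux[OF V] rho_closed[OF U'] finite_alphabet by (intro mult_finsum) auto
    also have "\<dots> = (\<Oplus>a\<in>\<AA>. psi \<pi> ((U \<otimes>\<^bsub>L\<^esub> V) (xi X a)) \<otimes> star B (T a))"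
    proof (intro finsum_cong' refl)
      fix a assume a: "a \<in> \<AA>"
      have "rho U \<otimes> (psi \<pi> (V (xi X a)) \<otimes> star B (T a)) = (rho U \<otimes> psi \<pi> (V (xi X a))) \<otimes> star B (T a)"
        using a Ux[OF V a] rho_closed[OF U'] by (simp add: mult_assoc)
      then show "rho U \<otimes> (psi \<pi> (V (xi X a)) \<otimes> star B (T a)) = psi \<pi> ((U \<otimes>\<^bsub>L\<^esub> V) (xi X a)) \<otimes> star B (T a)"
        unfolding rho_psi[OF U' Ux[OF V a]] by (simp add: adjointable_simps compose_def xi_in_H[OF a])
    qed (use adjoint_pairD(1)[OF U' Ux[OF V]] in \<open>auto simp: adjointable_simps compose_def xi_in_H\<close>)
    finally show "rho (U \<otimes>\<^bsub>L\<^esub> V) = rho U \<otimes> rho V" unfolding rho_def[of "U \<otimes>\<^bsub>L\<^esub> V"] by (rule sym)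
  qed
qed

lemma psi_coinvariant: "cuntz_pimsner_coinvariant (D_alg \<AA> X) H (left_action \<AA> X) B (psi \<pi>) \<pi>"
  unfolding cuntz_pimsner_coinvariant_def induced_hom_def
proof (intro exI[of _ rho] conjI ballI impI)
  show "star_hom (compact_ops (D_alg \<AA> X) H) B rho" by (rule rho_hom)
  fix \<xi> \<eta> assume xi: "\<xi> \<in> carrier H" and eta: "\<eta> \<in> carrier H"
  note [simp] = pi_H[OF eta]
  have cn: "(\<lambda>x. cnj (\<eta> a x)) \<in> D" if "a \<in> \<AA>" for a by (rule function_algebraD(6)[OF D_fa(1) H_in(1)[OF eta that]])
  have th: "theta H \<xi> \<eta> (xi X a) = (\<lambda>b x. \<xi> b x * cnj (\<eta> a x))" if a: "a \<in> \<AA>" for a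
  proof -
    have "iprod H \<eta> (xi X a) x = cnj (\<eta> a x)" for x
      using iprod_cnj[of "xi X a" \<eta> x] unfolding iprod_xi[OF a eta] by (rule sym)
    then show ?thesis using xi_in_H[OF a] by (simp add: theta_def del: H_simps(5))
  qed
  have "psi \<pi> \<xi> \<otimes> star B (psi \<pi> \<eta>) = psi \<pi> \<xi> \<otimes> (\<Oplus>a\<in>\<AA>. star B (T a \<otimes> \<pi> (\<eta> a)))"
    unfolding psi_def[of \<pi> \<eta>] using eta finite_alphabet by (subst star_finsum) auto
  also have "\<dots> = (\<Oplus>a\<in>\<AA>. psi \<pi> \<xi> \<otimes> star B (T a \<otimes> \<pi> (\<eta> a)))"
    using xi eta finite_alphabet by (intro mult_finsum) auto
  also have "\<dots> = rho (theta H \<xi> \<eta>)"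
    unfolding rho_def
  proof (intro finsum_cong' refl)
    fix a assume a: "a \<in> \<AA>"
    have "psi \<pi> \<xi> \<otimes> star B (T a \<otimes> \<pi> (\<eta> a)) = psi \<pi> \<xi> \<otimes> star B (\<pi> (\<eta> a)) \<otimes> star B (T a)"
      using a xi eta by (simp add: star_mult mult_assoc)
    then show "psi \<pi> \<xi> \<otimes> star B (T a \<otimes> \<pi> (\<eta> a)) = psi \<pi> (theta H \<xi> \<eta> (xi X a)) \<otimes> star B (T a)"
      unfolding th[OF a] psi_mult[OF xi cn[OF a]] pi(5)[OF H_in(1)[OF eta a]] .
  qed (use H_closed(3)[OF xi cn] th in auto)
  finally show "rho (theta H \<xi> \<eta>) = psi \<pi> \<xi> \<otimes> star B (psi \<pi> \<eta>)" by (rule sym)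
next
  fix f assume f: "f \<in> D"
  note c = pi(1)[OF f]
  \<comment> \<open>Covariance of the Toeplitz pair sends
    \<open>left_action \<AA> X f (xi X a)\<close> to \<open>\<pi> f \<otimes> T a\<close>, and (a)
    then sums the terms to \<open>\<pi> f\<close>.\<close>
  have "rho (left_action \<AA> X f) = (\<Oplus>a\<in>\<AA>. \<pi> f \<otimes> (T a \<otimes> star B (T a)))"
    unfolding rho_def
  proof (intro finsum_cong' refl)
    fix a assume a: "a \<in> \<AA>"
    have "psi \<pi> (left_action \<AA> X f (xi X a)) = \<pi> f \<otimes> T a"
      using psi_toeplitz xi_in_H[OF a] f unfolding toeplitz_representation_def psi_xi[OF a, symmetric] by blast
    then show "psi \<pi> (left_action \<AA> X f (xi X a)) \<otimes> star B (T a) = \<pi> f \<otimes> (T a \<otimes> star B (T a))"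
      using a c by (simp add: mult_assoc)
  qed (use c in auto)
  also have "\<dots> = \<pi> f \<otimes> J"
    unfolding sum_T[symmetric] using c finite_alphabet by (intro mult_finsum[symmetric]) auto
  finally show "rho (left_action \<AA> X f) = \<pi> f" using c by simp
qed

end

lemma coinvariant_representation_exists:
  "\<exists>\<psi> \<pi>. toeplitz_representation (D_alg \<AA> X) H (left_action \<AA> X) B \<psi> \<pi> \<and>
    cuntz_pimsner_coinvariant (D_alg \<AA> X) H (left_action \<AA> X) B \<psi> \<pi> \<and> (\<forall>a\<in>\<AA>. \<psi> (xi X a) = T a)"
proof -
  obtain \<pi> where "covariant D \<pi>" using covariant_D_exists by blast
  then show ?thesis using psi_toeplitz psi_coinvariant psi_xi by blast
qed

end

theorem theorem7p2:
  fixes \<AA> :: "'a set" and X :: "(nat \<Rightarrow> 'a) set" and Q :: "'o cstar"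
    and k\<^sub>H :: "('a \<Rightarrow> (nat \<Rightarrow> 'a) \<Rightarrow> complex) \<Rightarrow> 'o"
    and k\<^sub>D :: "((nat \<Rightarrow> 'a) \<Rightarrow> complex) \<Rightarrow> 'o"
  assumes "finite \<AA>" and "subshift \<AA> X"
    and "subshift_algebra TYPE('c) \<AA> X Q k\<^sub>H k\<^sub>D"
  defines "S \<equiv> \<lambda>a. k\<^sub>H (xi X a)"
  shows "\<exists>I. cstar_unit Q I \<and>
           subshift_family \<AA> X Q I S \<and>
           cstar_generated Q (S ` \<AA>) = carrier Q \<and>
           (\<forall>(B :: 'c cstar) J T.
              cstar_algebra B \<and> cstar_unit B J \<and> subshift_family \<AA> X B J T \<and>
              cstar_generated B (T ` \<AA>) = carrier B \<longrightarrow>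
              (\<exists>h. star_hom Q B h \<and> (\<forall>a\<in>\<AA>. h (S a) = T a)))"
proof -
  note O = assms(3)[unfolded subshift_algebra_def cuntz_pimsner_algebra_def]
  interpret F: finite_subshift \<AA> X using assms by unfold_locales
  interpret Q: cstar_algebra Q using O by blast
  interpret G: generating_representation \<AA> X Q k\<^sub>H k\<^sub>D
    using O by unfold_locales blast+
  show ?thesis
    unfolding S_def
  proof (intro exI[of _ "k\<^sub>D (indicator X)"] conjI allI impI)
    show "cstar_unit Q (k\<^sub>D (indicator X))" by (rule G.unit)
    show "subshift_family \<AA> X Q (k\<^sub>D (indicator X)) (\<lambda>a. k\<^sub>H (xi X a))" by (rule G.S_family)
    show "cstar_generated Q ((\<lambda>a. k\<^sub>H (xi X a)) ` \<AA>) = carrier Q" by (rule G.S_generates)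
    fix B :: "'c cstar" and J T
    assume B: "cstar_algebra B \<and> cstar_unit B J \<and> subshift_family \<AA> X B J T \<and>
      cstar_generated B (T ` \<AA>) = carrier B"
    then have fam: "subshift_family \<AA> X B J T" and gen: "cstar_generated B (T ` \<AA>) = carrier B" by blast+
    \<comment> \<open>Generation by the \<open>T a\<close> identifies the target algebra in (c) with
      \<open>B\<close> itself.\<close>
    obtain h where h: "star_hom (A_alg \<AA> X) (B\<lparr>carrier := carrier B\<rparr>) h" "h (indicator X) = J"
      "\<And>\<mu>. \<mu> \<in> lists \<AA> \<Longrightarrow> h (indicator (follower_set X \<mu>)) = star B (word_elem B J T \<mu>) \<otimes>\<^bsub>B\<^esub> word_elem B J T \<mu>"
      using fam unfolding subshift_family_def gen by blast
    have hom: "star_hom (fn_alg X (carrier (A_alg \<AA> X))) B h"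
      using h(1) by (subst F.A_alg_eq[symmetric]) simp
    interpret B: cstar_algebra B using B by blast
    interpret U: generating_family \<AA> X B J T h
    proof
      show "cstar_unit B J" using B by blast
    qed (use fam hom h(2,3) in \<open>unfold subshift_family_def Let_def, blast+\<close>)
    obtain \<psi> \<pi> where rep: "toeplitz_representation (D_alg \<AA> X) (H_mod \<AA> X) (left_action \<AA> X) B \<psi> \<pi>"
      "cuntz_pimsner_coinvariant (D_alg \<AA> X) (H_mod \<AA> X) (left_action \<AA> X) B \<psi> \<pi>" "\<forall>a\<in>\<AA>. \<psi> (xi X a) = T a"
      using U.coinvariant_representation_exists by blast
    \<comment> \<open>The universal property in \<open>O\<close> covers \<open>B\<close>, whose
      elements have type \<open>'c\<close>; at \<open>xi X a\<close> the resulting map takes the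
      value \<open>T a\<close>.\<close>
    obtain \<rho> where "star_hom Q B \<rho>" "\<forall>\<xi>\<in>carrier (H_mod \<AA> X). \<psi> \<xi> = \<rho> (k\<^sub>H \<xi>)"
      using O rep(1,2) B by blast
    then show "\<exists>h. star_hom Q B h \<and> (\<forall>a\<in>\<AA>. h (k\<^sub>H (xi X a)) = T a)"
      using rep(3) F.xi_in_H by (intro exI[of _ \<rho>]) auto
  qed
qed

end
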